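(* Let $\varepsilon\dot X=f(t,X,\varepsilon)$ satisfy hypotheses (HFN1)–(HFN5) of the context (Hopf bifurcation at $t=a$ followed by a focus-node bifurcation at $t=b$). Assume also that there exists a big canard $\tilde X(t)$, i.e. a solution going along the slow curve on the whole interval $]t_m,t_M[$. If a trajectory $X(t)$ goes along the slow curve exactly on an interval $]t_e,t_s[$ with $[t_e,t_s]\subset\,]t_m,t_M[$, then $$\int_{t_e}^{t_s}\Re(\lambda(\tau))\,d\tau\ \le\ 0\ \le\ \int_{t_e}^{t_s}\Re(\mu(\tau))\,d\tau .$$ Conversely, if $t_e<t_s$ with $[t_e,t_s]\subset\,]t_m,t_M[$ satisfy these inequalities, then there exists a trajectory going along the slow curve exactly on $]t_e,t_s[$.
   Context: The language is Nelson's nonstandard analysis: $x\simeq y$ means that $x-y$ is infinitesimal. The function $f$, the domains, $\phi$, $a$, $b$, $t_m$, $t_M$, and the endpoints of the intervals below are standard ($t_m=-\infty$ and $t_M=+\infty$ are allowed); $\varepsilon$ is a fixed parameter. The equation is $\varepsilon\dot X=f(t,X,\varepsilon)$, with $X$ two-dimensional; trajectories are real solutions, for real $t$. Hypotheses: (HFN1) $f$ is analytic on a domain $\mathcal D\subset\mathbb C\times\mathbb C^2\times\mathbb C$ and takes real values when its arguments are real. (HFN2) $\varepsilon$ is real, positive and infinitesimal. (HFN3) There is an analytic function $\phi$ on a complex domain $\mathcal D_t$ with $f(t,\phi(t),0)=0$ for all $t\in\mathcal D_t$. The curve $X=\phi(t)$ is called the slow curve. The intersection of $\mathcal D_t$ with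 the real axis is an interval $]t_m,t_M[$. (HFN4) Let $\lambda(t),\mu(t)$ be the eigenvalues of $D_Xf(t,\phi(t),0)$. There are $a<b$ in $]t_m,t_M[$ such that, for real $t\in\,]t_m,t_M[$: $\Re\lambda(t)$ and $\Re\mu(t)$ are negative for $t<a$, zero for $t=a$, positive for $t>a$; $\Im\lambda(t)<0<\Im\mu(t)$ for $t<b$; and $\Im\lambda(t)=\Im\mu(t)=0$ for $t\ge b$. Moreover $\lambda(t)=\mu(t)$ only at $t=b$. In the complex plane $\lambda$ and $\mu$ are the two determinations of a multivalued function with a square root singularity at $b$; with a cut along $[b,+\infty[$ they satisfy $\mu(\bar t)=\overline{\lambda(t)}$. (HFN5) Let $R_\lambda(t)=\Re\int_a^t\lambda(s)\,ds$ and $R_\mu(t)=\Re\int_a^t\mu(s)\,ds$; these are the two determinations of a multivalued function with a square root singularity at $b$, with $R_\mu(t)=R_\lambda(\bar t)$ off the cut $[b,+\infty[$. For real $t>b$ the determinations are chosen so that $\lambda(t)<\mu(t)$. The function $R_\lambda$ has a unique critical point (zero of $\lambda$), with critical value $R_c$, and $R_\lambda(b)<R_c$. Definitions. The $S$-interior of an interval $]t_1,t_2[$ is the set of limited (finite) $t\in\,]t_1,t_2[$ that are not infinitely close to an endpoint. A solution $X(t)$ goes along the slow curve (at least) on $]t_1,t_2[$ if $X(t)\simeq\phi(t)$ for all $t$ in the $S$-interior of $]t_1,t_2[$. It goes along the slow curve exactly on $]t_e,t_s[$ if it goes along the slow curve at least on $]t_e,t_s[$ and the interval $]t_e,t_s[$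 is maximal for this property. *)

theory Defs
  imports "HOL-Complex_Analysis.Complex_Analysis"
begin

no_notation fps_nth (infixl "$" 75)

section \<open>Nonstandard universe: an ultrapower over the natural numbers\<close>

text \<open>
  Nonstandard objects of type \<open>'a\<close> are classes of sequences modulo a free ultrafilter.
  The standard ones are those of the form \<open>star_of x\<close>; elements of \<open>('a \<Rightarrow> 'b) star\<close> and the like
  are the internal functions.
\<close>

definition free_ultrafilter :: "nat filter \<Rightarrow> bool" where
  "free_ultrafilter F \<longleftrightarrow> F \<noteq> bot \<and> F \<le> sequentially \<and>
     (\<forall>P. eventually P F \<or> eventually (\<lambda>n. \<not> P n) F)"

lemma free_ultrafilter_exists: "\<exists>F. free_ultrafilter F"
proof -
  define A where "A = {F :: nat filter. F \<noteq> bot \<and> F \<le> sequentially}"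
  have "\<exists>m\<in>A. \<forall>F\<in>A. F \<le> m \<longrightarrow> F = m"
  proof (rule predicate_Zorn)
    show "partial_order_on A (relation_of (\<lambda>F G. G \<le> F) A)"
      by (rule partial_order_on_relation_ofI) auto
  next
    fix C assume C: "C \<in> Chains (relation_of (\<lambda>F G. G \<le> F) A)"
    have CA: "C \<subseteq> A"
      using C by (auto simp: Chains_def relation_of_def)
    show "\<exists>u\<in>A. \<forall>F\<in>C. u \<le> F"
    proof (cases "C = {}")
      case True
      have "sequentially \<in> A" by (auto simp: A_def)
      with True show ?thesis by auto
    next
      case False
      have ch: "\<exists>x\<in>C. x \<le> inf F G" if "F \<in> C" "G \<in> C" for F G
      proof -
        have "F \<le> G \<or> G \<le> F"
          using C that by (auto simp: Chains_def relation_of_def)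
        then show ?thesis using that by (metis inf.absorb1 inf.absorb2 order_refl)
      qed
      have "\<not> eventually (\<lambda>_. False) (Inf C)"
        using CA by (subst eventually_Inf_base[OF False ch])
          (auto simp: A_def trivial_limit_def)
      moreover obtain F where "F \<in> C" using False by auto
      moreover have "F \<le> sequentially" using CA \<open>F \<in> C\<close> by (auto simp: A_def)
      ultimately have "Inf C \<in> A"
        unfolding A_def trivial_limit_def by (auto intro: Inf_lower order_trans)
      then show ?thesis by (auto intro: Inf_lower)
    qed
  qed
  then obtain m where m: "m \<in> A" and minimal: "\<And>F. F \<in> A \<Longrightarrow> F \<le> m \<Longrightarrow> F = m"
    by auto
  have "eventually P m \<or> eventually (\<lambda>n. \<not> P n) m" for P
  proof (cases "inf m (principal {n. P n}) = bot")
    case True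
    then show ?thesis by (auto simp: trivial_limit_def eventually_inf_principal)
  next
    case False
    have "inf m (principal {n. P n}) \<in> A"
      using False m by (auto simp: A_def intro: le_infI1)
    then have "inf m (principal {n. P n}) = m"
      by (rule minimal) (rule inf.cobounded1)
    then have "m \<le> principal {n. P n}"
      by (rule inf.orderI[OF sym])
    then show ?thesis by (simp add: le_principal)
  qed
  with m show ?thesis by (auto simp: A_def free_ultrafilter_def)
qed

definition ultra :: "nat filter" where
  "ultra = (SOME F. free_ultrafilter F)"

lemma free_ultrafilter_ultra: "free_ultrafilter ultra"
  unfolding ultra_def by (rule someI_ex) (rule free_ultrafilter_exists)

quotient_type 'a star = "nat \<Rightarrow> 'a" / "\<lambda>x y. eventually (\<lambda>n. x n = y n) ultra"
proof (rule equivpI)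
  show "reflp (\<lambda>x y :: nat \<Rightarrow> 'a. eventually (\<lambda>n. x n = y n) ultra)"
    by (simp add: reflp_def)
  show "symp (\<lambda>x y :: nat \<Rightarrow> 'a. eventually (\<lambda>n. x n = y n) ultra)"
    by (simp add: symp_def eq_commute)
  show "transp (\<lambda>x y :: nat \<Rightarrow> 'a. eventually (\<lambda>n. x n = y n) ultra)"
    unfolding transp_def by (intro allI impI, erule (1) eventually_elim2) simp
qed

lift_definition star_of :: "'a \<Rightarrow> 'a star" is "\<lambda>x n. x" .

lift_definition starfun :: "('a \<Rightarrow> 'b) \<Rightarrow> 'a star \<Rightarrow> 'b star" is "\<lambda>h x n. h (x n)"
  by (erule eventually_mono) simp

lift_definition starfun2 :: "('a \<Rightarrow> 'b \<Rightarrow> 'c) \<Rightarrow> 'a star \<Rightarrow> 'b star \<Rightarrow> 'c star"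
  is "\<lambda>h x y n. h (x n) (y n)"
  by (erule (1) eventually_elim2) simp

lift_definition starP :: "('a \<Rightarrow> bool) \<Rightarrow> 'a star \<Rightarrow> bool"
  is "\<lambda>P x. eventually (\<lambda>n. P (x n)) ultra"
  by (rule eventually_subst, erule eventually_mono) simp

lift_definition starP2 :: "('a \<Rightarrow> 'b \<Rightarrow> bool) \<Rightarrow> 'a star \<Rightarrow> 'b star \<Rightarrow> bool"
  is "\<lambda>P x y. eventually (\<lambda>n. P (x n) (y n)) ultra"
  by (rule eventually_subst, erule (1) eventually_elim2) simp

definition infinitesimal :: "'a::real_normed_vector star \<Rightarrow> bool" where
  "infinitesimal x \<longleftrightarrow> (\<forall>r>0. starP (\<lambda>u. norm u < r) x)"

definition approx :: "'a::real_normed_vector star \<Rightarrow> 'a star \<Rightarrow> bool" (infix "\<simeq>" 50) where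
  "x \<simeq> y \<longleftrightarrow> infinitesimal (starfun2 (-) x y)"

definition limited :: "'a::real_normed_vector star \<Rightarrow> bool" where
  "limited x \<longleftrightarrow> (\<exists>r. starP (\<lambda>u. norm u \<le> r) x)"

text \<open>
  The endpoints are standard, possibly infinite; a limited number is never infinitely close to
  an infinite endpoint.
\<close>
definition S_interior :: "ereal \<Rightarrow> ereal \<Rightarrow> real star set" where
  "S_interior t1 t2 = {t. limited t \<and> starP (\<lambda>s. t1 < ereal s \<and> ereal s < t2) t \<and>
     (\<forall>r. ereal r = t1 \<or> ereal r = t2 \<longrightarrow> \<not> t \<simeq> star_of r)}"

section \<open>The differential equation\<close>

type_synonym field = "complex \<times> (complex^2) \<times> complex \<Rightarrow> complex^2"

definition domain :: "'a::topological_space set \<Rightarrow> bool" where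
  "domain S \<longleftrightarrow> open S \<and> connected S \<and> S \<noteq> {}"

text \<open>
  As for \<open>holomorphic_on\<close>, analyticity on an open set is complex differentiability at every point:
  the Frechet derivative exists and is complex linear.
\<close>
definition analytic_field :: "field \<Rightarrow> (complex \<times> (complex^2) \<times> complex) set \<Rightarrow> bool" where
  "analytic_field f D \<longleftrightarrow> (\<forall>p\<in>D. \<exists>L. (f has_derivative L) (at p) \<and>
     (\<forall>c t x e. L (c * t, c *s x, c * e) = c *s L (t, x, e)))"

definition cvec :: "real^2 \<Rightarrow> complex^2" where
  "cvec x = (\<chi> i. of_real (x $ i))"

definition DX :: "field \<Rightarrow> complex \<Rightarrow> complex^2 \<Rightarrow> complex \<Rightarrow> complex^2^2" where
  "DX f t x e = matrix (frechet_derivative (\<lambda>y. f (t, y, e)) (at x))"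

definition eigenvalues :: "complex^2^2 \<Rightarrow> complex set" where
  "eigenvalues A = {z. \<exists>v. v \<noteq> 0 \<and> A *v v = z *s v}"

text \<open>A real solution is a pair of an open interval and a function, relevant only on that interval.\<close>

type_synonym curve = "real set \<times> (real \<Rightarrow> real^2)"

definition solution ::
  "field \<Rightarrow> (complex \<times> (complex^2) \<times> complex) set \<Rightarrow> real \<Rightarrow> curve \<Rightarrow> bool" where
  "solution f D e X \<longleftrightarrow> (case X of (I, x) \<Rightarrow>
     open I \<and> is_interval I \<and> I \<noteq> {} \<and>
     (\<forall>t\<in>I. (of_real t, cvec (x t), of_real e) \<in> D \<and>
        (\<exists>v. (x has_vector_derivative v) (at t) \<and>
             cvec (e *\<^sub>R v) = f (of_real t, cvec (x t), of_real e))))"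

text \<open>
  Trajectories are non-extendable solutions. Otherwise an artificial restriction of the domain would
  make any interval maximal for the property of going along the slow curve.
\<close>
definition trajectory ::
  "field \<Rightarrow> (complex \<times> (complex^2) \<times> complex) set \<Rightarrow> real \<Rightarrow> curve \<Rightarrow> bool" where
  "trajectory f D e X \<longleftrightarrow> solution f D e X \<and>
     (\<forall>Y. solution f D e Y \<and> fst X \<subseteq> fst Y \<and> (\<forall>t\<in>fst X. snd Y t = snd X t)
        \<longrightarrow> fst Y = fst X)"

section \<open>Going along the slow curve\<close>

definition goes_along ::
  "(complex \<Rightarrow> complex^2) \<Rightarrow> complex set \<Rightarrow> ereal \<Rightarrow> ereal \<Rightarrow> curve star \<Rightarrow> bool" where
  "goes_along \<phi> Dt t1 t2 X \<longleftrightarrow>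
     t1 < t2 \<and> (\<forall>s. t1 < ereal s \<and> ereal s < t2 \<longrightarrow> of_real s \<in> Dt) \<and>
     (\<forall>t\<in>S_interior t1 t2.
        starP2 (\<lambda>Y s. s \<in> fst Y) X t \<and>
        starfun2 (\<lambda>Y s. cvec (snd Y s)) X t \<simeq> starfun (\<lambda>s. \<phi> (of_real s)) t)"

definition goes_along_exactly ::
  "(complex \<Rightarrow> complex^2) \<Rightarrow> complex set \<Rightarrow> ereal \<Rightarrow> ereal \<Rightarrow> curve star \<Rightarrow> bool" where
  "goes_along_exactly \<phi> Dt te ts X \<longleftrightarrow> goes_along \<phi> Dt te ts X \<and>
     (\<forall>t1 t2. t1 \<le> te \<and> ts \<le> t2 \<and> goes_along \<phi> Dt t1 t2 X \<longrightarrow> t1 = te \<and> t2 = ts)"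

section \<open>The hypotheses\<close>

definition HFN1 :: "field \<Rightarrow> (complex \<times> (complex^2) \<times> complex) set \<Rightarrow> bool" where
  "HFN1 f D \<longleftrightarrow> domain D \<and> analytic_field f D \<and>
     (\<forall>t x e. (of_real t, cvec x, of_real e) \<in> D \<longrightarrow>
        (\<exists>y. f (of_real t, cvec x, of_real e) = cvec y))"

definition HFN2 :: "real star \<Rightarrow> bool" where
  "HFN2 \<epsilon> \<longleftrightarrow> starP (\<lambda>e. 0 < e) \<epsilon> \<and> infinitesimal \<epsilon>"

definition HFN3 ::
  "field \<Rightarrow> (complex \<times> (complex^2) \<times> complex) set \<Rightarrow> (complex \<Rightarrow> complex^2) \<Rightarrow> complex set
     \<Rightarrow> ereal \<Rightarrow> ereal \<Rightarrow> bool" where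
  "HFN3 f D \<phi> Dt tm tM \<longleftrightarrow> domain Dt \<and> (\<forall>i. (\<lambda>t. \<phi> t $ i) analytic_on Dt) \<and>
     (\<forall>t\<in>Dt. (t, \<phi> t, 0) \<in> D \<and> f (t, \<phi> t, 0) = 0) \<and>
     (\<forall>t. of_real t \<in> Dt \<longleftrightarrow> tm < ereal t \<and> ereal t < tM)"

definition slit :: "complex set \<Rightarrow> real \<Rightarrow> complex set" where
  "slit Dt b = Dt - of_real ` {b..}"

text \<open>
  \<open>u\<close> and \<open>v\<close> are the two determinations near \<open>b\<close> of \<open>p (g (sqrt (t - b)))\<close>, where \<open>g\<close> is analytic
  at \<open>0\<close> and the two determinations do not coincide. The projection \<open>p\<close> is the identity for
  the eigenvalues, and \<open>Re\<close> for the real parts of their primitives, where the first odd power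
  of \<open>sqrt (t - b)\<close> is higher than 1.
\<close>
definition sqrt_singularity ::
  "(complex \<Rightarrow> 'a) \<Rightarrow> real \<Rightarrow> (complex \<Rightarrow> 'a) \<Rightarrow> (complex \<Rightarrow> 'a) \<Rightarrow> bool" where
  "sqrt_singularity p b u v \<longleftrightarrow> (\<exists>r>0. \<exists>g. g holomorphic_on ball 0 r \<and>
     (\<exists>s\<in>ball 0 r. p (g s) \<noteq> p (g (- s))) \<and>
     (\<forall>s\<in>ball 0 r. {u (of_real b + s^2), v (of_real b + s^2)} = {p (g s), p (g (- s))}))"

definition HFN4 ::
  "field \<Rightarrow> (complex \<Rightarrow> complex^2) \<Rightarrow> complex set \<Rightarrow> ereal \<Rightarrow> ereal \<Rightarrow> real \<Rightarrow> real
     \<Rightarrow> (complex \<Rightarrow> complex) \<Rightarrow> (complex \<Rightarrow> complex) \<Rightarrow> bool" where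
  "HFN4 f \<phi> Dt tm tM a b lam mu \<longleftrightarrow>
     (\<forall>t\<in>Dt. {lam t, mu t} = eigenvalues (DX f t (\<phi> t) 0)) \<and>
     tm < ereal a \<and> a < b \<and> ereal b < tM \<and>
     (\<forall>t. tm < ereal t \<and> ereal t < tM \<longrightarrow>
        (t < a \<longrightarrow> Re (lam (of_real t)) < 0 \<and> Re (mu (of_real t)) < 0) \<and>
        (t = a \<longrightarrow> Re (lam (of_real t)) = 0 \<and> Re (mu (of_real t)) = 0) \<and>
        (t > a \<longrightarrow> Re (lam (of_real t)) > 0 \<and> Re (mu (of_real t)) > 0) \<and>
        (t < b \<longrightarrow> Im (lam (of_real t)) < 0 \<and> 0 < Im (mu (of_real t))) \<and>
        (t \<ge> b \<longrightarrow> Im (lam (of_real t)) = 0 \<and> Im (mu (of_real t)) = 0)) \<and>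
     (\<forall>t\<in>Dt. lam t = mu t \<longleftrightarrow> t = of_real b) \<and>
     lam holomorphic_on slit Dt b \<and> mu holomorphic_on slit Dt b \<and>
     sqrt_singularity id b lam mu \<and>
     (\<forall>t. t \<in> slit Dt b \<and> cnj t \<in> slit Dt b \<longrightarrow> mu (cnj t) = cnj (lam t))"

text \<open>
  \<open>R t\<close> is the real part of the integral of \<open>l\<close> from \<open>a\<close> to \<open>t\<close>: off the cut along any path in the slit
  domain, and at the points of the cut along the real axis. That \<open>R\<close> is a function
  includes the independence of the path.
\<close>
definition re_integral ::
  "complex set \<Rightarrow> real \<Rightarrow> real \<Rightarrow> (complex \<Rightarrow> complex) \<Rightarrow> (complex \<Rightarrow> real) \<Rightarrow> bool" where
  "re_integral Dt a b l R \<longleftrightarrow>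
     (\<forall>\<gamma>. valid_path \<gamma> \<and> path_image \<gamma> \<subseteq> slit Dt b \<and> pathstart \<gamma> = of_real a \<longrightarrow>
        R (pathfinish \<gamma>) = Re (contour_integral \<gamma> l)) \<and>
     (\<forall>t. b \<le> t \<and> of_real t \<in> Dt \<longrightarrow>
        R (of_real t) = integral {a..t} (\<lambda>s. Re (l (of_real s))))"

definition HFN5 ::
  "complex set \<Rightarrow> real \<Rightarrow> real \<Rightarrow> (complex \<Rightarrow> complex) \<Rightarrow> (complex \<Rightarrow> complex) \<Rightarrow> bool" where
  "HFN5 Dt a b lam mu \<longleftrightarrow> (\<exists>Rlam Rmu.
     re_integral Dt a b lam Rlam \<and> re_integral Dt a b mu Rmu \<and>
     sqrt_singularity Re b Rlam Rmu \<and>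
     (\<forall>t. t \<in> slit Dt b \<and> cnj t \<in> slit Dt b \<longrightarrow> Rmu t = Rlam (cnj t)) \<and>
     (\<forall>t. b < t \<and> of_real t \<in> Dt \<longrightarrow> Re (lam (of_real t)) < Re (mu (of_real t))) \<and>
     (\<exists>c\<in>slit Dt b. lam c = 0 \<and> (\<forall>z\<in>slit Dt b. lam z = 0 \<longrightarrow> z = c) \<and>
        Rlam (of_real b) < Rlam c))"

end

theory Submission
  imports Defs
begin

text \<open>
  Let \<open>Xc\<close> be the big canard and let \<open>Y = X - Xc\<close> for another solution \<open>X\<close>. As long as \<open>Y\<close> is
  infinitesimal, \<open>\<epsilon> Y' = A(t) Y + o(Y)\<close>, where \<open>A(t)\<close> is the derivative of the field with respect to \<open>X\<close> on
  the slow curve. The real parts of the eigenvalues of \<open>A(t)\<close>, the slow rate \<open>Re \<lambda>\<close> and the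
  fast rate \<open>Re \<mu>\<close>, bound the logarithmic growth of \<open>Y\<close>: \<open>\<epsilon> log |Y|\<close> changes between two times
  by an amount between \<open>\<integral> Re \<lambda>\<close> and \<open>\<integral> Re \<mu>\<close>, up to an infinitesimal (\<open>growth_upper\<close>,
  \<open>growth_lower\<close>). The delicate point is the time \<open>b\<close>, where the eigenvalues meet and \<open>A\<close> need not be
  diagonalizable. There the estimate is obtained with a quadratic form that is not the one given by the eigenvectors but
  is smooth and positive through \<open>b\<close> (\<open>norm_form_inequality\<close>).

  If \<open>X\<close> goes along the slow curve exactly on \<open>]te, ts[\<close>, then \<open>|Y|\<close> takes the same standard value near
  \<open>te\<close> and near \<open>ts\<close> (\<open>exit_balance\<close>), so the total change of \<open>\<epsilon> log |Y|\<close> is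
  infinitesimal, and \<open>0\<close> lies between the two integrals.

  Conversely, the trajectories with \<open>|Y(te)| = r0\<close> are parametrized by a circle. After \<open>b\<close> there are trajectories that
  grow at the fast rate and others that grow at the slow rate (\<open>fast_growth\<close>, \<open>slow_decay\<close>), and under the two
  inequalities the former come back to size \<open>r0\<close> before \<open>ts\<close> and the latter after \<open>ts\<close>, both up to an infinitesimal. Since
  the circle is connected, some trajectory comes back to size \<open>r0\<close> at a time infinitely close to \<open>ts\<close>
  (\<open>crossing\<close>). In between it is exponentially small because the rates are negative before \<open>a\<close> and positive after
  \<open>a\<close> (\<open>envelope\<close>). It does not go along a larger interval, for then its size at \<open>te\<close> or at the exit time would be
  exponentially small as well (\<open>ends_exponentially_small\<close>).

  The argument takes place in real time. Analyticity serves to obtain the uniform linearization near the slow curve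
  (\<open>linear_tube_exists\<close>). The nonstandard notions are translated into statements on sequences along the
  ultrafilter: going along the slow curve is uniform convergence on compact intervals (\<open>goes_along_iff\<close>).
\<close>

section \<open>Growth of solutions of nearly linear planar systems\<close>

text \<open>
  The sign of \<open>N\<close> is arbitrary, so that the statement, applied to \<open>- N\<close>,
  also yields lower bounds.
\<close>
lemma linear_differential_inequality:
  fixes N :: "real \<Rightarrow> real"
  assumes st: "s \<le> t" and g: "continuous_on {s..t} g"
    and N: "\<And>x. x \<in> {s..t} \<Longrightarrow> (N has_real_derivative N' x) (at x within {s..t})"
    and le: "\<And>x. x \<in> {s..t} \<Longrightarrow> N' x \<le> g x * N x"
  shows "N t \<le> N s * exp (integral {s..t} g)"
proof -
  define G where "G = (\<lambda>x. integral {s..x} g)"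
  define h where "h = (\<lambda>x. N x * exp (- G x))"
  have G: "(G has_real_derivative g x) (at x within {s..t})" if "x \<in> {s..t}" for x
    unfolding G_def by (rule integral_has_real_derivative[OF g that])
  have h: "(h has_real_derivative (N' x - g x * N x) * exp (- G x)) (at x within {s..t})"
    if "x \<in> {s..t}" for x
    unfolding h_def
    by (rule derivative_eq_intros N[OF that] G[OF that] refl)+ (simp add: algebra_simps)
  have neg: "\<exists>y. DERIV h x :> y \<and> y \<le> 0" if x: "s < x" "x < t" for x
  proof -
    have "(h has_real_derivative (N' x - g x * N x) * exp (- G x)) (at x)"
      using h[of x] x at_within_Icc_at[of s x t] by simp
    moreover have "(N' x - g x * N x) * exp (- G x) \<le> 0"
      using le[of x] x by (simp add: mult_nonpos_nonneg)
    ultimately show ?thesis by blast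
  qed
  have "continuous_on {s..t} h"
    by (rule DERIV_continuous_on) (rule h)
  from DERIV_nonpos_imp_decreasing_open[OF st neg this]
  have "h t \<le> h s" by simp
  then have "N t * exp (- G t) \<le> N s"
    by (simp add: h_def G_def)
  then have "N t * (exp (- G t) * exp (G t)) \<le> N s * exp (G t)"
    unfolding mult.assoc[symmetric] by (intro mult_right_mono) auto
  moreover have "exp (- G t) * exp (G t) = 1"
    by (simp flip: exp_add)
  ultimately have "N t \<le> N s * exp (G t)"
    by (simp only: mult_1_right)
  then show ?thesis
    by (simp only: G_def)
qed

definition half_trace :: "real^2^2 \<Rightarrow> real" where
  "half_trace A = (A$1$1 + A$2$2) / 2"

text \<open>
  The trace-free part \<open>B = A - half_trace A\<close> satisfies \<open>B\<^sup>2 = discr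
  A\<close>. Hence the eigenvalues of \<open>A\<close> are \<open>half_trace A \<plusminus> sqrt
  (discr A)\<close>, and the two rates below are their real parts: they agree for a focus and
  differ for a node.
\<close>
definition discr :: "real^2^2 \<Rightarrow> real" where
  "discr A = ((A$1$1 - A$2$2) / 2)\<^sup>2 + A$1$2 * A$2$1"

definition fast_rate :: "real^2^2 \<Rightarrow> real" where
  "fast_rate A = half_trace A + sqrt (max 0 (discr A))"

definition slow_rate :: "real^2^2 \<Rightarrow> real" where
  "slow_rate A = half_trace A - sqrt (max 0 (discr A))"

text \<open>
  The error is relative to \<open>Y\<close>. A nonlinear equation has this form as long as its
  solution stays in a small neighbourhood of a zero of the right-hand side.
\<close>
definition near_linear ::
  "(real \<Rightarrow> real^2^2) \<Rightarrow> real \<Rightarrow> real \<Rightarrow> real \<Rightarrow> real \<Rightarrow> (real \<Rightarrow> real^2) \<Rightarrow> bool" where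
  "near_linear A \<rho> e s t Y \<longleftrightarrow> (\<forall>x\<in>{s..t}. \<exists>v.
     (Y has_vector_derivative v) (at x within {s..t}) \<and>
     norm (e *\<^sub>R v - A x *v Y x) \<le> \<rho> * norm (Y x))"

lemma abs_product_le:
  fixes x y :: real
  shows "\<bar>x\<bar> \<le> p \<Longrightarrow> \<bar>y\<bar> \<le> q \<Longrightarrow> \<bar>x * y\<bar> \<le> p * q"
  by (simp add: abs_mult mult_mono)

lemma quad_bound:
  fixes y1 y2 :: real
  assumes "\<bar>u1\<bar> \<le> m" "\<bar>u2\<bar> \<le> m" "\<bar>v1\<bar> \<le> n" "\<bar>v2\<bar> \<le> n"
  shows "\<bar>(u1 * y1 + u2 * y2) * (v1 * y1 + v2 * y2)\<bar> \<le> 2 * (m * n) * (y1\<^sup>2 + y2\<^sup>2)"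
proof -
  have m: "m \<ge> 0" "n \<ge> 0" using assms by linarith+
  have "\<bar>u1 * y1 + u2 * y2\<bar> \<le> m * (\<bar>y1\<bar> + \<bar>y2\<bar>)"
    using abs_product_le[OF assms(1), of y1 "\<bar>y1\<bar>"] abs_product_le[OF assms(2), of y2 "\<bar>y2\<bar>"]
    by (simp add: distrib_left)
  moreover have "\<bar>v1 * y1 + v2 * y2\<bar> \<le> n * (\<bar>y1\<bar> + \<bar>y2\<bar>)"
    using abs_product_le[OF assms(3), of y1 "\<bar>y1\<bar>"] abs_product_le[OF assms(4), of y2 "\<bar>y2\<bar>"]
    by (simp add: distrib_left)
  ultimately have "\<bar>(u1 * y1 + u2 * y2) * (v1 * y1 + v2 * y2)\<bar>
      \<le> (m * (\<bar>y1\<bar> + \<bar>y2\<bar>)) * (n * (\<bar>y1\<bar> + \<bar>y2\<bar>))"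
    by (rule abs_product_le)
  also have "\<dots> = (m * n) * (\<bar>y1\<bar> + \<bar>y2\<bar>)\<^sup>2" by (simp add: power2_eq_square algebra_simps)
  also have "\<dots> \<le> (m * n) * (2 * (y1\<^sup>2 + y2\<^sup>2))"
  proof (rule mult_left_mono)
    have "0 \<le> (\<bar>y1\<bar> - \<bar>y2\<bar>)\<^sup>2" by simp
    then show "(\<bar>y1\<bar> + \<bar>y2\<bar>)\<^sup>2 \<le> 2 * (y1\<^sup>2 + y2\<^sup>2)"
      by (simp add: power2_sum power2_diff)
  qed (use m in simp)
  finally show ?thesis by (simp add: algebra_simps)
qed

lemma quad_bound_err:
  fixes y1 y2 :: real
  assumes "\<bar>u1\<bar> \<le> m" "\<bar>u2\<bar> \<le> m" "\<bar>w\<bar> \<le> n * sqrt (y1\<^sup>2 + y2\<^sup>2)"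
  shows "\<bar>(u1 * y1 + u2 * y2) * w\<bar> \<le> 2 * (m * n) * (y1\<^sup>2 + y2\<^sup>2)"
proof -
  have m: "m \<ge> 0" using assms by linarith
  let ?S = "sqrt (y1\<^sup>2 + y2\<^sup>2)"
  have "\<bar>u1 * y1 + u2 * y2\<bar> \<le> m * ?S + m * ?S"
    using abs_product_le[OF assms(1), of y1 ?S] abs_product_le[OF assms(2), of y2 ?S]
    by (simp add: real_le_rsqrt)
  then have "\<bar>(u1 * y1 + u2 * y2) * w\<bar> \<le> (m * ?S + m * ?S) * (n * ?S)"
    by (rule abs_product_le) (fact assms(3))
  also have "\<dots> = 2 * (m * n) * (?S * ?S)" by (simp add: algebra_simps)
  finally show ?thesis by simp
qed

text \<open>
  The quadratic form \<open>N = k |y|\<^sup>2 + |B y|\<^sup>2\<close> plays the role of a norm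
  adapted to \<open>A = \<alpha> + B\<close>. Since \<open>B\<^sup>2 = D\<close>, its derivative
  along \<open>\<epsilon> y' = A y\<close> is \<open>2 \<alpha> N + 2 (k + D) (y, B y)\<close>
  divided by \<open>\<epsilon>\<close>, and \<open>2 sqrt k |(y, B y)| \<le> N\<close>. The choice
  \<open>k = |D|\<close> would give the exact rate \<open>sqrt (max 0 D)\<close> but degenerates
  where \<open>D = 0\<close>, which is where the focus turns into a node and \<open>B\<close> may
  be nilpotent. With \<open>k = sqrt (D\<^sup>2 + \<eta>\<^sup>4)\<close> the form is smooth and
  bounded below by \<open>\<eta>\<^sup>2 |y|\<^sup>2\<close> everywhere, and the rate is exceeded
  by at most \<open>\<eta>\<close>. A second \<open>\<eta>\<close> pays for the perturbation
  \<open>E\<close> and for the time derivative of the form.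
\<close>
lemma norm_form_inequality:
  fixes y1 y2 :: real
  assumes eta: "\<eta> > 0" and e: "e > 0"
    and D: "D = \<beta>\<^sup>2 + \<gamma> * \<delta>" and k: "k = sqrt (D\<^sup>2 + \<eta>^4)"
    and M: "\<bar>\<beta>\<bar> \<le> M" "\<bar>\<gamma>\<bar> \<le> M" "\<bar>\<delta>\<bar> \<le> M"
    and M': "\<bar>\<beta>'\<bar> \<le> M'" "\<bar>\<gamma>'\<bar> \<le> M'" "\<bar>\<delta>'\<bar> \<le> M'"
    and E: "\<bar>E1\<bar> \<le> \<rho> * sqrt (y1\<^sup>2 + y2\<^sup>2)" "\<bar>E2\<bar> \<le> \<rho> * sqrt (y1\<^sup>2 + y2\<^sup>2)"
    and small: "12 * (M * M') * e + (24 * (M * M) + 4 * \<eta>\<^sup>2) * \<rho> \<le> 2 * \<eta>^3"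
    and z1: "e * z1 = (\<alpha> + \<beta>) * y1 + \<gamma> * y2 + E1"
    and z2: "e * z2 = \<delta> * y1 + (\<alpha> - \<beta>) * y2 + E2"
    and D': "D' = 2 * \<beta> * \<beta>' + \<gamma>' * \<delta> + \<gamma> * \<delta>'"
    and P: "P = \<beta> * y1 + \<gamma> * y2" and Q: "Q = \<delta> * y1 - \<beta> * y2"
  shows "e * (D * D' / k * (y1\<^sup>2 + y2\<^sup>2) + k * (2 * y1 * z1 + 2 * y2 * z2)
            + 2 * P * (\<beta>' * y1 + \<gamma>' * y2 + \<beta> * z1 + \<gamma> * z2)
            + 2 * Q * (\<delta>' * y1 - \<beta>' * y2 + \<delta> * z1 - \<beta> * z2))
         \<le> 2 * (\<alpha> + sqrt (max 0 D) + 2 * \<eta>) * (k * (y1\<^sup>2 + y2\<^sup>2) + P\<^sup>2 + Q\<^sup>2)"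
proof -
  define S where "S = y1\<^sup>2 + y2\<^sup>2"
  define N where "N = k * S + P\<^sup>2 + Q\<^sup>2"
  define W where "W = y1 * P + y2 * Q"
  have S0: "S \<ge> 0" by (simp add: S_def)
  have eta4: "\<eta>^4 > 0" using eta by simp
  have k2: "k\<^sup>2 = D\<^sup>2 + \<eta>^4" using k eta4 by (simp add: add_nonneg_nonneg)
  have k_eta: "k \<ge> \<eta>\<^sup>2"
    unfolding k by (rule real_le_rsqrt) simp
  have k0: "k > 0" using k_eta eta by (smt (verit) zero_less_power)
  have kD: "k \<ge> \<bar>D\<bar>" unfolding k by (rule real_le_rsqrt) simp
  have kle: "k \<le> \<bar>D\<bar> + \<eta>\<^sup>2"
    unfolding k by (rule real_le_lsqrt) (auto simp: power2_sum)
  define q where "q = sqrt k"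
  have q: "q > 0" "q\<^sup>2 = k" "q \<ge> \<eta>"
    using k0 k_eta eta by (auto simp: q_def real_le_rsqrt)
  have M0: "M \<ge> 0" "M' \<ge> 0" using M(1) M'(1) by linarith+
  have rho: "\<rho> * S \<ge> 0"
  proof (cases "S = 0")
    case False
    then have "sqrt S > 0" using S0 by simp
    moreover have "0 \<le> \<rho> * sqrt S" using E(1) unfolding S_def by linarith
    ultimately have "\<rho> \<ge> 0" by (simp add: zero_le_mult_iff)
    then show ?thesis using S0 by simp
  qed simp
  have Dle: "\<bar>D\<bar> \<le> 2 * (M * M)"
    using abs_product_le[OF M(1) M(1)] abs_product_le[OF M(2) M(3)]
    unfolding D power2_eq_square by linarith
  have D'le: "\<bar>D'\<bar> \<le> 4 * (M * M')"
    using abs_product_le[OF M(1) M'(1)] abs_product_le[OF M(2) M'(3)] abs_product_le[OF M(3) M'(2)]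
    unfolding D' abs_le_iff by (simp add: algebra_simps)
  have "\<bar>D * D' / k\<bar> \<le> \<bar>D'\<bar>"
    using mult_right_mono[OF kD, of "\<bar>D'\<bar>"] k0 by (simp add: abs_mult divide_le_eq mult.commute)
  then have t1: "D * D' / k * S \<le> 4 * (M * M') * S"
    using D'le S0 by (intro mult_right_mono) linarith+
  have t2: "P * (\<beta>' * y1 + \<gamma>' * y2) \<le> 2 * (M * M') * S"
    using quad_bound[OF M(1,2) M'(1,2), of y1 y2] unfolding P S_def by linarith
  have t3: "Q * (\<delta>' * y1 - \<beta>' * y2) \<le> 2 * (M * M') * S"
    using quad_bound[of \<delta> M "- \<beta>" \<delta>' M' "- \<beta>'" y1 y2] M M' unfolding Q S_def by simp
  have u1: "P * (\<beta> * E1 + \<gamma> * E2) \<le> 4 * (M * M) * (\<rho> * S)"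
  proof -
    have "\<bar>\<beta> * E1 + \<gamma> * E2\<bar> \<le> (2 * M * \<rho>) * sqrt (y1\<^sup>2 + y2\<^sup>2)"
      using abs_product_le[OF M(1) E(1)] abs_product_le[OF M(2) E(2)] by (simp add: algebra_simps)
    from quad_bound_err[OF M(1,2) this] show ?thesis
      unfolding P S_def by (simp add: algebra_simps)
  qed
  have u2: "Q * (\<delta> * E1 - \<beta> * E2) \<le> 4 * (M * M) * (\<rho> * S)"
  proof -
    have "\<bar>\<delta> * E1 - \<beta> * E2\<bar> \<le> (2 * M * \<rho>) * sqrt (y1\<^sup>2 + y2\<^sup>2)"
      using abs_product_le[OF M(3) E(1)] abs_product_le[OF M(1) E(2)] by (simp add: algebra_simps)
    from quad_bound_err[OF M(3) _ this, of "-\<beta>"] M show ?thesis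
      unfolding Q S_def by (simp add: algebra_simps)
  qed
  have u3: "y1 * E1 + y2 * E2 \<le> 2 * (\<rho> * S)"
  proof -
    have a: "\<bar>y1\<bar> \<le> sqrt (y1\<^sup>2 + y2\<^sup>2)" "\<bar>y2\<bar> \<le> sqrt (y1\<^sup>2 + y2\<^sup>2)"
      by (simp_all add: real_le_rsqrt)
    have "sqrt (y1\<^sup>2 + y2\<^sup>2) * (\<rho> * sqrt (y1\<^sup>2 + y2\<^sup>2)) = \<rho> * S"
      unfolding S_def by (simp add: mult.left_commute)
    then show ?thesis
      using abs_product_le[OF a(1) E(1)] abs_product_le[OF a(2) E(2)] by linarith
  qed
  have u3': "k * (y1 * E1 + y2 * E2) \<le> (2 * (M * M) + \<eta>\<^sup>2) * (2 * (\<rho> * S))"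
  proof -
    have "k * (y1 * E1 + y2 * E2) \<le> k * (2 * (\<rho> * S))"
      using u3 k0 by (intro mult_left_mono) auto
    also have "\<dots> \<le> (2 * (M * M) + \<eta>\<^sup>2) * (2 * (\<rho> * S))"
      using kle Dle rho by (intro mult_right_mono) linarith+
    finally show ?thesis .
  qed
  have rest: "e * (D * D' / k * S + 2 * (P * (\<beta>' * y1 + \<gamma>' * y2)) + 2 * (Q * (\<delta>' * y1 - \<beta>' * y2)))
      + 2 * (k * (y1 * E1 + y2 * E2)) + 2 * (P * (\<beta> * E1 + \<gamma> * E2)) + 2 * (Q * (\<delta> * E1 - \<beta> * E2))
      \<le> 2 * \<eta> * N"
  proof -
    have "e * (D * D' / k * S + 2 * (P * (\<beta>' * y1 + \<gamma>' * y2)) + 2 * (Q * (\<delta>' * y1 - \<beta>' * y2)))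
      \<le> e * (12 * (M * M') * S)"
      using t1 t2 t3 e by (intro mult_left_mono) linarith+
    with u1 u2 u3' have "e * (D * D' / k * S + 2 * (P * (\<beta>' * y1 + \<gamma>' * y2)) + 2 * (Q * (\<delta>' * y1 - \<beta>' * y2)))
      + 2 * (k * (y1 * E1 + y2 * E2)) + 2 * (P * (\<beta> * E1 + \<gamma> * E2)) + 2 * (Q * (\<delta> * E1 - \<beta> * E2))
      \<le> e * (12 * (M * M') * S) + 2 * ((2 * (M * M) + \<eta>\<^sup>2) * (2 * (\<rho> * S)))
        + 2 * (4 * (M * M) * (\<rho> * S)) + 2 * (4 * (M * M) * (\<rho> * S))"
      by linarith
    also have "\<dots> = (12 * (M * M') * e + (24 * (M * M) + 4 * \<eta>\<^sup>2) * \<rho>) * S"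
      by (simp add: algebra_simps)
    finally have "e * (D * D' / k * S + 2 * (P * (\<beta>' * y1 + \<gamma>' * y2)) + 2 * (Q * (\<delta>' * y1 - \<beta>' * y2)))
      + 2 * (k * (y1 * E1 + y2 * E2)) + 2 * (P * (\<beta> * E1 + \<gamma> * E2)) + 2 * (Q * (\<delta> * E1 - \<beta> * E2))
      \<le> (12 * (M * M') * e + (24 * (M * M) + 4 * \<eta>\<^sup>2) * \<rho>) * S" .
    moreover have "(12 * (M * M') * e + (24 * (M * M) + 4 * \<eta>\<^sup>2) * \<rho>) * S \<le> 2 * \<eta>^3 * S"
      using small S0 by (rule mult_right_mono)
    moreover have "2 * \<eta>^3 * S = 2 * \<eta> * (\<eta>\<^sup>2 * S)" by (simp add: power2_eq_square power3_eq_cube)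
    moreover have "\<eta>\<^sup>2 * S \<le> N"
      using mult_right_mono[OF k_eta S0] by (simp add: N_def add_increasing2)
    then have "2 * \<eta> * (\<eta>\<^sup>2 * S) \<le> 2 * \<eta> * N"
      using eta by (intro mult_left_mono) auto
    ultimately show ?thesis by linarith
  qed
  \<comment> \<open>completing the square in \<open>q y - B y\<close>\<close>
  have W: "2 * q * W \<le> N"
  proof -
    have "0 \<le> (q * y1 - P)\<^sup>2 + (q * y2 - Q)\<^sup>2" by simp
    also have "\<dots> = q\<^sup>2 * S + P\<^sup>2 + Q\<^sup>2 - 2 * q * W"
      by (simp add: S_def W_def power2_eq_square algebra_simps)
    finally show ?thesis by (simp add: N_def q)
  qed
  have N0: "N \<ge> 0" using k0 S0 by (simp add: N_def)
  have rate: "k + D \<le> 2 * q * (sqrt (max 0 D) + \<eta>)"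
  proof (cases "D \<ge> 0")
    case True
    have "k \<le> (sqrt D + \<eta>)\<^sup>2"
      using kle True eta by (simp add: power2_sum add_increasing2)
    then have "q \<le> sqrt D + \<eta>"
      unfolding q_def using True eta by (intro real_le_lsqrt) auto
    then have "q * q \<le> q * (sqrt D + \<eta>)" using q by (intro mult_left_mono) auto
    moreover have "k + D \<le> 2 * (q * q)" using q kD by (simp add: power2_eq_square)
    moreover have "2 * q * (sqrt (max 0 D) + \<eta>) = 2 * (q * (sqrt D + \<eta>))" using True by simp
    ultimately show ?thesis by linarith
  next
    case False
    \<comment> \<open>for \<open>D < 0\<close> the sum \<open>k + D\<close> is small because of
      cancellation\<close>
    have "(k + D) * (k - D) = \<eta>^4" using k2 by (simp add: power2_eq_square algebra_simps)
    moreover have "(k + D) * k \<le> (k + D) * (k - D)"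
      using False kD by (intro mult_left_mono) linarith+
    moreover have "\<eta>^4 \<le> \<eta> * q * k"
    proof -
      have "\<eta>^4 = \<eta> * (\<eta> * \<eta>\<^sup>2)" by (simp add: power2_eq_square power4_eq_xxxx)
      also have "\<dots> \<le> \<eta> * (q * k)"
        using eta q k_eta by (intro mult_left_mono mult_mono) auto
      finally show ?thesis by simp
    qed
    ultimately have "(k + D) * k \<le> \<eta> * q * k" by linarith
    then have "k + D \<le> \<eta> * q" using k0 by simp
    moreover have "0 \<le> \<eta> * q" "2 * q * (sqrt (max 0 D) + \<eta>) = 2 * (\<eta> * q)"
      using eta q False by simp_all
    ultimately show ?thesis by linarith
  qed
  have main: "2 * (k + D) * W \<le> 2 * (sqrt (max 0 D) + \<eta>) * N"
  proof -
    let ?g = "sqrt (max 0 D) + \<eta>"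
    have g0: "?g > 0" using eta by (simp add: add_nonneg_pos)
    have "q * ((k + D) * (2 * W)) = (k + D) * (2 * q * W)" by simp
    also have "\<dots> \<le> (k + D) * N" using W kD by (intro mult_left_mono) linarith+
    also have "\<dots> \<le> (2 * q * ?g) * N" using rate N0 by (intro mult_right_mono)
    finally have "q * ((k + D) * (2 * W)) \<le> q * (2 * ?g * N)" by (simp add: mult_ac)
    then have "(k + D) * (2 * W) \<le> 2 * ?g * N" using q(1) by (simp only: mult_le_cancel_left_pos)
    then show ?thesis by (simp add: algebra_simps)
  qed
  have "e * (D * D' / k * S + k * (2 * y1 * z1 + 2 * y2 * z2)
            + 2 * P * (\<beta>' * y1 + \<gamma>' * y2 + \<beta> * z1 + \<gamma> * z2)
            + 2 * Q * (\<delta>' * y1 - \<beta>' * y2 + \<delta> * z1 - \<beta> * z2))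
     = e * (D * D' / k * S + 2 * (P * (\<beta>' * y1 + \<gamma>' * y2)) + 2 * (Q * (\<delta>' * y1 - \<beta>' * y2)))
      + 2 * k * (y1 * (e * z1) + y2 * (e * z2)) + 2 * P * (\<beta> * (e * z1) + \<gamma> * (e * z2))
      + 2 * Q * (\<delta> * (e * z1) - \<beta> * (e * z2))"
    by (simp add: algebra_simps)
  also have "\<dots> = 2 * \<alpha> * N + 2 * (k + D) * W
      + (e * (D * D' / k * S + 2 * (P * (\<beta>' * y1 + \<gamma>' * y2)) + 2 * (Q * (\<delta>' * y1 - \<beta>' * y2)))
      + 2 * (k * (y1 * E1 + y2 * E2)) + 2 * (P * (\<beta> * E1 + \<gamma> * E2)) + 2 * (Q * (\<delta> * E1 - \<beta> * E2)))"
    unfolding z1 z2 N_def W_def S_def D P Q by (simp add: algebra_simps power2_eq_square)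
  also have "\<dots> \<le> 2 * \<alpha> * N + 2 * (sqrt (max 0 D) + \<eta>) * N + 2 * \<eta> * N"
    using main rest by linarith
  also have "\<dots> = 2 * (\<alpha> + sqrt (max 0 D) + 2 * \<eta>) * N" by (simp add: algebra_simps)
  finally show ?thesis by (simp add: S_def N_def)
qed

text \<open>
  For a node the form \<open>V = (y, B y)\<close> detects the fast eigendirection: its derivative
  along \<open>\<epsilon> y' = (\<alpha> + B) y\<close> is \<open>2 \<alpha> V + D |y|\<^sup>2 +
  |B y|\<^sup>2\<close> divided by \<open>\<epsilon>\<close>, and \<open>D |y|\<^sup>2 + |B
  y|\<^sup>2 \<ge> 2 sqrt D V\<close>. This holds for either sign of \<open>V\<close>, so no
  invariant cone has to be followed. The fraction \<open>\<theta>\<close> of the gain is given up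
  because \<open>\<theta> D |y|\<^sup>2\<close> absorbs the errors.
\<close>
lemma fast_form_inequality:
  fixes y1 y2 :: real
  assumes e: "e > 0" and D: "D = \<beta>\<^sup>2 + \<gamma> * \<delta>" "D > 0" and th: "0 \<le> \<theta>" "\<theta> \<le> 1"
    and M: "\<bar>\<beta>\<bar> \<le> M" "\<bar>\<gamma>\<bar> \<le> M" "\<bar>\<delta>\<bar> \<le> M"
    and M': "\<bar>\<beta>'\<bar> \<le> M'" "\<bar>\<gamma>'\<bar> \<le> M'" "\<bar>\<delta>'\<bar> \<le> M'"
    and E: "\<bar>E1\<bar> \<le> \<rho> * sqrt (y1\<^sup>2 + y2\<^sup>2)" "\<bar>E2\<bar> \<le> \<rho> * sqrt (y1\<^sup>2 + y2\<^sup>2)"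
    and small: "4 * M' * e + 8 * M * \<rho> \<le> \<theta> * D"
    and z1: "e * z1 = (\<alpha> + \<beta>) * y1 + \<gamma> * y2 + E1"
    and z2: "e * z2 = \<delta> * y1 + (\<alpha> - \<beta>) * y2 + E2"
    and P: "P = \<beta> * y1 + \<gamma> * y2" and Q: "Q = \<delta> * y1 - \<beta> * y2"
  shows "2 * (\<alpha> + (1 - \<theta>) * sqrt D) * (y1 * P + y2 * Q) \<le>
    e * (z1 * P + z2 * Q + y1 * (\<beta>' * y1 + \<gamma>' * y2 + \<beta> * z1 + \<gamma> * z2)
      + y2 * (\<delta>' * y1 - \<beta>' * y2 + \<delta> * z1 - \<beta> * z2))"
proof -
  define S where "S = y1\<^sup>2 + y2\<^sup>2"
  define W where "W = y1 * P + y2 * Q"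
  have S0: "S \<ge> 0" by (simp add: S_def)
  define d where "d = sqrt D"
  have d: "d > 0" "d\<^sup>2 = D" using D by (auto simp: d_def)
  have W: "2 * d * W \<le> D * S + P\<^sup>2 + Q\<^sup>2"
  proof -
    have "0 \<le> (d * y1 - P)\<^sup>2 + (d * y2 - Q)\<^sup>2" by simp
    also have "\<dots> = d\<^sup>2 * S + P\<^sup>2 + Q\<^sup>2 - 2 * d * W"
      by (simp add: S_def W_def power2_eq_square algebra_simps)
    finally show ?thesis by (simp add: d)
  qed
  have W1: "2 * ((1 - \<theta>) * d) * W + \<theta> * (D * S) \<le> D * S + P\<^sup>2 + Q\<^sup>2"
  proof -
    have "(1 - \<theta>) * (2 * d * W) \<le> (1 - \<theta>) * (D * S + P\<^sup>2 + Q\<^sup>2)"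
      using W th by (intro mult_left_mono) auto
    moreover have "\<theta> * (D * S) \<le> \<theta> * (D * S + P\<^sup>2 + Q\<^sup>2)"
      using th by (intro mult_left_mono) auto
    ultimately show ?thesis by (simp add: algebra_simps)
  qed
  have t1: "\<bar>y1 * (\<beta>' * y1 + \<gamma>' * y2)\<bar> \<le> 2 * M' * S"
    using quad_bound[of 1 1 0 \<beta>' M' \<gamma>' y1 y2] M' unfolding S_def by simp
  have t2: "\<bar>y2 * (\<delta>' * y1 - \<beta>' * y2)\<bar> \<le> 2 * M' * S"
    using quad_bound[of 0 1 1 \<delta>' M' "-\<beta>'" y1 y2] M' unfolding S_def by simp
  have u1: "\<bar>P * E1\<bar> \<le> 2 * (M * \<rho>) * S"
    using quad_bound_err[OF M(1,2) E(1)] unfolding P S_def by simp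
  have u2: "\<bar>Q * E2\<bar> \<le> 2 * (M * \<rho>) * S"
    using quad_bound_err[OF M(3) _ E(2), of "-\<beta>"] M unfolding Q S_def by simp
  have u3: "\<bar>(\<beta> * y1 + \<delta> * y2) * E1\<bar> \<le> 2 * (M * \<rho>) * S"
    using quad_bound_err[OF M(1,3) E(1)] unfolding S_def by simp
  have u4: "\<bar>(\<gamma> * y1 - \<beta> * y2) * E2\<bar> \<le> 2 * (M * \<rho>) * S"
    using quad_bound_err[OF M(2) _ E(2), of "-\<beta>"] M unfolding S_def by simp
  have e4: "\<bar>e * (y1 * (\<beta>' * y1 + \<gamma>' * y2) + y2 * (\<delta>' * y1 - \<beta>' * y2))\<bar> \<le> e * (4 * M' * S)"
    using abs_product_le[of e e "y1 * (\<beta>' * y1 + \<gamma>' * y2) + y2 * (\<delta>' * y1 - \<beta>' * y2)" "4 * M' * S"]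
      t1 t2 e by linarith
  have sm: "(4 * M' * e + 8 * M * \<rho>) * S \<le> \<theta> * D * S"
    using small S0 by (rule mult_right_mono)
  have "e * (z1 * P + z2 * Q + y1 * (\<beta>' * y1 + \<gamma>' * y2 + \<beta> * z1 + \<gamma> * z2)
      + y2 * (\<delta>' * y1 - \<beta>' * y2 + \<delta> * z1 - \<beta> * z2))
    = e * (y1 * (\<beta>' * y1 + \<gamma>' * y2) + y2 * (\<delta>' * y1 - \<beta>' * y2))
      + ((e * z1) * P + (e * z2) * Q + y1 * (\<beta> * (e * z1) + \<gamma> * (e * z2))
         + y2 * (\<delta> * (e * z1) - \<beta> * (e * z2)))"
    by (simp add: algebra_simps)
  also have "\<dots> = 2 * \<alpha> * W + (D * S + P\<^sup>2 + Q\<^sup>2)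
      + e * (y1 * (\<beta>' * y1 + \<gamma>' * y2) + y2 * (\<delta>' * y1 - \<beta>' * y2))
      + (P * E1 + Q * E2 + (\<beta> * y1 + \<delta> * y2) * E1 + (\<gamma> * y1 - \<beta> * y2) * E2)"
    unfolding z1 z2 W_def S_def D P Q by (simp add: algebra_simps power2_eq_square)
  also have "\<dots> \<ge> 2 * \<alpha> * W + 2 * ((1 - \<theta>) * d) * W"
    using W1 e4 u1 u2 u3 u4 sm by (simp add: algebra_simps)
  finally show ?thesis by (simp add: W_def d_def algebra_simps)
qed

lemma smooth_approximation:
  fixes g :: "real \<Rightarrow> real"
  assumes "continuous_on {c..d} g" "\<rho> > 0"
  obtains p p' K where "\<And>x. (p has_real_derivative p' x) (at x)"
    "\<And>x. x \<in> {c..d} \<Longrightarrow> \<bar>g x - p x\<bar> \<le> \<rho>" "\<And>x. x \<in> {c..d} \<Longrightarrow> \<bar>p' x\<bar> \<le> K"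
proof -
  obtain p where p: "real_polynomial_function p" "\<And>x. x \<in> {c..d} \<Longrightarrow> \<bar>g x - p x\<bar> < \<rho>"
    using Stone_Weierstrass_real_polynomial_function[OF compact_Icc assms] by blast
  obtain p' where p': "real_polynomial_function p'" "\<And>x. (p has_real_derivative p' x) (at x)"
    using has_real_derivative_polynomial_function[OF p(1)] by blast
  have "continuous_on {c..d} p'"
    using p'(1) by (simp add: continuous_on_polymonial_function real_polynomial_function_eq)
  then have "bounded (p' ` {c..d})" by (intro compact_imp_bounded compact_continuous_image) auto
  then obtain K where "\<forall>z\<in>p' ` {c..d}. norm z \<le> K" unfolding bounded_iff by blast
  then have "\<And>x. x \<in> {c..d} \<Longrightarrow> \<bar>p' x\<bar> \<le> K" by simp
  with p(2) p'(2) show thesis by (intro that[of p p' K]) (auto intro: less_imp_le)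
qed

lemma continuous_on_entry:
  "continuous_on S A \<Longrightarrow> continuous_on S (\<lambda>x. (A x :: real^2^2) $ i $ j)"
  by (intro continuous_on_component)

lemma continuous_on_rates:
  assumes "continuous_on S A"
  shows "continuous_on S (\<lambda>x. half_trace (A x))" "continuous_on S (\<lambda>x. discr (A x))"
    "continuous_on S (\<lambda>x. fast_rate (A x))" "continuous_on S (\<lambda>x. slow_rate (A x))"
  unfolding half_trace_def discr_def fast_rate_def slow_rate_def
  by (intro continuous_intros continuous_on_entry assms; simp)+

lemma norm_2: "norm (y::real^2) = sqrt ((y$1)\<^sup>2 + (y$2)\<^sup>2)"
  by (simp add: norm_vec_def L2_set_def sum_2)

lemma mult_vec_2:
  fixes A :: "real^2^2"
  shows "(A *v y) $ 1 = (half_trace A + (A$1$1 - A$2$2) / 2) * y$1 + A$1$2 * y$2"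
    "(A *v y) $ 2 = A$2$1 * y$1 + (half_trace A - (A$1$1 - A$2$2) / 2) * y$2"
  by (simp_all add: matrix_vector_mult_def sum_2 half_trace_def field_simps)

lemma abs_sum4_le:
  fixes x y z w :: real
  assumes "\<bar>x\<bar> \<le> k" "\<bar>y\<bar> \<le> k" "\<bar>z\<bar> \<le> k" "\<bar>w\<bar> \<le> k"
  shows "\<bar>x + y + z + w\<bar> \<le> 4 * k"
  using assms by linarith

lemma perturbed_components:
  fixes A :: "real^2^2" and v y :: "real^2"
  assumes "norm (e *\<^sub>R v - A *v y) \<le> \<rho> * norm y"
    and "\<bar>half_trace A - \<alpha>\<bar> \<le> \<rho>" "\<bar>(A$1$1 - A$2$2) / 2 - \<beta>\<bar> \<le> \<rho>"
      "\<bar>A$1$2 - \<gamma>\<bar> \<le> \<rho>" "\<bar>A$2$1 - \<delta>\<bar> \<le> \<rho>"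
  obtains E1 E2 where "e * v$1 = (\<alpha> + \<beta>) * y$1 + \<gamma> * y$2 + E1"
    "e * v$2 = \<delta> * y$1 + (\<alpha> - \<beta>) * y$2 + E2"
    "\<bar>E1\<bar> \<le> 4 * \<rho> * sqrt ((y$1)\<^sup>2 + (y$2)\<^sup>2)" "\<bar>E2\<bar> \<le> 4 * \<rho> * sqrt ((y$1)\<^sup>2 + (y$2)\<^sup>2)"
proof
  let ?E1 = "e * v$1 - ((\<alpha> + \<beta>) * y$1 + \<gamma> * y$2)" and ?E2 = "e * v$2 - (\<delta> * y$1 + (\<alpha> - \<beta>) * y$2)"
  let ?b = "(A$1$1 - A$2$2) / 2"
  show "e * v$1 = (\<alpha> + \<beta>) * y$1 + \<gamma> * y$2 + ?E1" "e * v$2 = \<delta> * y$1 + (\<alpha> - \<beta>) * y$2 + ?E2"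
    by simp_all
  let ?n = "norm y"
  have y: "\<bar>y$1\<bar> \<le> ?n" "\<bar>y$2\<bar> \<le> ?n" by (rule component_le_norm_cart)+
  have a: "\<bar>(e *\<^sub>R v - A *v y) $ i\<bar> \<le> \<rho> * ?n" for i
    using component_le_norm_cart assms(1) by (rule order_trans)
  have p: "\<bar>(half_trace A - \<alpha>) * y$i\<bar> \<le> \<rho> * ?n" "\<bar>(?b - \<beta>) * y$i\<bar> \<le> \<rho> * ?n"
    "\<bar>(A$1$2 - \<gamma>) * y$i\<bar> \<le> \<rho> * ?n" "\<bar>(A$2$1 - \<delta>) * y$i\<bar> \<le> \<rho> * ?n"
    "\<bar>- ((?b - \<beta>) * y$i)\<bar> \<le> \<rho> * ?n" for i
    unfolding abs_minus_cancel by (intro abs_product_le assms component_le_norm_cart)+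
  have "?E1 = (e *\<^sub>R v - A *v y) $ 1 + (half_trace A - \<alpha>) * y$1 + (?b - \<beta>) * y$1 + (A$1$2 - \<gamma>) * y$2"
    by (simp add: mult_vec_2 algebra_simps)
  then have "\<bar>?E1\<bar> \<le> 4 * (\<rho> * ?n)" using abs_sum4_le[OF a[of 1] p(1)[of 1] p(2)[of 1] p(3)[of 2]] by simp
  then show "\<bar>?E1\<bar> \<le> 4 * \<rho> * sqrt ((y$1)\<^sup>2 + (y$2)\<^sup>2)" by (simp add: norm_2)
  have "?E2 = (e *\<^sub>R v - A *v y) $ 2 + (A$2$1 - \<delta>) * y$1 + (half_trace A - \<alpha>) * y$2 + - ((?b - \<beta>) * y$2)"
    by (simp add: mult_vec_2 algebra_simps)
  then have "\<bar>?E2\<bar> \<le> 4 * (\<rho> * ?n)" using abs_sum4_le[OF a[of 2] p(4)[of 1] p(1)[of 2] p(5)[of 2]] by simp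
  then show "\<bar>?E2\<bar> \<le> 4 * \<rho> * sqrt ((y$1)\<^sup>2 + (y$2)\<^sup>2)" by (simp add: norm_2)
qed

lemma has_real_derivative_component:
  assumes "(Y has_vector_derivative v) F"
  shows "((\<lambda>x. (Y x :: real^2) $ i) has_real_derivative v $ i) F"
  using bounded_linear.has_vector_derivative[OF bounded_linear_vec_nth assms]
  by (simp add: has_real_derivative_iff_has_vector_derivative)

lemma discr_perturbation:
  fixes \<beta> :: real
  assumes "\<bar>\<beta>\<bar> \<le> M" "\<bar>\<gamma>\<bar> \<le> M" "\<bar>q\<bar> \<le> M" "\<bar>s\<bar> \<le> M"
    and "\<bar>\<beta> - q\<bar> \<le> \<rho>" "\<bar>\<gamma> - r\<bar> \<le> \<rho>" "\<bar>\<delta> - s\<bar> \<le> \<rho>"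
  shows "\<bar>\<beta>\<^sup>2 + \<gamma> * \<delta> - (q\<^sup>2 + r * s)\<bar> \<le> 4 * M * \<rho>"
proof -
  have "\<beta>\<^sup>2 + \<gamma> * \<delta> - (q\<^sup>2 + r * s) = \<beta> * (\<beta> - q) + q * (\<beta> - q) + \<gamma> * (\<delta> - s) + s * (\<gamma> - r)"
    by (simp add: power2_eq_square algebra_simps)
  then show ?thesis
    using abs_product_le[OF assms(1,5)] abs_product_le[OF assms(3,5)] abs_product_le[OF assms(2,7)]
      abs_product_le[OF assms(4,6)] by linarith
qed

text \<open>
  Entries of \<open>A\<close> in the coordinates \<open>A = \<alpha> + [[\<beta>, \<gamma>],
  [\<delta>, - \<beta>]]\<close>, replaced by nearby differentiable functions: the quadratic forms
  above need derivatives of their coefficients.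
\<close>
definition smooth_approximant where
  "smooth_approximant c d A M \<rho> M' \<alpha> \<beta> \<gamma> \<delta> \<beta>' \<gamma>' \<delta>' \<longleftrightarrow>
      M' \<ge> 0 \<and>
      (\<forall>x. (\<beta> has_real_derivative \<beta>' x) (at x) \<and> (\<gamma> has_real_derivative \<gamma>' x) (at x) \<and>
           (\<delta> has_real_derivative \<delta>' x) (at x)) \<and> continuous_on UNIV \<alpha> \<and>
      (\<forall>x\<in>{c..d}. \<bar>\<beta> x\<bar> \<le> M \<and> \<bar>\<gamma> x\<bar> \<le> M \<and> \<bar>\<delta> x\<bar> \<le> M \<and> \<bar>\<beta>' x\<bar> \<le> M' \<and> \<bar>\<gamma>' x\<bar> \<le> M' \<and> \<bar>\<delta>' x\<bar> \<le> M' \<and>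
        \<bar>half_trace (A x) - \<alpha> x\<bar> \<le> \<rho> \<and> \<bar>(A x$1$1 - A x$2$2) / 2 - \<beta> x\<bar> \<le> \<rho> \<and>
        \<bar>A x$1$2 - \<gamma> x\<bar> \<le> \<rho> \<and> \<bar>A x$2$1 - \<delta> x\<bar> \<le> \<rho> \<and>
        \<bar>discr (A x) - ((\<beta> x)\<^sup>2 + \<gamma> x * \<delta> x)\<bar> \<le> 4 * M * \<rho>)"

lemma abs_half_diff_le:
  fixes p q m :: real
  assumes "\<bar>p\<bar> \<le> m" "\<bar>q\<bar> \<le> m"
  shows "\<bar>(p - q) / 2\<bar> \<le> m"
  using assms by (simp add: abs_le_iff field_simps)

text \<open>
  The bound \<open>M\<close> is found before the accuracy \<open>\<rho>\<close>, which will be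
  chosen small in terms of \<open>M\<close>. The bound \<open>M'\<close> on the derivatives grows
  when \<open>\<rho>\<close> decreases, but it only meets the factor \<open>e\<close>.
\<close>
lemma smooth_coefficients:
  fixes A :: "real \<Rightarrow> real^2^2"
  assumes A: "continuous_on {c..d} A"
  obtains M where "M \<ge> 1"
    "\<And>\<rho>. 0 < \<rho> \<Longrightarrow> \<rho> \<le> 1 \<Longrightarrow> \<exists>\<alpha> \<beta> \<gamma> \<delta> \<beta>' \<gamma>' \<delta>' M'. smooth_approximant c d A M \<rho> M' \<alpha> \<beta> \<gamma> \<delta> \<beta>' \<gamma>' \<delta>'"
proof -
  note cont = continuous_on_entry[OF A]
  have "bounded (A ` {c..d})" using A by (intro compact_imp_bounded compact_continuous_image) auto
  then obtain K where K: "\<And>x. x \<in> {c..d} \<Longrightarrow> norm (A x) \<le> K" unfolding bounded_iff by (metis imageI)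
  define M where "M = \<bar>K\<bar> + 1"
  have ent: "\<bar>A x$i$j\<bar> \<le> M - 1" if "x \<in> {c..d}" for x i j
  proof -
    have "\<bar>A x$i$j\<bar> \<le> norm (A x $ i)" by (rule component_le_norm_cart)
    also have "\<dots> \<le> norm (A x)" by (rule Finite_Cartesian_Product.norm_nth_le)
    also have "\<dots> \<le> K" by (rule K[OF that])
    finally show ?thesis by (simp add: M_def)
  qed
  have bet: "\<bar>(A x$1$1 - A x$2$2) / 2\<bar> \<le> M - 1" if "x \<in> {c..d}" for x
    using abs_half_diff_le[OF ent[OF that] ent[OF that]] .
  show thesis
  proof (rule that)
    show "M \<ge> 1" by (simp add: M_def)
    fix \<rho> :: real assume rho: "0 < \<rho>" "\<rho> \<le> 1"
    have c: "continuous_on {c..d} (\<lambda>x. (A x$1$1 - A x$2$2) / 2)"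
      by (intro continuous_intros cont) simp
    obtain \<alpha> \<alpha>' K0 where a: "\<And>x. (\<alpha> has_real_derivative \<alpha>' x) (at x)"
        "\<And>x. x \<in> {c..d} \<Longrightarrow> \<bar>half_trace (A x) - \<alpha> x\<bar> \<le> \<rho>" "\<And>x. x \<in> {c..d} \<Longrightarrow> \<bar>\<alpha>' x\<bar> \<le> K0"
      using smooth_approximation[OF continuous_on_rates(1)[OF A] rho(1)] by metis
    obtain \<beta> \<beta>' K1 where b: "\<And>x. (\<beta> has_real_derivative \<beta>' x) (at x)"
        "\<And>x. x \<in> {c..d} \<Longrightarrow> \<bar>(A x$1$1 - A x$2$2) / 2 - \<beta> x\<bar> \<le> \<rho>" "\<And>x. x \<in> {c..d} \<Longrightarrow> \<bar>\<beta>' x\<bar> \<le> K1"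
      using smooth_approximation[OF c rho(1)] by metis
    obtain \<gamma> \<gamma>' K2 where g: "\<And>x. (\<gamma> has_real_derivative \<gamma>' x) (at x)"
        "\<And>x. x \<in> {c..d} \<Longrightarrow> \<bar>A x$1$2 - \<gamma> x\<bar> \<le> \<rho>" "\<And>x. x \<in> {c..d} \<Longrightarrow> \<bar>\<gamma>' x\<bar> \<le> K2"
      using smooth_approximation[OF cont rho(1)] by metis
    obtain \<delta> \<delta>' K3 where d: "\<And>x. (\<delta> has_real_derivative \<delta>' x) (at x)"
        "\<And>x. x \<in> {c..d} \<Longrightarrow> \<bar>A x$2$1 - \<delta> x\<bar> \<le> \<rho>" "\<And>x. x \<in> {c..d} \<Longrightarrow> \<bar>\<delta>' x\<bar> \<le> K3"
      using smooth_approximation[OF cont rho(1)] by metis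
    have ca: "continuous_on UNIV \<alpha>" by (rule DERIV_continuous_on[OF has_field_derivative_at_within]) (rule a(1))
    define M' where "M' = \<bar>K1\<bar> + \<bar>K2\<bar> + \<bar>K3\<bar>"
    have "\<bar>\<beta> x\<bar> \<le> M \<and> \<bar>\<gamma> x\<bar> \<le> M \<and> \<bar>\<delta> x\<bar> \<le> M \<and> \<bar>\<beta>' x\<bar> \<le> M' \<and> \<bar>\<gamma>' x\<bar> \<le> M' \<and> \<bar>\<delta>' x\<bar> \<le> M' \<and>
        \<bar>half_trace (A x) - \<alpha> x\<bar> \<le> \<rho> \<and> \<bar>(A x$1$1 - A x$2$2) / 2 - \<beta> x\<bar> \<le> \<rho> \<and>
        \<bar>A x$1$2 - \<gamma> x\<bar> \<le> \<rho> \<and> \<bar>A x$2$1 - \<delta> x\<bar> \<le> \<rho> \<and>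
        \<bar>discr (A x) - ((\<beta> x)\<^sup>2 + \<gamma> x * \<delta> x)\<bar> \<le> 4 * M * \<rho>"
      if x: "x \<in> {c..d}" for x
    proof (intro conjI)
      show 1: "\<bar>\<beta> x\<bar> \<le> M" using b(2)[OF x] bet[OF x] rho by linarith
      show 2: "\<bar>\<gamma> x\<bar> \<le> M" using g(2)[OF x] ent[OF x, of 1 2] rho by linarith
      show 3: "\<bar>\<delta> x\<bar> \<le> M" using d(2)[OF x] ent[OF x, of 2 1] rho by linarith
      show "\<bar>\<beta>' x\<bar> \<le> M'" "\<bar>\<gamma>' x\<bar> \<le> M'" "\<bar>\<delta>' x\<bar> \<le> M'"
        using b(3)[OF x] g(3)[OF x] d(3)[OF x] unfolding M'_def by linarith+
      show "\<bar>discr (A x) - ((\<beta> x)\<^sup>2 + \<gamma> x * \<delta> x)\<bar> \<le> 4 * M * \<rho>"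
        unfolding discr_def
        by (rule discr_perturbation[OF _ _ 1 3 b(2)[OF x] g(2)[OF x] d(2)[OF x]])
          (use bet[OF x] ent[OF x, of 1 2] in linarith)+
    qed (fact a(2)[OF x] b(2)[OF x] g(2)[OF x] d(2)[OF x])+
    then have props: "\<forall>x\<in>{c..d}. \<bar>\<beta> x\<bar> \<le> M \<and> \<bar>\<gamma> x\<bar> \<le> M \<and> \<bar>\<delta> x\<bar> \<le> M \<and> \<bar>\<beta>' x\<bar> \<le> M' \<and> \<bar>\<gamma>' x\<bar> \<le> M' \<and> \<bar>\<delta>' x\<bar> \<le> M' \<and>
        \<bar>half_trace (A x) - \<alpha> x\<bar> \<le> \<rho> \<and> \<bar>(A x$1$1 - A x$2$2) / 2 - \<beta> x\<bar> \<le> \<rho> \<and>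
        \<bar>A x$1$2 - \<gamma> x\<bar> \<le> \<rho> \<and> \<bar>A x$2$1 - \<delta> x\<bar> \<le> \<rho> \<and>
        \<bar>discr (A x) - ((\<beta> x)\<^sup>2 + \<gamma> x * \<delta> x)\<bar> \<le> 4 * M * \<rho>"
      by (intro ballI)
    have M'0: "M' \<ge> 0" by (simp add: M'_def)
    have "smooth_approximant c d A M \<rho> M' \<alpha> \<beta> \<gamma> \<delta> \<beta>' \<gamma>' \<delta>'"
      unfolding smooth_approximant_def
      by (intro conjI allI) (fact M'0 b(1) g(1) d(1) ca props)+
    then show "\<exists>\<alpha> \<beta> \<gamma> \<delta> \<beta>' \<gamma>' \<delta>' M'. smooth_approximant c d A M \<rho> M' \<alpha> \<beta> \<gamma> \<delta> \<beta>' \<gamma>' \<delta>'"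
      by (intro exI)
  qed
qed

lemma sqrt_max_close:
  assumes "\<bar>x - y\<bar> \<le> \<eta>\<^sup>2" "\<eta> \<ge> (0::real)"
  shows "sqrt (max 0 x) \<le> sqrt (max 0 y) + \<eta>"
proof (rule real_le_lsqrt)
  have "x \<le> y + \<eta>\<^sup>2" using assms by linarith
  then have "max 0 x \<le> max 0 y + \<eta>\<^sup>2" using zero_le_power2[of \<eta>] by (simp add: max_def)
  also have "\<dots> \<le> (sqrt (max 0 y) + \<eta>)\<^sup>2" using assms by (simp add: power2_sum)
  finally show "max 0 x \<le> (sqrt (max 0 y) + \<eta>)\<^sup>2" .
  show "0 \<le> sqrt (max 0 y) + \<eta>" using assms by simp
qed

lemma half_inverse:
  fixes z :: real
  shows "inverse z / 2 * (2 * u * w) = u * w / z"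
  by (simp add: inverse_eq_divide)

lemma integral_affine_rate:
  fixes F :: "real \<Rightarrow> real"
  assumes "continuous_on {s..t} F" "s \<le> t"
  shows "integral {s..t} (\<lambda>x. k * (F x + h)) = k * (integral {s..t} F + h * (t - s))"
proof -
  have "integral {s..t} (\<lambda>x. F x + h) = integral {s..t} F + integral {s..t} (\<lambda>x. h)"
    by (rule integral_add) (use assms in \<open>auto intro: integrable_continuous_interval\<close>)
  with assms show ?thesis by (simp add: mult.commute)
qed

text \<open>
  Solutions grow at most at the fast rate, uniformly through the focus-node transition. The loss
  \<open>\<eta>\<close> in the rate can be made arbitrarily small, at the price of the constants.
\<close>
lemma growth_upper:
  fixes A :: "real \<Rightarrow> real^2^2"
  assumes A: "continuous_on {c..d} A" and eta: "\<eta> > 0"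
  shows "\<exists>C>0. \<exists>\<rho>>0. \<exists>e0>0. \<forall>e s t Y. 0 < e \<and> e < e0 \<and> c \<le> s \<and> s \<le> t \<and> t \<le> d \<and>
      near_linear A \<rho> e s t Y \<longrightarrow>
      norm (Y t) \<le> C * norm (Y s) * exp ((integral {s..t} (\<lambda>x. fast_rate (A x)) + \<eta> * (t - s)) / e)"
proof -
  \<comment> \<open>two quarters are spent in the inequality for the quadratic form, one on
    \<open>\<alpha>\<close> and one on the discriminant\<close>
  define h where "h = \<eta> / 4"
  have h: "h > 0" using eta by (simp add: h_def)
  obtain M where M1: "M \<ge> 1" and approx: "\<And>\<rho>. 0 < \<rho> \<Longrightarrow> \<rho> \<le> 1 \<Longrightarrow> \<exists>\<alpha> \<beta> \<gamma> \<delta> \<beta>' \<gamma>' \<delta>' M'. smooth_approximant c d A M \<rho> M' \<alpha> \<beta> \<gamma> \<delta> \<beta>' \<gamma>' \<delta>'"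
    using smooth_coefficients[OF A] by blast
  \<comment> \<open>in this order: the approximants stay below \<open>M\<close>,
    \<open>\<alpha>\<close> is off by at most \<open>h\<close>, the square root of the
    discriminant by at most \<open>h\<close>, and the total error is admissible for the
    quadratic form\<close>
  define \<rho> where "\<rho> = min 1 (min h (min (h\<^sup>2 / (4 * M)) (h^3 / (4 * (24 * (M * M) + 4 * h\<^sup>2)))))"
  have pos: "24 * (M * M) + 4 * h\<^sup>2 > 0" using M1 by (simp add: add_pos_nonneg)
  have rho: "\<rho> > 0" "\<rho> \<le> 1" "\<rho> \<le> h" using h M1 pos by (auto simp: \<rho>_def)
  have "\<rho> \<le> h\<^sup>2 / (4 * M)" "\<rho> \<le> h^3 / (4 * (24 * (M * M) + 4 * h\<^sup>2))" by (auto simp: \<rho>_def)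
  then have rho2: "4 * M * \<rho> \<le> h\<^sup>2" and rho3: "(24 * (M * M) + 4 * h\<^sup>2) * (4 * \<rho>) \<le> h^3"
    using M1 pos by (simp_all add: pos_le_divide_eq mult_ac)
  obtain \<alpha> \<beta> \<gamma> \<delta> \<beta>' \<gamma>' \<delta>' M' where sa: "smooth_approximant c d A M \<rho> M' \<alpha> \<beta> \<gamma> \<delta> \<beta>' \<gamma>' \<delta>'"
    using approx[OF rho(1,2)] by blast
  note M' = smooth_approximant_def[THEN iffD1, OF sa, THEN conjunct1]
  note der = smooth_approximant_def[THEN iffD1, OF sa, THEN conjunct2, THEN conjunct1, rule_format]
  note bd = smooth_approximant_def[THEN iffD1, OF sa, THEN conjunct2, THEN conjunct2, THEN conjunct2, rule_format]
  define e0 where "e0 = h^3 / (12 * (M * (M' + 1)))"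
  have e0: "e0 > 0" using h M1 M' by (simp add: e0_def)
  define C where "C = sqrt (10 * (M * M) + h\<^sup>2) / h"
  have C: "C > 0" using M1 h by (simp add: C_def add_pos_nonneg)
  have main: "norm (Y t) \<le> C * norm (Y s) * exp ((integral {s..t} (\<lambda>x. fast_rate (A x)) + \<eta> * (t - s)) / e)"
    if e: "0 < e" "e < e0" and st: "c \<le> s" "s \<le> t" "t \<le> d" and nl: "near_linear A \<rho> e s t Y" for e s t Y
  proof -
    have e_small: "12 * (M * M') * e \<le> h^3"
    proof -
      have "12 * (M * M') * e \<le> 12 * (M * (M' + 1)) * e0" using e M1 M' by (intro mult_mono) auto
      also have "\<dots> = h^3" using M1 M' by (simp add: e0_def)
      finally show ?thesis .
    qed
    define D where "D = (\<lambda>x. (\<beta> x)\<^sup>2 + \<gamma> x * \<delta> x)"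
    define D' where "D' = (\<lambda>x. 2 * \<beta> x * \<beta>' x + \<gamma>' x * \<delta> x + \<gamma> x * \<delta>' x)"
    define k where "k = (\<lambda>x. sqrt ((D x)\<^sup>2 + h^4))"
    define P where "P = (\<lambda>x. \<beta> x * Y x$1 + \<gamma> x * Y x$2)"
    define Q where "Q = (\<lambda>x. \<delta> x * Y x$1 - \<beta> x * Y x$2)"
    define N where "N = (\<lambda>x. k x * ((Y x$1)\<^sup>2 + (Y x$2)\<^sup>2) + (P x)\<^sup>2 + (Q x)\<^sup>2)"
    obtain Y' where Y': "\<And>x. x \<in> {s..t} \<Longrightarrow> (Y has_vector_derivative Y' x) (at x within {s..t})"
      "\<And>x. x \<in> {s..t} \<Longrightarrow> norm (e *\<^sub>R Y' x - A x *v Y x) \<le> \<rho> * norm (Y x)"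
      using nl unfolding near_linear_def by metis
    define N' where "N' = (\<lambda>x. D x * D' x / k x * ((Y x$1)\<^sup>2 + (Y x$2)\<^sup>2)
       + k x * (2 * Y x$1 * Y' x$1 + 2 * Y x$2 * Y' x$2)
       + 2 * P x * (\<beta>' x * Y x$1 + \<gamma>' x * Y x$2 + \<beta> x * Y' x$1 + \<gamma> x * Y' x$2)
       + 2 * Q x * (\<delta>' x * Y x$1 - \<beta>' x * Y x$2 + \<delta> x * Y' x$1 - \<beta> x * Y' x$2))"
    have h4: "h^4 > 0" using h by simp
    have kpos: "k x \<ge> h\<^sup>2" "k x > 0" for x
    proof -
      show "k x \<ge> h\<^sup>2" unfolding k_def by (rule real_le_rsqrt) simp
      then show "k x > 0" using h by (smt (verit) zero_less_power)
    qed
    have Nder: "(N has_real_derivative N' x) (at x within {s..t})" if x: "x \<in> {s..t}" for x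
    proof -
      note d = der[THEN conjunct1, THEN has_field_derivative_at_within] der[THEN conjunct2, THEN conjunct1, THEN has_field_derivative_at_within] der[THEN conjunct2, THEN conjunct2, THEN has_field_derivative_at_within]
      note y = has_real_derivative_component[OF Y'(1)[OF x]]
      have DD: "(D has_real_derivative D' x) (at x within {s..t})"
        unfolding D_def D'_def by (rule derivative_eq_intros d refl)+ (simp add: algebra_simps)
      have "((\<lambda>x. (D x)\<^sup>2 + h^4) has_real_derivative 2 * D x * D' x) (at x within {s..t})"
        by (rule derivative_eq_intros DD refl)+ simp
      then have "(k has_real_derivative inverse (sqrt ((D x)\<^sup>2 + h^4)) / 2 * (2 * D x * D' x)) (at x within {s..t})"
        unfolding k_def by (intro DERIV_chain2[OF DERIV_real_sqrt]) (use h4 in \<open>auto intro: add_nonneg_pos\<close>)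
      moreover have "inverse (sqrt ((D x)\<^sup>2 + h^4)) / 2 * (2 * D x * D' x) = D x * D' x / k x"
        unfolding k_def by (rule half_inverse)
      ultimately have kd: "(k has_real_derivative D x * D' x / k x) (at x within {s..t})" by simp
      have Pd: "(P has_real_derivative \<beta>' x * Y x$1 + \<gamma>' x * Y x$2 + \<beta> x * Y' x$1 + \<gamma> x * Y' x$2) (at x within {s..t})"
        unfolding P_def by (rule derivative_eq_intros d y refl)+ (simp add: algebra_simps)
      have Qd: "(Q has_real_derivative \<delta>' x * Y x$1 - \<beta>' x * Y x$2 + \<delta> x * Y' x$1 - \<beta> x * Y' x$2) (at x within {s..t})"
        unfolding Q_def by (rule derivative_eq_intros d y refl)+ (simp add: algebra_simps)
      show ?thesis
        unfolding N_def N'_def by (rule derivative_eq_intros kd Pd Qd y refl)+ (simp add: algebra_simps)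
    qed
    have Nle: "N' x \<le> (2 / e * (fast_rate (A x) + \<eta>)) * N x" if x: "x \<in> {s..t}" for x
    proof -
      have xc: "x \<in> {c..d}" using x st by auto
      note b = bd[OF xc]
      obtain E1 E2 where E: "e * Y' x$1 = (\<alpha> x + \<beta> x) * Y x$1 + \<gamma> x * Y x$2 + E1"
        "e * Y' x$2 = \<delta> x * Y x$1 + (\<alpha> x - \<beta> x) * Y x$2 + E2"
        "\<bar>E1\<bar> \<le> 4 * \<rho> * sqrt ((Y x$1)\<^sup>2 + (Y x$2)\<^sup>2)" "\<bar>E2\<bar> \<le> 4 * \<rho> * sqrt ((Y x$1)\<^sup>2 + (Y x$2)\<^sup>2)"
        using perturbed_components[OF Y'(2)[OF x], of "\<alpha> x" "\<beta> x" "\<gamma> x" "\<delta> x"] b by metis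
      have "e * N' x \<le> 2 * (\<alpha> x + sqrt (max 0 (D x)) + 2 * h) * N x"
        unfolding N'_def N_def
        by (rule norm_form_inequality[where M = M and M' = M' and \<rho> = "4 * \<rho>" and \<eta> = h, OF h e(1)])
          (use b E e_small rho3 in \<open>simp_all add: D_def D'_def k_def P_def Q_def\<close>)
      also have "\<dots> \<le> 2 * (fast_rate (A x) + \<eta>) * N x"
      proof -
        have "sqrt (max 0 (D x)) \<le> sqrt (max 0 (discr (A x))) + h"
          by (rule sqrt_max_close) (use b rho2 h in \<open>auto simp: D_def abs_minus_commute\<close>)
        moreover have "\<bar>half_trace (A x) - \<alpha> x\<bar> \<le> \<rho>" using b by blast
        then have "\<alpha> x \<le> half_trace (A x) + h" using rho(3) by linarith
        ultimately have "\<alpha> x + sqrt (max 0 (D x)) + 2 * h \<le> fast_rate (A x) + \<eta>"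
          by (simp add: fast_rate_def h_def)
        moreover have "N x \<ge> 0" using kpos(2)[of x] by (simp add: N_def)
        ultimately show ?thesis by (intro mult_right_mono) auto
      qed
      finally show ?thesis using e by (simp add: field_simps)
    qed
    have cf: "continuous_on {s..t} (\<lambda>x. fast_rate (A x))"
      by (rule continuous_on_subset[OF continuous_on_rates(3)[OF A]]) (use st in auto)
    have cg: "continuous_on {s..t} (\<lambda>x. 2 / e * (fast_rate (A x) + \<eta>))"
      by (intro continuous_intros cf)
    have "N t \<le> N s * exp (integral {s..t} (\<lambda>x. 2 / e * (fast_rate (A x) + \<eta>)))"
      by (rule linear_differential_inequality[OF st(2) cg Nder Nle])
    also have "integral {s..t} (\<lambda>x. 2 / e * (fast_rate (A x) + \<eta>))
        = 2 * ((integral {s..t} (\<lambda>x. fast_rate (A x)) + \<eta> * (t - s)) / e)"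
      by (subst integral_affine_rate[OF cf st(2)]) simp
    finally have Nt: "N t \<le> N s * (exp ((integral {s..t} (\<lambda>x. fast_rate (A x)) + \<eta> * (t - s)) / e))\<^sup>2"
      by (simp only: exp_double)
    let ?X = "exp ((integral {s..t} (\<lambda>x. fast_rate (A x)) + \<eta> * (t - s)) / e)"
    have low: "h\<^sup>2 * (norm (Y t))\<^sup>2 \<le> N t"
      using mult_right_mono[OF kpos(1)[of t], of "(Y t$1)\<^sup>2 + (Y t$2)\<^sup>2"]
      by (simp add: N_def norm_2 add_increasing2)
    have up: "N s \<le> (10 * (M * M) + h\<^sup>2) * (norm (Y s))\<^sup>2"
    proof -
      have xc: "s \<in> {c..d}" using st by auto
      have b: "\<bar>\<beta> s\<bar> \<le> M" "\<bar>\<gamma> s\<bar> \<le> M" "\<bar>\<delta> s\<bar> \<le> M" using bd[OF xc] by blast+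
      let ?S = "(Y s$1)\<^sup>2 + (Y s$2)\<^sup>2"
      have "\<bar>D s\<bar> \<le> 2 * (M * M)"
        using abs_product_le[OF b(1) b(1)] abs_product_le[OF b(2) b(3)]
        unfolding D_def power2_eq_square by linarith
      moreover have "k s \<le> \<bar>D s\<bar> + h\<^sup>2"
        unfolding k_def by (rule real_le_lsqrt) (auto simp: power2_sum)
      ultimately have "k s \<le> 2 * (M * M) + h\<^sup>2" by linarith
      then have "k s * ?S \<le> (2 * (M * M) + h\<^sup>2) * ?S" by (rule mult_right_mono) simp
      moreover have "(P s)\<^sup>2 \<le> 2 * (M * M) * ?S"
        using quad_bound[of "\<beta> s" M "\<gamma> s" "\<beta> s" M "\<gamma> s" "Y s$1" "Y s$2"] b
        by (simp add: P_def power2_eq_square)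
      moreover have "(Q s)\<^sup>2 \<le> 2 * (M * M) * ?S"
        using quad_bound[of "\<delta> s" M "- \<beta> s" "\<delta> s" M "- \<beta> s" "Y s$1" "Y s$2"] b
        by (simp add: Q_def power2_eq_square)
      moreover have "0 \<le> M * M * ?S" using M1 by simp
      ultimately have "N s \<le> (10 * (M * M) + h\<^sup>2) * ?S"
        unfolding N_def by (simp add: algebra_simps)
      then show ?thesis by (simp add: norm_2)
    qed
    have "h\<^sup>2 * (norm (Y t))\<^sup>2 \<le> (10 * (M * M) + h\<^sup>2) * (norm (Y s))\<^sup>2 * ?X\<^sup>2"
      by (rule order_trans[OF low order_trans[OF Nt mult_right_mono[OF up]]]) simp
    also have "10 * (M * M) + h\<^sup>2 = (h * C)\<^sup>2"
      using h M1 by (simp add: C_def power_divide add_nonneg_nonneg)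
    finally have "(h * norm (Y t))\<^sup>2 \<le> (h * (C * norm (Y s) * ?X))\<^sup>2"
      by (simp add: power_mult_distrib mult_ac)
    then have "h * norm (Y t) \<le> h * (C * norm (Y s) * ?X)"
      by (rule power2_le_imp_le) (use h C in simp)
    then show ?thesis using h by simp
  qed
  show ?thesis
    using C rho e0 main by blast
qed

lemma eigenvector_trace_free:
  fixes \<beta> :: real
  assumes "D = \<beta>\<^sup>2 + \<gamma> * \<delta>" "D > 0"
  obtains p :: "real^2" where "p \<noteq> 0" "\<beta> * p$1 + \<gamma> * p$2 = sqrt D * p$1" "\<delta> * p$1 - \<beta> * p$2 = sqrt D * p$2"
proof -
  define q where "q = sqrt D"
  have q: "q > 0" "q * q = \<beta> * \<beta> + \<gamma> * \<delta>" using assms by (simp_all add: q_def power2_eq_square)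
  define p :: "real^2" where "p = (if \<beta> \<ge> 0 then vector [q + \<beta>, \<delta>] else vector [\<gamma>, q - \<beta>])"
  have "p \<noteq> 0"
  proof
    assume "p = 0"
    then have "p$1 = 0" "p$2 = 0" by simp_all
    then show False using q(1) by (simp add: p_def split: if_splits)
  qed
  moreover have "\<beta> * p$1 + \<gamma> * p$2 = q * p$1" "\<delta> * p$1 - \<beta> * p$2 = q * p$2"
    using q(2) by (simp_all add: p_def algebra_simps)
  ultimately show thesis using that by (simp add: q_def)
qed

text \<open>
  Along a node, a solution that starts on the fast eigenline of the approximating matrix keeps the
  fast rate. The comparison is with the form \<open>(y, B y)\<close>, which equals \<open>sqrt D
  |y|\<^sup>2\<close> at the start and is at most a constant times \<open>|y|\<^sup>2\<close>
  later.
\<close>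
lemma fast_growth:
  fixes A :: "real \<Rightarrow> real^2^2"
  assumes A: "continuous_on {c..d} A" and eta: "\<eta> > 0" and cd: "c \<le> d"
    and disc: "\<And>x. x \<in> {c..d} \<Longrightarrow> discr (A x) > 0"
  shows "\<exists>C>0. \<exists>\<rho>>0. \<exists>e0>0. \<exists>p. p \<noteq> 0 \<and> (\<forall>e t \<sigma> Y. 0 < e \<and> e < e0 \<and> c \<le> t \<and> t \<le> d \<and>
      near_linear A \<rho> e c t Y \<and> Y c = \<sigma> *\<^sub>R p \<longrightarrow>
      norm (Y c) * exp ((integral {c..t} (\<lambda>x. fast_rate (A x)) - \<eta> * (t - c)) / e) \<le> C * norm (Y t))"
proof -
  define h where "h = \<eta> / 3"
  have h: "h > 0" using eta by (simp add: h_def)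
  obtain x0 where x0: "x0 \<in> {c..d}" "\<And>x. x \<in> {c..d} \<Longrightarrow> discr (A x0) \<le> discr (A x)"
    using continuous_attains_inf[OF compact_Icc _ continuous_on_rates(2)[OF A]] cd by auto
  define d0 where "d0 = discr (A x0)"
  have d0: "d0 > 0" "\<And>x. x \<in> {c..d} \<Longrightarrow> discr (A x) \<ge> d0" using disc x0 by (auto simp: d0_def)
  obtain M where M1: "M \<ge> 1" and approx: "\<And>\<rho>. 0 < \<rho> \<Longrightarrow> \<rho> \<le> 1 \<Longrightarrow>
      \<exists>\<alpha> \<beta> \<gamma> \<delta> \<beta>' \<gamma>' \<delta>' M'. smooth_approximant c d A M \<rho> M' \<alpha> \<beta> \<gamma> \<delta> \<beta>' \<gamma>' \<delta>'"
    using smooth_coefficients[OF A] by blast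
  \<comment> \<open>makes \<open>\<theta> sqrt D \<le> h\<close>, since \<open>sqrt D \<le> 2
    M\<close>\<close>
  define \<theta> where "\<theta> = min 1 (h / (2 * M))"
  have th: "\<theta> > 0" "\<theta> \<le> 1" using h M1 by (auto simp: \<theta>_def)
  have "\<theta> \<le> h / (2 * M)" by (simp add: \<theta>_def)
  then have th2: "\<theta> * (2 * M) \<le> h" using M1 by (simp add: pos_le_divide_eq)
  define \<rho> where "\<rho> = min 1 (min h (min (h\<^sup>2 / (4 * M)) (min (d0 / (8 * M)) (\<theta> * d0 / (128 * M)))))"
  have rho: "\<rho> > 0" "\<rho> \<le> 1" "\<rho> \<le> h" using h M1 th d0 by (auto simp: \<rho>_def)
  have "\<rho> \<le> h\<^sup>2 / (4 * M)" "\<rho> \<le> d0 / (8 * M)" "\<rho> \<le> \<theta> * d0 / (128 * M)" by (auto simp: \<rho>_def)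
  then have rho2: "4 * M * \<rho> \<le> h\<^sup>2" and rho3: "8 * M * \<rho> \<le> d0" and rho4: "128 * M * \<rho> \<le> \<theta> * d0"
    using M1 by (simp_all add: pos_le_divide_eq mult_ac)
  obtain \<alpha> \<beta> \<gamma> \<delta> \<beta>' \<gamma>' \<delta>' M' where sa: "smooth_approximant c d A M \<rho> M' \<alpha> \<beta> \<gamma> \<delta> \<beta>' \<gamma>' \<delta>'"
    using approx[OF rho(1,2)] by blast
  note M' = smooth_approximant_def[THEN iffD1, OF sa, THEN conjunct1]
  note der = smooth_approximant_def[THEN iffD1, OF sa, THEN conjunct2, THEN conjunct1, rule_format]
  note ca = smooth_approximant_def[THEN iffD1, OF sa, THEN conjunct2, THEN conjunct2, THEN conjunct1]
  note bd = smooth_approximant_def[THEN iffD1, OF sa, THEN conjunct2, THEN conjunct2, THEN conjunct2, rule_format]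
  have Mb: "\<bar>\<beta> x\<bar> \<le> M" "\<bar>\<gamma> x\<bar> \<le> M" "\<bar>\<delta> x\<bar> \<le> M" if "x \<in> {c..d}" for x using bd[OF that] by blast+
  have M'b: "\<bar>\<beta>' x\<bar> \<le> M'" "\<bar>\<gamma>' x\<bar> \<le> M'" "\<bar>\<delta>' x\<bar> \<le> M'" if "x \<in> {c..d}" for x using bd[OF that] by blast+
  define D where "D = (\<lambda>x. (\<beta> x)\<^sup>2 + \<gamma> x * \<delta> x)"
  have Dd: "\<bar>discr (A x) - D x\<bar> \<le> 4 * M * \<rho>" if "x \<in> {c..d}" for x using bd[OF that] unfolding D_def by blast
  have Dlow: "D x \<ge> d0 / 2" if "x \<in> {c..d}" for x using Dd[OF that] d0(2)[OF that] rho3 by linarith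
  have Dup: "D x \<le> (2 * M)\<^sup>2" if "x \<in> {c..d}" for x
    using abs_product_le[OF Mb(1)[OF that] Mb(1)[OF that]] abs_product_le[OF Mb(2)[OF that] Mb(3)[OF that]]
      zero_le_square[of M]
    unfolding D_def power2_eq_square by simp
  have Dpos: "D x > 0" if "x \<in> {c..d}" for x using Dlow[OF that] d0(1) by linarith
  have cin: "c \<in> {c..d}" using cd by simp
  obtain p :: "real^2" where p: "p \<noteq> 0" "\<beta> c * p$1 + \<gamma> c * p$2 = sqrt (D c) * p$1"
      "\<delta> c * p$1 - \<beta> c * p$2 = sqrt (D c) * p$2"
    using eigenvector_trace_free[of "D c" "\<beta> c" "\<gamma> c" "\<delta> c"] Dpos[OF cin] unfolding D_def by blast
  define e0 where "e0 = \<theta> * d0 / (16 * (M' + 1))"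
  have e0: "e0 > 0" using th d0 M' by (simp add: e0_def)
  define q0 where "q0 = sqrt (d0 / 2)"
  have q0: "q0 > 0" using d0 by (simp add: q0_def)
  define C where "C = sqrt (4 * M / q0)"
  have C: "C > 0" using M1 q0 by (simp add: C_def)
  have main: "norm (Y c) * exp ((integral {c..t} (\<lambda>x. fast_rate (A x)) - \<eta> * (t - c)) / e) \<le> C * norm (Y t)"
    if e: "0 < e" "e < e0" and t: "c \<le> t" "t \<le> d" and nl: "near_linear A \<rho> e c t Y"
      and Yc: "Y c = \<sigma> *\<^sub>R p" for e t \<sigma> Y
  proof -
    have e_small: "16 * M' * e \<le> \<theta> * d0"
    proof -
      have "16 * M' * e \<le> 16 * (M' + 1) * e0" using e M' by (intro mult_mono) auto
      also have "\<dots> = \<theta> * d0" using M' by (simp add: e0_def)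
      finally show ?thesis .
    qed
    define P where "P = (\<lambda>x. \<beta> x * Y x$1 + \<gamma> x * Y x$2)"
    define Q where "Q = (\<lambda>x. \<delta> x * Y x$1 - \<beta> x * Y x$2)"
    define V where "V = (\<lambda>x. Y x$1 * P x + Y x$2 * Q x)"
    obtain Y' where Y': "\<And>x. x \<in> {c..t} \<Longrightarrow> (Y has_vector_derivative Y' x) (at x within {c..t})"
      "\<And>x. x \<in> {c..t} \<Longrightarrow> norm (e *\<^sub>R Y' x - A x *v Y x) \<le> \<rho> * norm (Y x)"
      using nl unfolding near_linear_def by metis
    define V' where "V' = (\<lambda>x. Y' x$1 * P x + Y' x$2 * Q x
      + Y x$1 * (\<beta>' x * Y x$1 + \<gamma>' x * Y x$2 + \<beta> x * Y' x$1 + \<gamma> x * Y' x$2)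
      + Y x$2 * (\<delta>' x * Y x$1 - \<beta>' x * Y x$2 + \<delta> x * Y' x$1 - \<beta> x * Y' x$2))"
    have Vder: "(V has_real_derivative V' x) (at x within {c..t})" if x: "x \<in> {c..t}" for x
    proof -
      note d = der[THEN conjunct1, THEN has_field_derivative_at_within]
        der[THEN conjunct2, THEN conjunct1, THEN has_field_derivative_at_within]
        der[THEN conjunct2, THEN conjunct2, THEN has_field_derivative_at_within]
      note y = has_real_derivative_component[OF Y'(1)[OF x]]
      have Pd: "(P has_real_derivative \<beta>' x * Y x$1 + \<gamma>' x * Y x$2 + \<beta> x * Y' x$1 + \<gamma> x * Y' x$2) (at x within {c..t})"
        unfolding P_def by (rule derivative_eq_intros d y refl)+ (simp add: algebra_simps)
      have Qd: "(Q has_real_derivative \<delta>' x * Y x$1 - \<beta>' x * Y x$2 + \<delta> x * Y' x$1 - \<beta> x * Y' x$2) (at x within {c..t})"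
        unfolding Q_def by (rule derivative_eq_intros d y refl)+ (simp add: algebra_simps)
      show ?thesis
        unfolding V_def V'_def by (rule derivative_eq_intros Pd Qd y refl)+ (simp add: algebra_simps)
    qed
    define g where "g = (\<lambda>x. 2 / e * (\<alpha> x + (1 - \<theta>) * sqrt (D x)))"
    have Vge: "- V' x \<le> g x * - V x" if x: "x \<in> {c..t}" for x
    proof -
      have xc: "x \<in> {c..d}" using x t by auto
      note b = bd[OF xc]
      obtain E1 E2 where E: "e * Y' x$1 = (\<alpha> x + \<beta> x) * Y x$1 + \<gamma> x * Y x$2 + E1"
        "e * Y' x$2 = \<delta> x * Y x$1 + (\<alpha> x - \<beta> x) * Y x$2 + E2"
        "\<bar>E1\<bar> \<le> 4 * \<rho> * sqrt ((Y x$1)\<^sup>2 + (Y x$2)\<^sup>2)" "\<bar>E2\<bar> \<le> 4 * \<rho> * sqrt ((Y x$1)\<^sup>2 + (Y x$2)\<^sup>2)"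
        using perturbed_components[OF Y'(2)[OF x], of "\<alpha> x" "\<beta> x" "\<gamma> x" "\<delta> x"] b by metis
      have "\<theta> * (d0 / 2) \<le> \<theta> * D x" using Dlow[OF xc] th by (intro mult_left_mono) auto
      then have small: "4 * M' * e + 8 * M * (4 * \<rho>) \<le> \<theta> * D x" using e_small rho4 by linarith
      have "2 * (\<alpha> x + (1 - \<theta>) * sqrt (D x)) * V x \<le> e * V' x"
        unfolding V_def V'_def
        by (rule fast_form_inequality[OF e(1) D_def[THEN fun_cong] Dpos[OF xc] _ th(2) Mb[OF xc] M'b[OF xc] E(3,4) small E(1,2)])
          (use th in \<open>simp_all add: P_def Q_def\<close>)
      then have "g x * V x \<le> V' x" using e unfolding g_def by (simp add: field_simps)
      then show ?thesis by simp
    qed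
    have c: "continuous_on UNIV \<beta>" "continuous_on UNIV \<gamma>" "continuous_on UNIV \<delta>"
      using der[THEN conjunct1] der[THEN conjunct2, THEN conjunct1] der[THEN conjunct2, THEN conjunct2]
      by (auto intro!: continuous_at_imp_continuous_on DERIV_isCont)
    have cD: "continuous_on UNIV D"
      unfolding D_def
      by (intro continuous_intros c)
    have cg: "continuous_on {c..t} g"
      unfolding g_def by (intro continuous_intros continuous_on_subset[OF ca] continuous_on_subset[OF cD]) auto
    have "- V t \<le> - V c * exp (integral {c..t} g)"
      by (rule linear_differential_inequality[OF t(1) cg DERIV_minus[OF Vder] Vge])
    then have Vt: "V c * exp (integral {c..t} g) \<le> V t" by simp
    have q: "sqrt (D c) \<ge> q0" unfolding q0_def using Dlow[OF cin] by simp
    have Vc: "V c = sqrt (D c) * (norm (Y c))\<^sup>2"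
    proof -
      have "P c = \<sigma> * (\<beta> c * p$1 + \<gamma> c * p$2)" "Q c = \<sigma> * (\<delta> c * p$1 - \<beta> c * p$2)"
        by (simp_all add: P_def Q_def Yc algebra_simps)
      then have "P c = sqrt (D c) * Y c$1" "Q c = sqrt (D c) * Y c$2"
        unfolding p by (simp_all add: Yc mult_ac)
      then show ?thesis by (simp add: V_def norm_2 power2_eq_square algebra_simps)
    qed
    have cf: "continuous_on {c..t} (\<lambda>x. fast_rate (A x))"
      by (rule continuous_on_subset[OF continuous_on_rates(3)[OF A]]) (use t in auto)
    have "integral {c..t} (\<lambda>x. 2 / e * (fast_rate (A x) + - \<eta>)) \<le> integral {c..t} g"
    proof (rule integral_le)
      show "(\<lambda>x. 2 / e * (fast_rate (A x) + - \<eta>)) integrable_on {c..t}"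
        by (intro integrable_continuous_interval continuous_intros cf)
      show "g integrable_on {c..t}" by (intro integrable_continuous_interval cg)
      fix x assume "x \<in> {c..t}"
      then have xc: "x \<in> {c..d}" using t by auto
      have "sqrt (max 0 (discr (A x))) \<le> sqrt (max 0 (D x)) + h"
        by (rule sqrt_max_close) (use Dd[OF xc] rho2 h in linarith)+
      moreover have "max 0 (D x) = D x" using Dpos[OF xc] by simp
      moreover have "sqrt (D x) \<le> 2 * M" using Dup[OF xc] M1 by (intro real_le_lsqrt) auto
      then have "\<theta> * sqrt (D x) \<le> \<theta> * (2 * M)" using th by (intro mult_left_mono) auto
      moreover have "\<bar>half_trace (A x) - \<alpha> x\<bar> \<le> \<rho>" using bd[OF xc] by blast
      then have "half_trace (A x) \<le> \<alpha> x + h" using rho(3) by linarith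
      ultimately have "fast_rate (A x) - \<eta> \<le> \<alpha> x + (1 - \<theta>) * sqrt (D x)"
        using th2 by (simp add: fast_rate_def h_def algebra_simps)
      then show "2 / e * (fast_rate (A x) + - \<eta>) \<le> g x"
        unfolding g_def using e by (intro mult_left_mono) auto
    qed
    also have "integral {c..t} (\<lambda>x. 2 / e * (fast_rate (A x) + - \<eta>))
        = 2 * ((integral {c..t} (\<lambda>x. fast_rate (A x)) - \<eta> * (t - c)) / e)"
      by (subst integral_affine_rate[OF cf t(1)]) simp
    finally have gi: "2 * ((integral {c..t} (\<lambda>x. fast_rate (A x)) - \<eta> * (t - c)) / e) \<le> integral {c..t} g" .
    let ?X = "exp ((integral {c..t} (\<lambda>x. fast_rate (A x)) - \<eta> * (t - c)) / e)"
    have X2: "?X\<^sup>2 \<le> exp (integral {c..t} g)" using gi by (simp flip: exp_double)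
    have tc: "t \<in> {c..d}" using t by auto
    have Vup: "V t \<le> 4 * M * (norm (Y t))\<^sup>2"
      using quad_bound[of 1 1 0 "\<beta> t" M "\<gamma> t" "Y t$1" "Y t$2"] quad_bound[of 0 1 1 "\<delta> t" M "- \<beta> t" "Y t$1" "Y t$2"]
        Mb[OF tc] unfolding V_def P_def Q_def norm_2 by simp
    have "q0 * (norm (Y c))\<^sup>2 * ?X\<^sup>2 \<le> sqrt (D c) * (norm (Y c))\<^sup>2 * exp (integral {c..t} g)"
      using q q0 X2 Dpos[OF cin] by (intro mult_mono) auto
    also have "\<dots> \<le> 4 * M * (norm (Y t))\<^sup>2" using Vt Vup unfolding Vc by linarith
    finally have "(norm (Y c))\<^sup>2 * ?X\<^sup>2 \<le> 4 * M / q0 * (norm (Y t))\<^sup>2" using q0 by (simp add: field_simps)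
    also have "4 * M / q0 = C\<^sup>2" using M1 q0 by (simp add: C_def)
    finally have "(norm (Y c) * ?X)\<^sup>2 \<le> (C * norm (Y t))\<^sup>2" by (simp add: power_mult_distrib)
    then show ?thesis by (rule power2_le_imp_le) (use C in simp)
  qed
  show ?thesis
    by (rule exI[of _ C], rule conjI[OF C], rule exI[of _ \<rho>], rule conjI[OF rho(1)], rule exI[of _ e0], rule conjI[OF e0],
        rule exI[of _ p], rule conjI[OF p(1)]) (use main in blast)
qed

text \<open>
  Reversing time replaces \<open>A\<close> by \<open>- A\<close>, which exchanges the two rates up
  to sign. So every estimate from above at the fast rate has a counterpart from below at the slow
  rate.
\<close>
lemma near_linear_reverse:
  assumes "near_linear A \<rho> e s t Y"
  shows "near_linear (\<lambda>x. - A (- x)) \<rho> e (- t) (- s) (\<lambda>x. Y (- x))"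
  unfolding near_linear_def
proof
  fix x assume "x \<in> {- t..- s}"
  then have "- x \<in> {s..t}" by auto
  then obtain v where v: "(Y has_vector_derivative v) (at (- x) within {s..t})"
    "norm (e *\<^sub>R v - A (- x) *v Y (- x)) \<le> \<rho> * norm (Y (- x))"
    using assms unfolding near_linear_def by blast
  have im: "uminus ` {- t..- s} = {s..t}" by simp
  have "((\<lambda>x. - x) has_vector_derivative -1) (at x within {- t..- s})"
    by (auto intro!: derivative_eq_intros)
  from vector_diff_chain_within[OF this, of Y v] v(1)
  have "((\<lambda>x. Y (- x)) has_vector_derivative - v) (at x within {- t..- s})"
    by (simp add: im o_def)
  moreover have "norm (e *\<^sub>R (- v) - (- A (- x)) *v Y (- x)) \<le> \<rho> * norm (Y (- x))"
  proof -
    have "(- A (- x)) *v Y (- x) = - (A (- x) *v Y (- x))"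
      by (simp add: matrix_vector_mult_def vec_eq_iff sum_negf)
    then have "e *\<^sub>R (- v) - (- A (- x)) *v Y (- x) = - (e *\<^sub>R v - A (- x) *v Y (- x))" by simp
    then show ?thesis using v(2) by (simp only: norm_minus_cancel)
  qed
  ultimately show "\<exists>v. ((\<lambda>x. Y (- x)) has_vector_derivative v) (at x within {- t..- s}) \<and>
      norm (e *\<^sub>R v - (- A (- x)) *v Y (- x)) \<le> \<rho> * norm (Y (- x))" by blast
qed

lemma rates_minus: "fast_rate (- A) = - slow_rate A" "discr (- A) = discr A"
proof -
  have neg: "(- x - - y) / 2 = - ((x - y) / 2)" "(- x + - y) / 2 = - ((x + y) / 2)" for x y :: real
    by (simp_all add: field_simps)
  show d: "discr (- A) = discr A"
    unfolding discr_def vector_uminus_component neg by simp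
  show "fast_rate (- A) = - slow_rate A"
    unfolding fast_rate_def slow_rate_def d unfolding half_trace_def vector_uminus_component neg by simp
qed

lemma integral_fast_reverse:
  fixes A :: "real \<Rightarrow> real^2^2"
  shows "integral {- t..- s} (\<lambda>x. fast_rate (- A (- x))) = - integral {s..t} (\<lambda>x. slow_rate (A x))"
  unfolding rates_minus using Henstock_Kurzweil_Integration.integral_reflect_real[of t s "\<lambda>x. slow_rate (A x)"] by simp

lemma continuous_on_reverse:
  fixes A :: "real \<Rightarrow> real^2^2"
  assumes "continuous_on {c..d} A"
  shows "continuous_on {- d..- c} (\<lambda>x. - A (- x))"
  by (intro continuous_intros continuous_on_compose2[OF assms]) auto

lemma growth_lower:
  fixes A :: "real \<Rightarrow> real^2^2"
  assumes A: "continuous_on {c..d} A" and eta: "\<eta> > 0"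
  shows "\<exists>C>0. \<exists>\<rho>>0. \<exists>e0>0. \<forall>e s t Y. 0 < e \<and> e < e0 \<and> c \<le> s \<and> s \<le> t \<and> t \<le> d \<and>
      near_linear A \<rho> e s t Y \<longrightarrow>
      norm (Y s) \<le> C * norm (Y t) * exp ((- integral {s..t} (\<lambda>x. slow_rate (A x)) + \<eta> * (t - s)) / e)"
proof -
  obtain C \<rho> e0 where *: "C > 0" "\<rho> > 0" "e0 > 0"
    and G: "\<And>e s t Y. 0 < e \<and> e < e0 \<and> - d \<le> s \<and> s \<le> t \<and> t \<le> - c \<and>
      near_linear (\<lambda>x. - A (- x)) \<rho> e s t Y \<Longrightarrow>
      norm (Y t) \<le> C * norm (Y s) * exp ((integral {s..t} (\<lambda>x. fast_rate (- A (- x))) + \<eta> * (t - s)) / e)"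
    using growth_upper[OF continuous_on_reverse[OF A] eta] by blast
  have "norm (Y s) \<le> C * norm (Y t) * exp ((- integral {s..t} (\<lambda>x. slow_rate (A x)) + \<eta> * (t - s)) / e)"
    if "0 < e \<and> e < e0 \<and> c \<le> s \<and> s \<le> t \<and> t \<le> d \<and> near_linear A \<rho> e s t Y" for e s t Y
    using G[of e "- t" "- s" "\<lambda>x. Y (- x)"] that near_linear_reverse
    by (simp add: integral_fast_reverse add.commute)
  with * show ?thesis by blast
qed

lemma slow_decay:
  fixes A :: "real \<Rightarrow> real^2^2"
  assumes A: "continuous_on {c..d} A" and eta: "\<eta> > 0" and cd: "c \<le> d"
    and disc: "\<And>x. x \<in> {c..d} \<Longrightarrow> discr (A x) > 0"
  shows "\<exists>C>0. \<exists>\<rho>>0. \<exists>e0>0. \<exists>p. p \<noteq> 0 \<and> (\<forall>e t \<sigma> Y. 0 < e \<and> e < e0 \<and> c \<le> t \<and> t \<le> d \<and>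
      near_linear A \<rho> e t d Y \<and> Y d = \<sigma> *\<^sub>R p \<longrightarrow>
      norm (Y d) * exp ((- integral {t..d} (\<lambda>x. slow_rate (A x)) - \<eta> * (d - t)) / e) \<le> C * norm (Y t))"
proof -
  have d': "discr (- A (- x)) > 0" if "x \<in> {- d..- c}" for x
    using disc[of "- x"] that by (auto simp: rates_minus)
  have cd': "- d \<le> - c" using cd by simp
  obtain C \<rho> e0 p where *: "C > 0" "\<rho> > 0" "e0 > 0" "p \<noteq> 0"
    and F: "\<And>e t \<sigma> Y. 0 < e \<and> e < e0 \<and> - d \<le> t \<and> t \<le> - c \<and>
      near_linear (\<lambda>x. - A (- x)) \<rho> e (- d) t Y \<and> Y (- d) = \<sigma> *\<^sub>R p \<Longrightarrow>
      norm (Y (- d)) * exp ((integral {- d..t} (\<lambda>x. fast_rate (- A (- x))) - \<eta> * (t - (- d))) / e) \<le> C * norm (Y t)"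
    using fast_growth[OF continuous_on_reverse[OF A] eta cd' d'] by blast
  have "norm (Y d) * exp ((- integral {t..d} (\<lambda>x. slow_rate (A x)) - \<eta> * (d - t)) / e) \<le> C * norm (Y t)"
    if "0 < e \<and> e < e0 \<and> c \<le> t \<and> t \<le> d \<and> near_linear A \<rho> e t d Y \<and> Y d = \<sigma> *\<^sub>R p" for e t \<sigma> Y
    using F[of e "- t" "\<lambda>x. Y (- x)" \<sigma>] that near_linear_reverse[of A \<rho> e t d Y]
    by (simp add: integral_fast_reverse add.commute)
  with * show ?thesis by blast
qed

section \<open>Ordinary differential equations with globally Lipschitz right-hand side\<close>

lemma vector_derivative_imp_continuous_on:
  "(\<And>x. x \<in> S \<Longrightarrow> (u has_vector_derivative g x) (at x within S)) \<Longrightarrow> continuous_on S u"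
  unfolding continuous_on_eq_continuous_within by (blast intro: has_vector_derivative_continuous)

definition solves :: "(real \<Rightarrow> 'a::real_normed_vector \<Rightarrow> 'a) \<Rightarrow> real \<Rightarrow> real \<Rightarrow> (real \<Rightarrow> 'a) \<Rightarrow> bool" where
  "solves H c d y \<longleftrightarrow> (\<forall>t\<in>{c..d}. (y has_vector_derivative H t (y t)) (at t within {c..d}))"

text \<open>
  This is the contraction estimate for the weighted supremum norm with weight \<open>exp (- K |t -
  t0|)\<close>, on both sides of the initial time.
\<close>
lemma exponential_primitive_bound:
  fixes u :: "real \<Rightarrow> 'a::euclidean_space"
  assumes K: "K > 0" and t0: "t0 \<in> {c..d}" and t: "t \<in> {c..d}"
    and u: "\<And>x. x \<in> {c..d} \<Longrightarrow> (u has_vector_derivative g x) (at x within {c..d})"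
    and g: "\<And>x. x \<in> {c..d} \<Longrightarrow> norm (g x) \<le> B * exp (K * \<bar>x - t0\<bar>)"
    and B: "B \<ge> 0"
  shows "norm (u t - u t0) \<le> B / K * exp (K * \<bar>t - t0\<bar>)"
proof -
  have cu: "continuous_on {c..d} u" by (rule vector_derivative_imp_continuous_on) (rule u)
  have der: "(u has_vector_derivative g x) (at x)" if "c < x" "x < d" for x
    using u[of x] that at_within_Icc_at[of c x d] by simp
  consider "t = t0" | "t0 < t" | "t < t0" by linarith
  then show ?thesis
  proof cases
    case 1
    then show ?thesis using B K by simp
  next
    case 2
    have "norm (u t - u t0) \<le> B / K * exp (K * (t - t0)) - B / K * exp (K * (t0 - t0))"
    proof (rule differentiable_bound_general[OF 2, where \<phi>' = "\<lambda>x. B * exp (K * (x - t0))" and f' = g])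
      show "continuous_on {t0..t} u" by (rule continuous_on_subset[OF cu]) (use t0 t in auto)
      fix x assume x: "t0 < x" "x < t"
      show "((\<lambda>x. B / K * exp (K * (x - t0))) has_vector_derivative B * exp (K * (x - t0))) (at x)"
        using K by (auto intro!: derivative_eq_intros simp: has_real_derivative_iff_has_vector_derivative[symmetric])
      show "(u has_vector_derivative g x) (at x)" using der x t0 t by auto
      show "norm (g x) \<le> B * exp (K * (x - t0))" using g[of x] x t0 t by auto
    qed (use K in \<open>auto intro!: continuous_intros\<close>)
    moreover have "B / K \<ge> 0" using B K by simp
    ultimately show ?thesis using 2 by simp
  next
    case 3
    have "norm (u t0 - u t) \<le> - B / K * exp (K * (t0 - t0)) - (- B / K * exp (K * (t0 - t)))"
    proof (rule differentiable_bound_general[OF 3, where \<phi>' = "\<lambda>x. B * exp (K * (t0 - x))" and f' = g])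
      show "continuous_on {t..t0} u" by (rule continuous_on_subset[OF cu]) (use t0 t in auto)
      fix x assume x: "t < x" "x < t0"
      show "((\<lambda>x. - B / K * exp (K * (t0 - x))) has_vector_derivative B * exp (K * (t0 - x))) (at x)"
        using K by (auto intro!: derivative_eq_intros simp: has_real_derivative_iff_has_vector_derivative[symmetric])
      show "(u has_vector_derivative g x) (at x)" using der x t0 t by auto
      show "norm (g x) \<le> B * exp (K * (t0 - x))" using g[of x] x t0 t by auto
    qed (use K in \<open>auto intro!: continuous_intros\<close>)
    moreover have "B / K \<ge> 0" using B K by simp
    ultimately show ?thesis using 3 by (simp add: norm_minus_commute)
  qed
qed

text \<open>
  The integral operator is a contraction for the weighted norm on the whole interval at once, so
  that no continuation of local solutions is needed. Functions on the interval are extended to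
  bounded continuous functions on the line by composing with the projection \<open>cl\<close>.
\<close>
lemma global_solution_exists:
  fixes H :: "real \<Rightarrow> 'a::euclidean_space \<Rightarrow> 'a"
  assumes cont: "continuous_on ({c..d} \<times> UNIV) (\<lambda>(t, y). H t y)"
    and lip: "\<And>t x y. t \<in> {c..d} \<Longrightarrow> norm (H t x - H t y) \<le> L * norm (x - y)"
    and t0: "t0 \<in> {c..d}"
  obtains y where "y t0 = y0" "solves H c d y"
proof -
  define K where "K = 2 * (\<bar>L\<bar> + 1)"
  have K: "K > 0" by (simp add: K_def add_nonneg_pos)
  define w where "w = (\<lambda>t. exp (K * \<bar>t - t0\<bar>))"
  have w: "w t > 0" "continuous_on S w" for t S
    unfolding w_def by (auto intro!: continuous_intros)
  define cl where "cl = (\<lambda>t. max c (min t d))"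
  have cl: "cl t \<in> {c..d}" "continuous_on S cl" "t \<in> {c..d} \<Longrightarrow> cl t = t" for t S
    using t0 unfolding cl_def by (auto intro!: continuous_intros)
  define G where "G = (\<lambda>z s. H s (w s *\<^sub>R z s))"
  define J where "J = (\<lambda>z t. integral {c..t} (G z) - integral {c..t0} (G z))"
  define T where "T = (\<lambda>z t. inverse (w (cl t)) *\<^sub>R (y0 + J z (cl t)))"
  have cG: "continuous_on {c..d} (G z)" if "continuous_on {c..d} z" for z
  proof -
    have "continuous_on {c..d} ((\<lambda>(t, y). H t y) \<circ> (\<lambda>s. (s, w s *\<^sub>R z s)))"
      by (intro continuous_on_compose continuous_on_subset[OF cont] continuous_intros w that) auto
    then show ?thesis by (simp add: G_def o_def)
  qed
  have dJ: "(J z has_vector_derivative G z t) (at t within {c..d})"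
    if "continuous_on {c..d} z" "t \<in> {c..d}" for z t
    unfolding J_def
    using has_vector_derivative_diff[OF integral_has_vector_derivative[OF cG[OF that(1)] that(2)] has_vector_derivative_const]
    by simp
  have J0: "J z t0 = 0" for z by (simp add: J_def)
  have T_bc: "T (apply_bcontfun z) \<in> bcontfun" for z :: "real \<Rightarrow>\<^sub>C 'a"
  proof -
    have cz: "continuous_on S (apply_bcontfun z)" for S
      using apply_bcontfun[of z] continuous_on_subset unfolding bcontfun_def by blast
    have cJ: "continuous_on {c..d} (J z)" by (rule vector_derivative_imp_continuous_on) (rule dJ[OF cz])
    have c1: "continuous_on {c..d} (\<lambda>t. inverse (w t) *\<^sub>R (y0 + J z t))"
      by (intro continuous_intros cJ w) (use w(1) in \<open>auto simp: less_imp_neq[symmetric]\<close>)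
    then have "continuous_on UNIV (T z)"
      unfolding T_def by (rule continuous_on_compose2) (use cl in auto)
    moreover have "bounded ((\<lambda>t. inverse (w t) *\<^sub>R (y0 + J z t)) ` {c..d})"
      by (intro compact_imp_bounded compact_continuous_image c1) simp
    then have "bounded (range (T z))"
      by (rule bounded_subset) (use cl(1) in \<open>auto simp: T_def\<close>)
    ultimately show ?thesis unfolding bcontfun_def by blast
  qed
  define F where "F = (\<lambda>z. Bcontfun (T (apply_bcontfun z)))"
  have F: "apply_bcontfun (F z) = T (apply_bcontfun z)" for z
    unfolding F_def by (rule Bcontfun_inverse) (rule T_bc)
  have cz: "continuous_on S (apply_bcontfun z)" for S and z :: "real \<Rightarrow>\<^sub>C 'a"
    using apply_bcontfun[of z] continuous_on_subset unfolding bcontfun_def by blast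
  have "\<exists>!z. F z = z"
  proof (rule banach_fix_type)
    show "0 \<le> (1/2::real)" "(1/2::real) < 1" by simp_all
    show "\<forall>z v. dist (F z) (F v) \<le> 1/2 * dist z v"
    proof (intro allI dist_bound)
      fix z v :: "real \<Rightarrow>\<^sub>C 'a" and t
      let ?\<tau> = "cl t"
      have "norm ((J z ?\<tau> - J v ?\<tau>) - (J z t0 - J v t0)) \<le> (\<bar>L\<bar> * dist z v) / K * exp (K * \<bar>?\<tau> - t0\<bar>)"
      proof (rule exponential_primitive_bound[OF K t0 cl(1)])
        fix x assume x: "x \<in> {c..d}"
        show "((\<lambda>t. J z t - J v t) has_vector_derivative G z x - G v x) (at x within {c..d})"
          by (intro derivative_intros dJ cz x)
        have "norm (G z x - G v x) \<le> L * norm (w x *\<^sub>R z x - w x *\<^sub>R v x)"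
          unfolding G_def by (rule lip[OF x])
        also have "\<dots> \<le> \<bar>L\<bar> * norm (w x *\<^sub>R z x - w x *\<^sub>R v x)" by (intro mult_right_mono) auto
        also have "\<dots> = \<bar>L\<bar> * (w x * dist (z x) (v x))"
          using w(1)[of x] by (simp add: dist_norm flip: scaleR_diff_right)
        also have "\<dots> \<le> \<bar>L\<bar> * (w x * dist z v)"
          using w(1)[of x] by (intro mult_left_mono dist_bounded) auto
        finally show "norm (G z x - G v x) \<le> \<bar>L\<bar> * dist z v * exp (K * \<bar>x - t0\<bar>)"
          by (simp add: w_def mult_ac)
      qed simp
      then have "norm (J z ?\<tau> - J v ?\<tau>) \<le> (\<bar>L\<bar> / K * dist z v) * w ?\<tau>"
        by (simp add: J0 w_def)
      also have "\<dots> \<le> (1/2 * dist z v) * w ?\<tau>"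
        using w(1)[of ?\<tau>] K by (intro mult_right_mono) (auto simp: K_def divide_le_eq)
      finally have "inverse (w ?\<tau>) * norm (J z ?\<tau> - J v ?\<tau>) \<le> 1/2 * dist z v"
        using w(1)[of ?\<tau>] by (simp add: field_simps)
      moreover have "dist (F z t) (F v t) = inverse (w ?\<tau>) * norm (J z ?\<tau> - J v ?\<tau>)"
        unfolding F T_def dist_norm using w(1)[of ?\<tau>] by (simp flip: scaleR_diff_right)
      ultimately show "dist (F z t) (F v t) \<le> 1/2 * dist z v" by simp
    qed
  qed
  then obtain z where z: "F z = z" by blast
  define y where "y = (\<lambda>t. w t *\<^sub>R z t)"
  have y: "y t = y0 + J z t" if "t \<in> {c..d}" for t
  proof -
    have "z t = T z t" using F[of z] z by simp
    then show ?thesis using that w(1)[of t] by (simp add: y_def T_def cl(3) less_imp_neq[symmetric])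
  qed
  have "y t0 = y0" using y[OF t0] J0 by simp
  moreover have "solves H c d y"
    unfolding solves_def
  proof
    fix t assume t: "t \<in> {c..d}"
    have "((\<lambda>t. y0 + J z t) has_vector_derivative G z t) (at t within {c..d})"
      using has_vector_derivative_add[OF has_vector_derivative_const dJ[OF cz t]] by simp
    then have "(y has_vector_derivative G z t) (at t within {c..d})"
      by (rule has_vector_derivative_transform[OF t, rotated]) (use y in simp)
    then show "(y has_vector_derivative H t (y t)) (at t within {c..d})"
      by (simp add: G_def y_def)
  qed
  ultimately show thesis by (rule that)
qed

text \<open>
  The squared distance \<open>N\<close> satisfies \<open>|N'| \<le> 2 L N\<close>.
\<close>
lemma solutions_exponentially_close:
  fixes H :: "real \<Rightarrow> 'a::euclidean_space \<Rightarrow> 'a"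
  assumes st: "s \<le> t" and L: "L \<ge> 0"
    and lip: "\<And>x. x \<in> {s..t} \<Longrightarrow> norm (H x (y x) - H x (z x)) \<le> L * norm (y x - z x)"
    and y: "solves H s t y" and z: "solves H s t z"
  shows "norm (y t - z t) \<le> exp (L * (t - s)) * norm (y s - z s)"
    "norm (y s - z s) \<le> exp (L * (t - s)) * norm (y t - z t)"
proof -
  define N where "N = (\<lambda>x. (y x - z x) \<bullet> (y x - z x))"
  define N' where "N' = (\<lambda>x. 2 * ((y x - z x) \<bullet> (H x (y x) - H x (z x))))"
  have N: "(N has_real_derivative N' x) (at x within {s..t})" if "x \<in> {s..t}" for x
  proof -
    have "((\<lambda>x. y x - z x) has_vector_derivative H x (y x) - H x (z x)) (at x within {s..t})"
      using y z that unfolding solves_def by (intro derivative_intros) auto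
    then have "((\<lambda>x. y x - z x) has_derivative (\<lambda>h. h *\<^sub>R (H x (y x) - H x (z x)))) (at x within {s..t})"
      by (simp add: has_vector_derivative_def)
    from has_derivative_inner[OF this this] show ?thesis
      unfolding N_def N'_def has_field_derivative_def
      by (rule has_derivative_eq_rhs) (auto simp: inner_commute algebra_simps)
  qed
  have ab: "\<bar>N' x\<bar> \<le> 2 * L * N x" if "x \<in> {s..t}" for x
  proof -
    have "\<bar>(y x - z x) \<bullet> (H x (y x) - H x (z x))\<bar> \<le> norm (y x - z x) * norm (H x (y x) - H x (z x))"
      by (rule Cauchy_Schwarz_ineq2)
    also have "\<dots> \<le> norm (y x - z x) * (L * norm (y x - z x))"
      using lip[OF that] by (intro mult_left_mono) auto
    finally show ?thesis by (simp add: N_def N'_def dot_square_norm power2_eq_square abs_mult mult_ac)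
  qed
  have sq: "N x = (norm (y x - z x))\<^sup>2" for x by (simp add: N_def dot_square_norm)
  have "N t \<le> N s * exp (integral {s..t} (\<lambda>x. 2 * L))"
    by (rule linear_differential_inequality[OF st _ N]) (use ab in \<open>auto simp: abs_le_iff\<close>)
  also have "exp (integral {s..t} (\<lambda>x. 2 * L)) = (exp (L * (t - s)))\<^sup>2"
    using st by (simp flip: exp_double add: mult_ac)
  finally have "(norm (y t - z t))\<^sup>2 \<le> (exp (L * (t - s)) * norm (y s - z s))\<^sup>2"
    by (simp add: sq power_mult_distrib mult_ac)
  then show "norm (y t - z t) \<le> exp (L * (t - s)) * norm (y s - z s)"
    by (rule power2_le_imp_le) simp
  have "- N t \<le> - N s * exp (integral {s..t} (\<lambda>x. - (2 * L)))"
    by (rule linear_differential_inequality[OF st _ DERIV_minus[OF N]]) (use ab in \<open>auto simp: abs_le_iff\<close>)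
  also have "integral {s..t} (\<lambda>x. - (2 * L)) = - (2 * (L * (t - s)))"
    using st by (simp add: mult_ac)
  finally have "N s * exp (- (2 * (L * (t - s)))) * exp (2 * (L * (t - s))) \<le> N t * exp (2 * (L * (t - s)))"
    by (intro mult_right_mono) auto
  then have "N s \<le> N t * (exp (L * (t - s)))\<^sup>2"
    by (simp add: mult.assoc flip: exp_add exp_double)
  then have "(norm (y s - z s))\<^sup>2 \<le> (exp (L * (t - s)) * norm (y t - z t))\<^sup>2"
    by (simp add: sq power_mult_distrib mult_ac)
  then show "norm (y s - z s) \<le> exp (L * (t - s)) * norm (y t - z t)"
    by (rule power2_le_imp_le) simp
qed

section \<open>Solutions, trajectories and the deviation from a canard\<close>

definition real_field :: "field \<Rightarrow> real \<Rightarrow> real^2 \<Rightarrow> real \<Rightarrow> real^2" where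
  "real_field f t x e = (\<chi> i. Re (f (of_real t, cvec x, of_real e) $ i))"

lemma cvec_nth [simp]: "cvec x $ i = of_real (x $ i)"
  by (simp add: cvec_def)

lemma cvec_diff: "cvec (x - y) = cvec x - cvec y"
  by (simp add: vec_eq_iff)

lemma cvec_inject [simp]: "cvec x = cvec y \<longleftrightarrow> x = y"
  by (simp add: vec_eq_iff)

lemma norm_cvec [simp]: "norm (cvec x) = norm x"
  by (simp add: norm_vec_def L2_set_def)

lemma continuous_on_cvec [continuous_intros]: "continuous_on S g \<Longrightarrow> continuous_on S (\<lambda>x. cvec (g x))"
  unfolding cvec_def by (intro continuous_intros)

lemma solutionD:
  assumes "solution f D e X"
  shows "open (fst X)" "is_interval (fst X)" "fst X \<noteq> {}"
    "t \<in> fst X \<Longrightarrow> (of_real t, cvec (snd X t), of_real e) \<in> D"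
    "t \<in> fst X \<Longrightarrow> \<exists>v. (snd X has_vector_derivative v) (at t) \<and>
       cvec (e *\<^sub>R v) = f (of_real t, cvec (snd X t), of_real e)"
    "p \<in> fst X \<Longrightarrow> q \<in> fst X \<Longrightarrow> p \<le> t \<Longrightarrow> t \<le> q \<Longrightarrow> t \<in> fst X"
proof -
  have *: "solution f D e (fst X, snd X)" using assms by simp
  note * = *[unfolded solution_def prod.case]
  from * show "open (fst X)" "is_interval (fst X)" "fst X \<noteq> {}"
    "t \<in> fst X \<Longrightarrow> (of_real t, cvec (snd X t), of_real e) \<in> D"
    "t \<in> fst X \<Longrightarrow> \<exists>v. (snd X has_vector_derivative v) (at t) \<and>
       cvec (e *\<^sub>R v) = f (of_real t, cvec (snd X t), of_real e)"
    by blast+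
  show "p \<in> fst X \<Longrightarrow> q \<in> fst X \<Longrightarrow> p \<le> t \<Longrightarrow> t \<le> q \<Longrightarrow> t \<in> fst X"
    using \<open>is_interval (fst X)\<close> unfolding is_interval_1 by blast
qed

lemma solution_glue:
  assumes X: "solution f D e (I, x)" and Z: "solution f D e (J, z)" and ne: "I \<inter> J \<noteq> {}"
    and eq: "\<And>t. t \<in> I \<inter> J \<Longrightarrow> x t = z t"
  shows "solution f D e (I \<union> J, \<lambda>t. if t \<in> I then x t else z t)"
proof -
  let ?y = "\<lambda>t. if t \<in> I then x t else z t"
  have oI: "open I" and oJ: "open J" using X Z by (auto simp: solution_def)
  have "is_interval (I \<union> J)"
    using X Z ne unfolding solution_def is_interval_connected_1 by (auto intro: connected_Un)
  moreover have "(of_real t, cvec (?y t), of_real e) \<in> D \<and>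
      (\<exists>v. (?y has_vector_derivative v) (at t) \<and> cvec (e *\<^sub>R v) = f (of_real t, cvec (?y t), of_real e))"
    if "t \<in> I \<union> J" for t
  proof (cases "t \<in> I")
    case True
    then obtain v where v: "(x has_vector_derivative v) (at t)"
      "cvec (e *\<^sub>R v) = f (of_real t, cvec (x t), of_real e)" "(of_real t, cvec (x t), of_real e) \<in> D"
      using X by (auto simp: solution_def)
    have "(?y has_vector_derivative v) (at t)"
      by (rule has_vector_derivative_transform_within_open[OF v(1) oI True]) simp
    with v True show ?thesis by auto
  next
    case False
    with that have t: "t \<in> J" by simp
    then obtain v where v: "(z has_vector_derivative v) (at t)"
      "cvec (e *\<^sub>R v) = f (of_real t, cvec (z t), of_real e)" "(of_real t, cvec (z t), of_real e) \<in> D"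
      using Z by (auto simp: solution_def)
    have "(?y has_vector_derivative v) (at t)"
      by (rule has_vector_derivative_transform_within_open[OF v(1) oJ t]) (use eq in auto)
    with v False show ?thesis by auto
  qed
  ultimately show ?thesis
    using X oI oJ unfolding solution_def by auto
qed

definition curve_graph :: "curve \<Rightarrow> (real \<times> (real^2)) set" where
  "curve_graph X = {(t, snd X t) |t. t \<in> fst X}"

lemma curve_graph_le:
  "curve_graph X \<subseteq> curve_graph Y \<longleftrightarrow> fst X \<subseteq> fst Y \<and> (\<forall>t\<in>fst X. snd Y t = snd X t)"
  by (fastforce simp: curve_graph_def)

text \<open>
  Zorn's lemma for the inclusion of graphs. Graphs, unlike curves, carry no irrelevant values
  outside of the interval of definition, so that inclusion is antisymmetric.
\<close>
lemma solution_extends_to_trajectory: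
  assumes X: "solution f D e X"
  obtains Y where "trajectory f D e Y" "fst X \<subseteq> fst Y" "\<And>t. t \<in> fst X \<Longrightarrow> snd Y t = snd X t"
proof -
  define \<A> where "\<A> = {curve_graph Y |Y. solution f D e Y \<and> curve_graph X \<subseteq> curve_graph Y}"
  have fX: "fst X \<noteq> {}" by (rule solutionD(3)[OF X])
  have "\<exists>M\<in>\<A>. \<forall>G\<in>\<A>. M \<subseteq> G \<longrightarrow> G = M"
  proof (rule subset_Zorn_nonempty)
    show "\<A> \<noteq> {}" using X unfolding \<A>_def by blast
    fix \<C> assume ne: "\<C> \<noteq> {}" and ch: "subset.chain \<A> \<C>"
    have CA: "\<C> \<subseteq> \<A>" using ch by (simp add: subset.chain_def)
    have lin: "G \<subseteq> G' \<or> G' \<subseteq> G" if "G \<in> \<C>" "G' \<in> \<C>" for G G'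
      using ch that unfolding subset.chain_def by blast
    define y where "y = (\<lambda>t. SOME v. (t, v) \<in> \<Union>\<C>)"
    define I where "I = fst ` \<Union>\<C>"
    have single: "v = v'" if tv: "(t, v) \<in> \<Union>\<C>" and tv': "(t, v') \<in> \<Union>\<C>" for t v v'
    proof -
      obtain G G' where G: "G \<in> \<C>" "(t, v) \<in> G" "G' \<in> \<C>" "(t, v') \<in> G'" using tv tv' by blast
      then have "\<exists>K\<in>\<C>. (t, v) \<in> K \<and> (t, v') \<in> K" using lin[of G G'] by blast
      then obtain K where K: "K \<in> \<C>" "(t, v) \<in> K" "(t, v') \<in> K" by blast
      then obtain Y where "K = curve_graph Y" using CA by (auto simp: \<A>_def)
      with K show "v = v'" by (auto simp: curve_graph_def)
    qed
    have yv: "y t = v" if "(t, v) \<in> \<Union>\<C>" for t v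
      unfolding y_def using single that by (metis (mono_tags, lifting) someI)
    have mem: "\<exists>Y. curve_graph Y \<in> \<C> \<and> solution f D e Y \<and> curve_graph X \<subseteq> curve_graph Y \<and> t \<in> fst Y \<and>
        fst Y \<subseteq> I \<and> (\<forall>s\<in>fst Y. y s = snd Y s)" if t: "t \<in> I" for t
    proof -
      obtain G v where G: "G \<in> \<C>" "(t, v) \<in> G" using t by (auto simp: I_def)
      then obtain Y where Y: "G = curve_graph Y" "solution f D e Y" "curve_graph X \<subseteq> curve_graph Y"
        using CA by (auto simp: \<A>_def)
      have "t \<in> fst Y" using G(2) unfolding Y(1) curve_graph_def by blast
      have in_C: "(s, snd Y s) \<in> \<Union>\<C>" if s: "s \<in> fst Y" for s
      proof -
        have "(s, snd Y s) \<in> G" using s unfolding Y(1) curve_graph_def by blast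
        with G(1) show ?thesis by blast
      qed
      have "fst Y \<subseteq> I"
        using in_C unfolding I_def by (metis fst_conv image_eqI subsetI)
      with in_C \<open>t \<in> fst Y\<close> Y G(1) yv show ?thesis by blast
    qed
    have graph: "curve_graph (I, y) = \<Union>\<C>"
    proof
      show "curve_graph (I, y) \<subseteq> \<Union>\<C>"
      proof
        fix p assume "p \<in> curve_graph (I, y)"
        then obtain t where t: "t \<in> I" "p = (t, y t)" by (auto simp: curve_graph_def)
        then obtain v where "(t, v) \<in> \<Union>\<C>" unfolding I_def by force
        with yv[OF this] t show "p \<in> \<Union>\<C>" by simp
      qed
      show "\<Union>\<C> \<subseteq> curve_graph (I, y)"
      proof
        fix p assume p: "p \<in> \<Union>\<C>"
        obtain t v where tv: "p = (t, v)" by (cases p)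
        have "t \<in> I" using p tv unfolding I_def by (metis fst_conv image_eqI)
        with yv p tv show "p \<in> curve_graph (I, y)" by (auto simp: curve_graph_def)
      qed
    qed
    have Xsub: "curve_graph X \<subseteq> \<Union>\<C>"
      using ne CA by (auto simp: \<A>_def)
    have sol: "solution f D e (I, y)"
      unfolding solution_def prod.case
    proof (intro conjI ballI)
      show "open I"
        unfolding open_subopen[of I]
      proof
        fix t assume "t \<in> I"
        from mem[OF this] obtain Y where "solution f D e Y" "t \<in> fst Y" "fst Y \<subseteq> I" by blast
        with solutionD(1) show "\<exists>T. open T \<and> t \<in> T \<and> T \<subseteq> I" by blast
      qed
      show "I \<noteq> {}" using Xsub fX graph by (auto simp: curve_graph_def)
      show "is_interval I"
        unfolding is_interval_1
      proof (intro ballI allI impI)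
        fix p q s assume pq: "p \<in> I" "q \<in> I" "p \<le> s \<and> s \<le> q"
        obtain Y where Y: "curve_graph Y \<in> \<C>" "solution f D e Y" "p \<in> fst Y" "fst Y \<subseteq> I"
          using mem[OF pq(1)] by blast
        obtain Z where Z: "curve_graph Z \<in> \<C>" "solution f D e Z" "q \<in> fst Z" "fst Z \<subseteq> I"
          using mem[OF pq(2)] by blast
        from lin[OF Y(1) Z(1)] show "s \<in> I"
        proof
          assume "curve_graph Y \<subseteq> curve_graph Z"
          then have "p \<in> fst Z" using Y(3) unfolding curve_graph_le by blast
          then have "s \<in> fst Z" using solutionD(6)[OF Z(2)] Z(3) pq by blast
          then show ?thesis using Z by blast
        next
          assume "curve_graph Z \<subseteq> curve_graph Y"
          then have "q \<in> fst Y" using Z(3) unfolding curve_graph_le by blast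
          then have "s \<in> fst Y" using solutionD(6)[OF Y(2) Y(3)] pq by blast
          then show ?thesis using Y by blast
        qed
      qed
      fix t assume "t \<in> I"
      from mem[OF this] obtain Y where Y: "solution f D e Y" "t \<in> fst Y" "\<forall>s\<in>fst Y. y s = snd Y s" by blast
      obtain v where v: "(snd Y has_vector_derivative v) (at t)"
        "cvec (e *\<^sub>R v) = f (of_real t, cvec (snd Y t), of_real e)"
        using solutionD(5)[OF Y(1,2)] by blast
      have yt: "y t = snd Y t" using Y by blast
      have "(y has_vector_derivative v) (at t)"
        by (rule has_vector_derivative_transform_within_open[OF v(1) solutionD(1)[OF Y(1)] Y(2)]) (use Y(3) in simp)
      with v(2) show "\<exists>v. (y has_vector_derivative v) (at t) \<and> cvec (e *\<^sub>R v) = f (of_real t, cvec (y t), of_real e)"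
        unfolding yt by blast
      show "(of_real t, cvec (y t), of_real e) \<in> D"
        using solutionD(4)[OF Y(1,2)] unfolding yt .
    qed
    show "\<Union>\<C> \<in> \<A>"
      unfolding \<A>_def using sol Xsub graph by blast
  qed
  then obtain M where M: "M \<in> \<A>" and M_max: "\<And>G. G \<in> \<A> \<Longrightarrow> M \<subseteq> G \<Longrightarrow> G = M" by blast
  obtain Y where Y: "solution f D e Y" "curve_graph X \<subseteq> curve_graph Y" and MY: "M = curve_graph Y"
    using M unfolding \<A>_def by blast
  have max: "curve_graph Z = curve_graph Y"
    if "solution f D e Z" "curve_graph X \<subseteq> curve_graph Z" "curve_graph Y \<subseteq> curve_graph Z" for Z
    using M_max[of "curve_graph Z"] that unfolding MY \<A>_def by blast
  have "trajectory f D e Y"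
    unfolding trajectory_def
  proof (intro conjI allI impI Y)
    fix Z assume Z: "solution f D e Z \<and> fst Y \<subseteq> fst Z \<and> (\<forall>t\<in>fst Y. snd Z t = snd Y t)"
    then have "curve_graph Y \<subseteq> curve_graph Z" by (simp add: curve_graph_le)
    with max[of Z] Z Y(2) have "curve_graph Z = curve_graph Y" by auto
    then have "curve_graph Z \<subseteq> curve_graph Y" "curve_graph Y \<subseteq> curve_graph Z" by auto
    then show "fst Z = fst Y" by (auto simp: curve_graph_le)
  qed
  with Y that show thesis by (auto simp: curve_graph_le)
qed

lemma continuous_on_matrix_vector [continuous_intros]:
  fixes A :: "'a::topological_space \<Rightarrow> real^2^2"
  assumes "continuous_on S A" "continuous_on S y"
  shows "continuous_on S (\<lambda>p. A p *v y p)"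
  unfolding matrix_vector_mult_def by (intro continuous_intros assms)

lemma norm_matrix_vector_le:
  fixes A :: "real^2^2"
  shows "norm (A *v y) \<le> (\<Sum>i\<in>UNIV. \<Sum>j\<in>UNIV. \<bar>A$i$j\<bar>) * norm y"
proof -
  have "norm (A *v y) \<le> (\<Sum>i\<in>UNIV. \<bar>(A *v y) $ i\<bar>)" by (rule norm_le_l1_cart)
  also have "\<dots> \<le> (\<Sum>i\<in>UNIV. \<Sum>j\<in>UNIV. \<bar>A$i$j\<bar> * norm y)"
    unfolding matrix_vector_mult_def
    by (intro sum_mono) (auto intro!: order_trans[OF sum_abs] sum_mono mult_left_mono component_le_norm_cart simp: abs_mult)
  finally show ?thesis by (simp add: sum_distrib_right)
qed

text \<open>
  Only differences of values of the field enter, so that the estimate applies to the deviation of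
  one solution from another, neither of which has to be on the curve \<open>\<phi>\<close>.
\<close>
definition linear_tube where
  "linear_tube f D \<phi> A c d \<rho> r \<longleftrightarrow> (\<forall>t\<in>{c..d}. \<forall>x y e. norm (x - \<phi> t) < r \<and> norm (y - \<phi> t) < r \<and> \<bar>e\<bar> < r \<longrightarrow>
     (of_real t, cvec x, of_real e) \<in> D \<and>
     norm (real_field f t x e - real_field f t y e - A t *v (x - y)) \<le> \<rho> * norm (x - y))"

lemma linear_tubeD:
  assumes "linear_tube f D \<phi> A c d \<rho> r" "t \<in> {c..d}" "norm (x - \<phi> t) < r" "\<bar>e\<bar> < r"
  shows "(of_real t, cvec x, of_real e) \<in> D"
    and "norm (y - \<phi> t) < r \<Longrightarrow>
      norm (real_field f t x e - real_field f t y e - A t *v (x - y)) \<le> \<rho> * norm (x - y)"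
  using assms unfolding linear_tube_def by blast+

text \<open>
  The equation for one value of the parameter, with a solution \<open>xc\<close> (the canard) in
  the inner half of the tube. Other solutions are studied through their deviation from it.
\<close>
locale canard_tube =
  fixes f :: field and D and \<phi> :: "real \<Rightarrow> real^2" and A :: "real \<Rightarrow> real^2^2" and c d \<rho> r e :: real
    and J and xc :: "real \<Rightarrow> real^2"
  assumes real_values: "\<And>t x e. (of_real t, cvec x, of_real e) \<in> D \<Longrightarrow> \<exists>y. f (of_real t, cvec x, of_real e) = cvec y"
    and cont_f: "continuous_on D f"
    and cont_A: "continuous_on {c..d} A"
    and tube: "linear_tube f D \<phi> A c d \<rho> r"
    and rho: "\<rho> \<ge> 0" and e: "0 < e" "e < r"
    and canard: "solution f D e (J, xc)" "{c..d} \<subseteq> J"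
    and close: "\<And>t. t \<in> {c..d} \<Longrightarrow> norm (xc t - \<phi> t) < r / 2"
begin

definition clip :: "real^2 \<Rightarrow> real^2" where
  "clip = closest_point (cball 0 (r / 2))"

text \<open>
  The equation for the deviation. Only the nonlinear remainder is evaluated at the clipped
  argument, not the linear part. So \<open>H\<close> is globally Lipschitz and globally close to
  \<open>A t / e\<close>, with the same constant \<open>\<rho>\<close>, and the growth estimates
  hold for all its solutions, whatever their size.
\<close>
definition H :: "real \<Rightarrow> real^2 \<Rightarrow> real^2" where
  "H t y = (1 / e) *\<^sub>R (A t *v y + (real_field f t (xc t + clip y) e - real_field f t (xc t) e - A t *v clip y))"

lemma r: "r > 0" using e by simp

lemma clip_lipschitz: "norm (clip x - clip y) \<le> norm (x - y)"
  unfolding clip_def dist_norm[symmetric] by (rule closest_point_lipschitz) (use r in auto)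

lemma clip_in: "norm (clip y) \<le> r / 2"
  using closest_point_in_set[of "cball 0 (r/2)" y] r unfolding clip_def by auto

lemma clip_id: "norm y \<le> r / 2 \<Longrightarrow> clip y = y"
  unfolding clip_def by (rule closest_point_self) auto

lemma in_tube: "t \<in> {c..d} \<Longrightarrow> norm y \<le> r / 2 \<Longrightarrow> norm (xc t + y - \<phi> t) < r"
  using close[of t] norm_triangle_ineq[of "xc t - \<phi> t" y] by (simp add: algebra_simps)

lemma in_D: "t \<in> {c..d} \<Longrightarrow> norm y \<le> r / 2 \<Longrightarrow> (of_real t, cvec (xc t + y), of_real e) \<in> D"
  by (rule linear_tubeD(1)[OF tube _ in_tube]) (use e in auto)

lemma tube_estimate:
  assumes "t \<in> {c..d}" "norm x \<le> r / 2" "norm y \<le> r / 2"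
  shows "norm (real_field f t (xc t + x) e - real_field f t (xc t + y) e - A t *v (x - y)) \<le> \<rho> * norm (x - y)"
proof -
  have "norm (real_field f t (xc t + x) e - real_field f t (xc t + y) e - A t *v ((xc t + x) - (xc t + y)))
      \<le> \<rho> * norm ((xc t + x) - (xc t + y))"
    by (rule linear_tubeD(2)[OF tube assms(1) in_tube[OF assms(1,2)] _ in_tube[OF assms(1,3)]]) (use e in simp)
  then show ?thesis by simp
qed

lemma remainder_lipschitz:
  assumes "t \<in> {c..d}"
  shows "norm ((real_field f t (xc t + clip x) e - A t *v clip x) - (real_field f t (xc t + clip y) e - A t *v clip y))
     \<le> \<rho> * norm (x - y)"
proof -
  have "norm (real_field f t (xc t + clip x) e - real_field f t (xc t + clip y) e - A t *v (clip x - clip y))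
     \<le> \<rho> * norm (clip x - clip y)"
    by (rule tube_estimate[OF assms clip_in clip_in])
  also have "\<dots> \<le> \<rho> * norm (x - y)" using rho by (intro mult_left_mono clip_lipschitz)
  finally show ?thesis by (simp add: matrix_vector_mult_diff_distrib algebra_simps)
qed

lemma H_near_linear:
  assumes "t \<in> {c..d}"
  shows "norm (e *\<^sub>R H t y - A t *v y) \<le> \<rho> * norm y"
  using remainder_lipschitz[OF assms, of y 0] clip_id[of 0] r e
  by (simp add: H_def algebra_simps)

lemma H_id:
  assumes "norm y \<le> r / 2"
  shows "e *\<^sub>R H t y = real_field f t (xc t + y) e - real_field f t (xc t) e"
  using e by (simp add: H_def clip_id[OF assms])

lemma H_lipschitz: "\<exists>L\<ge>0. \<forall>t\<in>{c..d}. \<forall>x y. norm (H t x - H t y) \<le> L * norm (x - y)"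
proof -
  have "continuous_on {c..d} (\<lambda>t. \<Sum>i\<in>UNIV. \<Sum>j\<in>UNIV. \<bar>A t$i$j\<bar>)"
    by (intro continuous_intros continuous_on_entry cont_A)
  then have "bounded ((\<lambda>t. \<Sum>i\<in>UNIV. \<Sum>j\<in>UNIV. \<bar>A t$i$j\<bar>) ` {c..d})"
    by (intro compact_imp_bounded compact_continuous_image) auto
  then obtain K where "\<forall>z\<in>(\<lambda>t. \<Sum>i\<in>UNIV. \<Sum>j\<in>UNIV. \<bar>A t$i$j\<bar>) ` {c..d}. norm z \<le> K"
    unfolding bounded_iff by blast
  then have K: "\<And>t. t \<in> {c..d} \<Longrightarrow> \<bar>\<Sum>i\<in>UNIV. \<Sum>j\<in>UNIV. \<bar>A t$i$j\<bar>\<bar> \<le> K" by simp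
  have "norm (H t x - H t y) \<le> ((\<bar>K\<bar> + \<rho>) / e) * norm (x - y)" if t: "t \<in> {c..d}" for t x y
  proof -
    have "e *\<^sub>R (H t x - H t y) = A t *v (x - y) +
       ((real_field f t (xc t + clip x) e - A t *v clip x) - (real_field f t (xc t + clip y) e - A t *v clip y))"
      using e by (simp add: H_def algebra_simps matrix_vector_mult_diff_distrib)
    then have "norm (e *\<^sub>R (H t x - H t y)) \<le> norm (A t *v (x - y)) + \<rho> * norm (x - y)"
      using norm_triangle_le[OF add_left_mono[OF remainder_lipschitz[OF t]]] by simp
    also have "norm (A t *v (x - y)) \<le> \<bar>K\<bar> * norm (x - y)"
      by (rule order_trans[OF norm_matrix_vector_le mult_right_mono]) (use K[OF t] in auto)
    finally have "norm (e *\<^sub>R (H t x - H t y)) \<le> (\<bar>K\<bar> + \<rho>) * norm (x - y)"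
      by (simp add: distrib_right)
    then have "e * norm (H t x - H t y) \<le> (\<bar>K\<bar> + \<rho>) * norm (x - y)"
      using e by (simp only: norm_scaleR abs_of_pos)
    then show ?thesis using e by (simp add: pos_le_divide_eq mult.commute)
  qed
  moreover have "(\<bar>K\<bar> + \<rho>) / e \<ge> 0" using rho e by simp
  ultimately show ?thesis by blast
qed

lemma real_field_solution:
  assumes "solution f D e (I, x)" "t \<in> I"
  obtains v where "(x has_vector_derivative v) (at t)" "e *\<^sub>R v = real_field f t (x t) e"
proof -
  obtain v where v: "(x has_vector_derivative v) (at t)" "cvec (e *\<^sub>R v) = f (of_real t, cvec (x t), of_real e)"
    using assms unfolding solution_def by auto
  show thesis by (rule that[OF v(1)]) (simp add: real_field_def v(2)[symmetric] vec_eq_iff)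
qed

lemma cont_xc: "continuous_on {c..d} xc"
proof (rule continuous_at_imp_continuous_on, rule ballI)
  fix t assume "t \<in> {c..d}"
  then have "t \<in> J" using canard(2) by blast
  then obtain v where "(xc has_vector_derivative v) (at t)" using real_field_solution[OF canard(1)] by blast
  then show "isCont xc t" by (rule has_vector_derivative_continuous)
qed

lemma H_continuous: "continuous_on ({c..d} \<times> UNIV) (\<lambda>(t, y). H t y)"
proof -
  have F: "continuous_on ({c..d} \<times> UNIV) (\<lambda>p. real_field f (fst p) (xc (fst p) + g (snd p)) e)"
    if g: "continuous_on UNIV g" "\<And>y. norm (g y) \<le> r / 2" for g :: "real^2 \<Rightarrow> real^2"
    unfolding real_field_def
    by (intro continuous_intros continuous_on_compose2[OF cont_f] continuous_on_compose2[OF cont_xc]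
        continuous_on_compose2[OF g(1)]) (use in_D g(2) in auto)
  have cl: "continuous_on UNIV clip"
    unfolding clip_def by (rule continuous_on_closest_point) (use r in auto)
  have "continuous_on ({c..d} \<times> UNIV) (\<lambda>p. H (fst p) (snd p))"
    unfolding H_def
    using F[OF cl clip_in] F[OF continuous_on_const, of 0] r
    by (intro continuous_intros continuous_on_compose2[OF cont_A] continuous_on_compose2[OF cl]) auto
  then show ?thesis by (simp add: case_prod_unfold)
qed

lemma deviation_solves:
  assumes x: "solution f D e (I, x)" and st: "c \<le> s" "t \<le> d" "{s..t} \<subseteq> I"
    and small: "\<And>\<tau>. \<tau> \<in> {s..t} \<Longrightarrow> norm (x \<tau> - xc \<tau>) \<le> r / 2"
  shows "solves H s t (\<lambda>\<tau>. x \<tau> - xc \<tau>)"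
  unfolding solves_def
proof
  fix \<tau> assume \<tau>: "\<tau> \<in> {s..t}"
  obtain v where v: "(x has_vector_derivative v) (at \<tau>)" "e *\<^sub>R v = real_field f \<tau> (x \<tau>) e"
    using real_field_solution[OF x] \<tau> st by blast
  have "\<tau> \<in> J" using \<tau> st canard(2) by auto
  obtain w where w: "(xc has_vector_derivative w) (at \<tau>)" "e *\<^sub>R w = real_field f \<tau> (xc \<tau>) e"
    using real_field_solution[OF canard(1) \<open>\<tau> \<in> J\<close>] by blast
  have "e *\<^sub>R (v - w) = e *\<^sub>R H \<tau> (x \<tau> - xc \<tau>)"
    using v(2) w(2) H_id[OF small[OF \<tau>]] by (simp add: scaleR_diff_right)
  then have "v - w = H \<tau> (x \<tau> - xc \<tau>)" using e by simp
  with has_vector_derivative_diff[OF v(1) w(1)]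
  show "((\<lambda>\<tau>. x \<tau> - xc \<tau>) has_vector_derivative H \<tau> (x \<tau> - xc \<tau>)) (at \<tau> within {s..t})"
    by (auto intro: has_vector_derivative_at_within)
qed

lemma solves_near_linear:
  assumes "solves H s t Y" "c \<le> s" "t \<le> d"
  shows "near_linear A \<rho> e s t Y"
  using assms H_near_linear unfolding solves_def near_linear_def by fastforce

lemma solves_gives_solution:
  assumes Z: "solves H c d Z" and pq: "c \<le> p" "p < q" "q \<le> d"
    and small: "\<And>\<tau>. p < \<tau> \<Longrightarrow> \<tau> < q \<Longrightarrow> norm (Z \<tau>) \<le> r / 2"
  shows "solution f D e ({p<..<q}, \<lambda>\<tau>. xc \<tau> + Z \<tau>)"
  unfolding solution_def prod.case
proof (intro conjI ballI)
  show "open {p<..<q}" "is_interval {p<..<q}" "{p<..<q} \<noteq> {}"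
    using pq by (auto simp: is_interval_oo)
  fix \<tau> assume \<tau>: "\<tau> \<in> {p<..<q}"
  have \<tau>c: "\<tau> \<in> {c..d}" using \<tau> pq by auto
  have sm: "norm (Z \<tau>) \<le> r / 2" using small \<tau> by auto
  show D: "(of_real \<tau>, cvec (xc \<tau> + Z \<tau>), of_real e) \<in> D" by (rule in_D[OF \<tau>c sm])
  obtain w where w: "(xc has_vector_derivative w) (at \<tau>)" "e *\<^sub>R w = real_field f \<tau> (xc \<tau>) e"
    using real_field_solution[OF canard(1)] canard(2) \<tau>c by blast
  have z: "(Z has_vector_derivative H \<tau> (Z \<tau>)) (at \<tau>)"
  proof -
    have "at \<tau> within {c..d} = at \<tau>" by (rule at_within_Icc_at) (use \<tau> pq in auto)
    with Z \<tau>c show ?thesis unfolding solves_def by metis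
  qed
  obtain y where y: "f (of_real \<tau>, cvec (xc \<tau> + Z \<tau>), of_real e) = cvec y" using real_values[OF D] by blast
  have "e *\<^sub>R (w + H \<tau> (Z \<tau>)) = y"
  proof -
    have "real_field f \<tau> (xc \<tau> + Z \<tau>) e = y" by (simp add: real_field_def y vec_eq_iff)
    with w(2) H_id[OF sm] show ?thesis by (simp add: scaleR_add_right)
  qed
  with has_vector_derivative_add[OF w(1) z] y
  show "\<exists>v. ((\<lambda>\<tau>. xc \<tau> + Z \<tau>) has_vector_derivative v) (at \<tau>) \<and>
      cvec (e *\<^sub>R v) = f (of_real \<tau>, cvec (xc \<tau> + Z \<tau>), of_real e)"
    by (intro exI[of _ "w + H \<tau> (Z \<tau>)"]) auto
qed

end

lemma last_crossing:
  fixes g :: "real \<Rightarrow> real"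
  assumes g: "continuous_on {u..q} g" "u \<le> q" "g u \<ge> s" "g q < s"
  obtains t where "t \<in> {u..q}" "g t = s" "\<And>\<tau>. \<tau> \<in> {t..q} \<Longrightarrow> g \<tau> \<le> s"
proof -
  define K where "K = {t \<in> {u..q}. s \<le> g t}"
  have "closed K"
    unfolding K_def by (intro continuous_on_closed_Collect_le continuous_intros g)
  moreover have "bounded K"
    by (rule bounded_subset[OF bounded_closed_interval[of u q]]) (auto simp: K_def)
  ultimately have "compact K" by (simp add: compact_eq_bounded_closed)
  moreover have "u \<in> K" using g by (simp add: K_def)
  ultimately obtain t where t: "t \<in> K" "\<And>x. x \<in> K \<Longrightarrow> x \<le> t"
    using compact_attains_sup[of K] by blast
  have tu: "t \<in> {u..q}" "s \<le> g t" using t by (auto simp: K_def)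
  have after: "g \<tau> < s" if "t < \<tau>" "\<tau> \<le> q" for \<tau>
    using t(2)[of \<tau>] that tu by (force simp: K_def)
  have "g t = s"
  proof (rule ccontr)
    assume "g t \<noteq> s"
    then have gt: "g t > s" using tu by simp
    have "\<exists>x\<ge>t. x \<le> q \<and> g x = s"
      by (rule IVT2') (use gt g tu in \<open>auto intro: continuous_on_subset[OF g(1)]\<close>)
    then obtain x where "t \<le> x" "x \<le> q" "g x = s" by blast
    then show False using after[of x] gt by (cases "x = t") auto
  qed
  moreover have "g \<tau> \<le> s" if "\<tau> \<in> {t..q}" for \<tau>
    using after[of \<tau>] that \<open>g t = s\<close> by (cases "\<tau> = t") auto
  ultimately show thesis using that tu by blast
qed

lemma first_crossing:
  fixes g :: "real \<Rightarrow> real"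
  assumes g: "continuous_on {q..u} g" "q \<le> u" "g u \<ge> s" "g q < s"
  obtains t where "t \<in> {q..u}" "g t = s" "\<And>\<tau>. \<tau> \<in> {q..t} \<Longrightarrow> g \<tau> \<le> s"
proof -
  have "continuous_on {- u..- q} (\<lambda>x. g (- x))"
    by (intro continuous_on_compose2[OF g(1)] continuous_intros) auto
  then obtain t where t: "t \<in> {- u..- q}" "g (- t) = s" "\<And>\<tau>. \<tau> \<in> {t..- q} \<Longrightarrow> g (- \<tau>) \<le> s"
    using last_crossing[of "- u" "- q" "\<lambda>x. g (- x)" s] g by auto
  have "g \<tau> \<le> s" if "\<tau> \<in> {q..- t}" for \<tau>
    using t(3)[of "- \<tau>"] that by auto
  with t show thesis by (intro that[of "- t"]) auto
qed

lemma first_missing_point: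
  fixes I :: "real set"
  assumes I: "open I" and u: "u \<in> I" and q: "q \<notin> I" "u \<le> q"
  obtains m where "u < m" "m \<le> q" "m \<notin> I" "{u..<m} \<subseteq> I"
proof -
  have "compact ({u..q} - I)" using I by (intro compact_diff) auto
  moreover have "q \<in> {u..q} - I" using q by auto
  ultimately obtain m where m: "m \<in> {u..q} - I" "\<And>x. x \<in> {u..q} - I \<Longrightarrow> m \<le> x"
    using compact_attains_inf[of "{u..q} - I"] by blast
  have m1: "u \<le> m" "m \<le> q" "m \<notin> I" using m(1) by auto
  have "u \<noteq> m" using m1(3) u by blast
  then have "u < m" using m1(1) by simp
  moreover have "{u..<m} \<subseteq> I"
  proof
    fix x assume x: "x \<in> {u..<m}"
    show "x \<in> I"
    proof (rule ccontr)
      assume "x \<notin> I"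
      then have "m \<le> x" using x m1(2) by (intro m(2)) auto
      with x show False by simp
    qed
  qed
  ultimately show thesis using that m1(2,3) by blast
qed

lemma solves_subset:
  assumes "solves H c d y" "c \<le> s" "t \<le> d"
  shows "solves H s t y"
  unfolding solves_def
proof
  fix x assume x: "x \<in> {s..t}"
  then have "(y has_vector_derivative H x (y x)) (at x within {c..d})"
    using assms unfolding solves_def by auto
  then show "(y has_vector_derivative H x (y x)) (at x within {s..t})"
    by (rule has_vector_derivative_within_subset) (use assms in auto)
qed

lemma solves_continuous: "solves H c d y \<Longrightarrow> continuous_on {c..d} y"
  unfolding solves_def by (rule vector_derivative_imp_continuous_on) (rule bspec)

lemma solutions_close:
  fixes H :: "real \<Rightarrow> 'a::euclidean_space \<Rightarrow> 'a"
  assumes L: "L \<ge> 0" and lip: "\<And>x y z. x \<in> {c..d} \<Longrightarrow> norm (H x y - H x z) \<le> L * norm (y - z)"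
    and y: "solves H c d y" and z: "solves H c d z" and st: "s \<in> {c..d}" "t \<in> {c..d}"
  shows "norm (y t - z t) \<le> exp (L * \<bar>t - s\<bar>) * norm (y s - z s)"
proof (cases "s \<le> t")
  case True
  have "norm (y t - z t) \<le> exp (L * (t - s)) * norm (y s - z s)"
    by (rule solutions_exponentially_close(1)[OF True L])
      (use lip st in \<open>auto intro: solves_subset[OF y] solves_subset[OF z]\<close>)
  then show ?thesis using True by simp
next
  case False
  have "norm (y t - z t) \<le> exp (L * (s - t)) * norm (y s - z s)"
    by (rule solutions_exponentially_close(2)[OF _ L])
      (use lip st False in \<open>auto intro: solves_subset[OF y] solves_subset[OF z]\<close>)
  then show ?thesis using False by simp
qed

lemma trajectory_maximal:
  assumes "trajectory f D e (I, x)" "solution f D e (K, y)" "I \<subseteq> K" "\<And>t. t \<in> I \<Longrightarrow> y t = x t"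
  shows "K = I"
proof -
  have "fst (K, y) = fst (I, x)"
    by (rule assms(1)[unfolded trajectory_def, THEN conjunct2, rule_format]) (use assms(2-4) in auto)
  then show ?thesis by simp
qed

context canard_tube
begin

lemma deviation_unique:
  assumes x: "solution f D e (I, x)" and st: "c \<le> s" "s \<le> t" "t \<le> d" "{s..t} \<subseteq> I"
    and small: "\<And>\<tau>. \<tau> \<in> {s..t} \<Longrightarrow> norm (x \<tau> - xc \<tau>) \<le> r / 2"
    and Z: "solves H c d Z" and eq: "\<tau> \<in> {s..t}" "Z \<tau> = x \<tau> - xc \<tau>" and u: "u \<in> {s..t}"
  shows "Z u = x u - xc u"
proof -
  obtain L where L: "L \<ge> 0" "\<And>t y z. t \<in> {c..d} \<Longrightarrow> norm (H t y - H t z) \<le> L * norm (y - z)"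
    using H_lipschitz by blast
  have "norm (Z u - (x u - xc u)) \<le> exp (L * \<bar>u - \<tau>\<bar>) * norm (Z \<tau> - (x \<tau> - xc \<tau>))"
    by (rule solutions_close[where c = s and d = t and H = H, OF L(1) _ solves_subset[OF Z st(1,3)]
          deviation_solves[OF x st(1,3,4) small] eq(1) u])
      (use L(2) st in auto)
  then show ?thesis using eq by simp
qed

text \<open>
  A trajectory cannot stop at a time \<open>m\<close> inside the tube: the solution
  \<open>Z\<close> of the truncated equation passes through \<open>m\<close> and, being small
  there, solves the true equation, so that the trajectory could be extended by it.
\<close>
lemma no_gap:
  assumes traj: "trajectory f D e (I, x)" and Z: "solves H c d Z" and m: "c < m" "m < d" "m \<notin> I"
    and h0: "h0 > 0" and eq: "\<And>t. t \<in> I \<Longrightarrow> \<bar>t - m\<bar> < h0 \<Longrightarrow> x t = xc t + Z t \<and> norm (Z t) \<le> r / 4"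
    and cl: "\<And>h. h > 0 \<Longrightarrow> \<exists>t\<in>I. \<bar>t - m\<bar> < h"
  shows False
proof -
  have mcd: "m \<in> {c..d}" using m by auto
  have "continuous_on {c..d} Z" by (rule solves_continuous[OF Z])
  then have "isCont Z m"
    using m by (intro continuous_on_interior[of "{c..d}"]) auto
  then obtain h1 where h1: "h1 > 0" "\<And>t. \<bar>t - m\<bar> < h1 \<Longrightarrow> norm (Z t - Z m) < r / 8"
    unfolding continuous_at_eps_delta using r by (metis dist_norm real_norm_def zero_less_divide_iff zero_less_numeral)
  define h where "h = min (min h0 h1) (min (m - c) (d - m))"
  have h: "h > 0" "h \<le> h0" "h \<le> h1" "c \<le> m - h" "m + h \<le> d" using h0 h1 m by (auto simp: h_def)
  obtain t0 where t0: "t0 \<in> I" "\<bar>t0 - m\<bar> < h" using cl[OF h(1)] by blast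
  have Zm: "norm (Z m) \<le> 3 * r / 8"
  proof -
    have "norm (Z t0 - Z m) < r / 8" "norm (Z t0) \<le> r / 4" using h1(2)[of t0] eq[of t0] t0 h by auto
    then show ?thesis using norm_triangle_ineq2[of "Z m" "Z t0"] by (simp add: norm_minus_commute)
  qed
  have small: "norm (Z \<tau>) \<le> r / 2" if "m - h < \<tau>" "\<tau> < m + h" for \<tau>
  proof -
    have "norm (Z \<tau> - Z m) < r / 8" using h1(2)[of \<tau>] that h by auto
    then show ?thesis using Zm norm_triangle_ineq2[of "Z \<tau>" "Z m"] by simp
  qed
  have sol: "solution f D e ({m - h<..<m + h}, \<lambda>\<tau>. xc \<tau> + Z \<tau>)"
    by (rule solves_gives_solution[OF Z]) (use h small in auto)
  have sx: "solution f D e (I, x)" using traj by (simp add: trajectory_def)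
  have "solution f D e (I \<union> {m - h<..<m + h}, \<lambda>t. if t \<in> I then x t else xc t + Z t)"
  proof (rule solution_glue[OF sx sol])
    have "t0 \<in> I \<inter> {m - h<..<m + h}" using t0 by auto
    then show "I \<inter> {m - h<..<m + h} \<noteq> {}" by blast
  qed (use eq h in auto)
  then have "I \<union> {m - h<..<m + h} = I"
    by (rule trajectory_maximal[OF traj]) auto
  moreover have "m \<in> {m - h<..<m + h}" using h(1) by simp
  ultimately show False using m(3) by blast
qed

lemma trajectory_stays:
  assumes traj: "trajectory f D e (I, x)" and pq: "c < p" "q < d" and \<tau>: "\<tau> \<in> I" "\<tau> \<in> {p..q}"
    and small: "\<And>t. t \<in> I \<Longrightarrow> t \<in> {p..q} \<Longrightarrow> norm (x t - xc t) \<le> r / 4"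
  shows "{p..q} \<subseteq> I"
proof (rule ccontr)
  assume "\<not> {p..q} \<subseteq> I"
  then obtain t0 where t0: "t0 \<in> {p..q}" "t0 \<notin> I" by blast
  have sx: "solution f D e (I, x)" using traj by (simp add: trajectory_def)
  note oI = solutionD(1)[OF sx, unfolded fst_conv]
  have ivl: "p' \<le> t \<Longrightarrow> t \<le> q' \<Longrightarrow> t \<in> I" if "p' \<in> I" "q' \<in> I" for p' q' t
    using solutionD(6)[OF sx, unfolded fst_conv, OF that] .
  have \<tau>cd: "\<tau> \<in> {c..d}" using \<tau> pq by auto
  obtain L where L: "L \<ge> 0" "\<And>t y z. t \<in> {c..d} \<Longrightarrow> norm (H t y - H t z) \<le> L * norm (y - z)"
    using H_lipschitz by blast
  obtain Z where Z: "Z \<tau> = x \<tau> - xc \<tau>" "solves H c d Z"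
    using global_solution_exists[OF H_continuous L(2) \<tau>cd] by blast
  have eq: "x t = xc t + Z t \<and> norm (Z t) \<le> r / 4" if t: "t \<in> I" "t \<in> {p..q}" for t
  proof -
    have sub: "{min t \<tau>..max t \<tau>} \<subseteq> I" using ivl[of "min t \<tau>" "max t \<tau>"] t \<tau> by (auto simp: min_def max_def split: if_splits)
    have sm: "norm (x \<sigma> - xc \<sigma>) \<le> r / 2" if \<sigma>: "\<sigma> \<in> {min t \<tau>..max t \<tau>}" for \<sigma>
    proof -
      have "\<sigma> \<in> {p..q}" using \<sigma> t(2) \<tau>(2) by (auto simp: min_def max_def split: if_splits)
      then have "norm (x \<sigma> - xc \<sigma>) \<le> r / 4" using small sub \<sigma> by blast
      then show ?thesis using r by linarith
    qed
    have "Z t = x t - xc t"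
      by (rule deviation_unique[OF sx _ _ _ sub sm Z(2) _ Z(1)]) (use t \<tau> pq in auto)
    with small[OF t] show ?thesis by simp
  qed
  show False
  proof (cases "\<tau> \<le> t0")
    case True
    obtain m where m: "\<tau> < m" "m \<le> t0" "m \<notin> I" "{\<tau>..<m} \<subseteq> I"
      using first_missing_point[OF oI \<tau>(1) t0(2) True] by blast
    show False
    proof (rule no_gap[OF traj Z(2)])
      show "c < m" "m < d" "m \<notin> I" "0 < m - \<tau>" using m \<tau> pq t0 by auto
      fix t assume t: "t \<in> I" "\<bar>t - m\<bar> < m - \<tau>"
      have "t < m" using ivl[OF \<tau>(1) t(1), of m] m by (meson less_imp_le not_le_imp_less)
      then show "x t = xc t + Z t \<and> norm (Z t) \<le> r / 4" using eq[OF t(1)] t m t0 \<tau> by auto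
    next
      fix h :: real assume "h > 0"
      then show "\<exists>t\<in>I. \<bar>t - m\<bar> < h"
        using m by (intro bexI[of _ "max \<tau> (m - h / 2)"]) (auto simp: max_def)
    qed
  next
    case False
    have oI': "open (uminus ` I)" using oI by (rule open_negations)
    obtain m' where m': "- \<tau> < m'" "m' \<le> - t0" "m' \<notin> uminus ` I" "{- \<tau>..<m'} \<subseteq> uminus ` I"
    proof (rule first_missing_point[OF oI'])
      show "- \<tau> \<in> uminus ` I" "- t0 \<notin> uminus ` I" "- \<tau> \<le> - t0" using \<tau>(1) t0(2) False by auto
    qed (rule that)
    define m where "m = - m'"
    have m: "m < \<tau>" "t0 \<le> m" using m'(1,2) by (auto simp: m_def)
    have m3: "m \<notin> I" using m'(3) by (auto simp: m_def image_iff)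
    note m = m m3
    have m4: "t \<in> I" if "m < t" "t \<le> \<tau>" for t
    proof -
      have "- t \<in> {- \<tau>..<m'}" using that by (auto simp: m_def)
      then have "- t \<in> uminus ` I" using m'(4) by blast
      then show ?thesis by auto
    qed
    show False
    proof (rule no_gap[OF traj Z(2)])
      show "c < m" "m < d" "m \<notin> I" "0 < \<tau> - m" using m \<tau> pq t0 by auto
      fix t assume t: "t \<in> I" "\<bar>t - m\<bar> < \<tau> - m"
      have "t > m" using ivl[OF t(1) \<tau>(1), of m] m by (meson less_imp_le not_le_imp_less)
      then show "x t = xc t + Z t \<and> norm (Z t) \<le> r / 4" using eq[OF t(1)] t m t0 \<tau> by auto
    next
      fix h :: real assume "h > 0"
      then show "\<exists>t\<in>I. \<bar>t - m\<bar> < h"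
        using m m4 by (intro bexI[of _ "min \<tau> (m + h / 2)"]) (auto simp: min_def)
    qed
  qed
qed

lemma continuous_on_deviation:
  assumes "solution f D e (I, x)" "{p..q} \<subseteq> I" "c \<le> p" "q \<le> d"
  shows "continuous_on {p..q} (\<lambda>t. norm (x t - xc t))"
proof (intro continuous_intros)
  show "continuous_on {p..q} xc" by (rule continuous_on_subset[OF cont_xc]) (use assms in auto)
  show "continuous_on {p..q} x"
  proof (rule continuous_at_imp_continuous_on, rule ballI)
    fix t assume "t \<in> {p..q}"
    then have "t \<in> I" using assms by blast
    then obtain v where "(x has_vector_derivative v) (at t)" using real_field_solution[OF assms(1)] by blast
    then show "isCont x t" by (rule has_vector_derivative_continuous)
  qed
qed

text \<open>
  A trajectory that is close to the canard at time \<open>q\<close>, but not all the way back to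
  \<open>p\<close>, was at the exact distance \<open>s\<close> at some time in between. Ceasing to
  exist does not give an exception, since that cannot happen in the tube.
\<close>
lemma trajectory_enters:
  assumes traj: "trajectory f D e (I, x)" and pq: "c < p" "p \<le> q" "q < d" and q: "q \<in> I" "norm (x q - xc q) < s"
    and s: "s \<le> r / 4" and bad: "t0 \<in> {p..q}" "t0 \<in> I \<Longrightarrow> s \<le> norm (x t0 - xc t0)"
  obtains t1 where "t1 \<in> {p..q}" "{t1..q} \<subseteq> I" "norm (x t1 - xc t1) = s"
    "\<And>t. t \<in> {t1..q} \<Longrightarrow> norm (x t - xc t) \<le> s"
proof -
  have sx: "solution f D e (I, x)" using traj by (simp add: trajectory_def)
  obtain u where u: "u \<in> I" "u \<in> {p..q}" "s \<le> norm (x u - xc u)"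
  proof (cases "\<exists>u. u \<in> I \<and> u \<in> {p..q} \<and> s \<le> norm (x u - xc u)")
    case False
    have "{p..q} \<subseteq> I"
      by (rule trajectory_stays[OF traj pq(1,3) q(1)]) (use False s pq in \<open>force+\<close>)
    with False bad show ?thesis by blast
  qed (use that in blast)
  have sub: "{u..q} \<subseteq> I" using solutionD(6)[OF sx, unfolded fst_conv, OF u(1) q(1)] by auto
  obtain t1 where t1: "t1 \<in> {u..q}" "norm (x t1 - xc t1) = s" "\<And>t. t \<in> {t1..q} \<Longrightarrow> norm (x t - xc t) \<le> s"
    using last_crossing[OF continuous_on_deviation[OF sx sub] _ u(3) q(2)] u pq by auto
  show thesis by (rule that[OF _ _ t1(2,3)]) (use t1(1) u sub in auto)
qed

lemma trajectory_exits:
  assumes traj: "trajectory f D e (I, x)" and pq: "c < q" "q \<le> p" "p < d" and q: "q \<in> I" "norm (x q - xc q) < s"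
    and s: "s \<le> r / 4" and bad: "t0 \<in> {q..p}" "t0 \<in> I \<Longrightarrow> s \<le> norm (x t0 - xc t0)"
  obtains t1 where "t1 \<in> {q..p}" "{q..t1} \<subseteq> I" "norm (x t1 - xc t1) = s"
    "\<And>t. t \<in> {q..t1} \<Longrightarrow> norm (x t - xc t) \<le> s"
proof -
  have sx: "solution f D e (I, x)" using traj by (simp add: trajectory_def)
  obtain u where u: "u \<in> I" "u \<in> {q..p}" "s \<le> norm (x u - xc u)"
  proof (cases "\<exists>u. u \<in> I \<and> u \<in> {q..p} \<and> s \<le> norm (x u - xc u)")
    case False
    have "{q..p} \<subseteq> I"
      by (rule trajectory_stays[OF traj pq(1,3) q(1)]) (use False s pq in \<open>force+\<close>)
    with False bad show ?thesis by blast
  qed (use that in blast)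
  have sub: "{q..u} \<subseteq> I" using solutionD(6)[OF sx, unfolded fst_conv, OF q(1) u(1)] by auto
  obtain t1 where t1: "t1 \<in> {q..u}" "norm (x t1 - xc t1) = s" "\<And>t. t \<in> {q..t1} \<Longrightarrow> norm (x t - xc t) \<le> s"
    using first_crossing[OF continuous_on_deviation[OF sx sub] _ u(3) q(2)] u pq by auto
  show thesis by (rule that[OF _ _ t1(2,3)]) (use t1(1) u sub in auto)
qed

end

section \<open>Passing through the bifurcations\<close>

lemma small_exponential:
  assumes "C > 0" "g > 0"
  obtains e0 :: real where "e0 > 0" "\<And>e. 0 < e \<Longrightarrow> e < e0 \<Longrightarrow> C * exp (- (g / e)) < 1"
proof
  show "g / C > 0" using assms by simp
  fix e :: real assume e: "0 < e" "e < g / C"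
  have "g / e > C" using e assms by (simp add: field_simps)
  also have "g / e < exp (g / e)" using exp_ge_add_one_self[of "g / e"] by linarith
  finally show "C * exp (- (g / e)) < 1" by (simp add: exp_minus field_simps)
qed

lemma integral_split:
  fixes g :: "real \<Rightarrow> real"
  assumes "continuous_on {s..u} g" "s \<le> t" "t \<le> u"
  shows "integral {s..u} g = integral {s..t} g + integral {t..u} g"
  using Henstock_Kurzweil_Integration.integral_combine[OF assms(2,3) integrable_continuous_interval[OF assms(1)]] by simp

lemma integral_lower_bound:
  fixes g :: "real \<Rightarrow> real"
  assumes "continuous_on {s..t} g" "s \<le> t" "\<And>x. x \<in> {s..t} \<Longrightarrow> k \<le> g x"
  shows "k * (t - s) \<le> integral {s..t} g"
proof -
  have "integral {s..t} (\<lambda>x. k) \<le> integral {s..t} g"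
    by (rule integral_le) (use assms in \<open>auto intro: integrable_continuous_interval\<close>)
  then show ?thesis using assms(2) by (simp add: mult.commute)
qed

text \<open>
  A rate that vanishes at the left end \<open>p\<close>, as at the Hopf bifurcation, is not
  bounded below by a positive constant. Its averages over \<open>[t, T]\<close> are, uniformly,
  since \<open>T\<close> stays away from \<open>p\<close>.
\<close>
lemma average_rate_below:
  fixes g :: "real \<Rightarrow> real"
  assumes g: "continuous_on {p..q} g" and pos: "\<And>x. p < x \<Longrightarrow> x \<le> q \<Longrightarrow> g x > 0" and pq: "p < q0" "q0 \<le> q"
  obtains \<eta> where "\<eta> > 0" "\<And>T t. q0 \<le> T \<Longrightarrow> T \<le> q \<Longrightarrow> p \<le> t \<Longrightarrow> t \<le> T \<Longrightarrow> \<eta> * (T - t) \<le> integral {t..T} g"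
proof -
  define m where "m = (p + q0) / 2"
  have m: "p < m" "m < q0" using pq by (auto simp: m_def field_simps)
  have cg: "continuous_on {s..t} g" if "p \<le> s" "t \<le> q" for s t
    by (rule continuous_on_subset[OF g]) (use that in auto)
  obtain z where z: "z \<in> {m..q}" "\<And>x. x \<in> {m..q} \<Longrightarrow> g z \<le> g x"
    using continuous_attains_inf[OF compact_Icc _ cg[of m q]] m pq by auto
  have k: "g z > 0" using pos z(1) m by auto
  have g0: "g x \<ge> 0" if "p \<le> x" "x \<le> q" for x
  proof (cases "x = p")
    case True
    show ?thesis
    proof (rule ccontr)
      assume neg: "\<not> g x \<ge> 0"
      have "\<exists>y\<ge>p. y \<le> q \<and> g y = g p / 2"
        by (rule IVT') (use neg True pos[of q] pq g in auto)
      then obtain y where y: "p \<le> y" "y \<le> q" "g y = g p / 2" by blast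
      then have "y \<noteq> p" using neg True by auto
      then show False using pos[of y] y neg True by auto
    qed
  qed (use pos[of x] that in auto)
  have "g z / 2 * (T - t) \<le> integral {t..T} g" if T: "q0 \<le> T" "T \<le> q" "p \<le> t" "t \<le> T" for T t
  proof (cases "t \<ge> m")
    case True
    have "g z * (T - t) \<le> integral {t..T} g"
      by (rule integral_lower_bound) (use T True z in \<open>auto intro: cg\<close>)
    moreover have "g z / 2 * (T - t) \<le> g z * (T - t)" using k T by (intro mult_right_mono) auto
    ultimately show ?thesis by linarith
  next
    case False
    have mT: "m \<le> T" using m T by linarith
    have "integral {t..T} g = integral {t..m} g + integral {m..T} g"
      by (rule integral_split) (use T False mT in \<open>auto intro: cg\<close>)
    moreover have "0 * (m - t) \<le> integral {t..m} g"
      by (rule integral_lower_bound) (use T False m mT g0 in \<open>auto intro: cg\<close>)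
    moreover have "g z * (T - m) \<le> integral {m..T} g"
      by (rule integral_lower_bound) (use T mT m z in \<open>auto intro: cg\<close>)
    moreover have "g z / 2 * (T - t) \<le> g z * (T - m)"
    proof -
      have "T - t \<le> 2 * (T - m)" using T by (simp add: m_def field_simps)
      then have "g z / 2 * (T - t) \<le> g z / 2 * (2 * (T - m))" using k by (intro mult_left_mono) auto
      also have "\<dots> = g z * (T - m)" by simp
      finally show ?thesis .
    qed
    ultimately show ?thesis by linarith
  qed
  with k that[of "g z / 2"] show thesis by auto
qed

lemma average_rate_above:
  fixes g :: "real \<Rightarrow> real"
  assumes g: "continuous_on {p..q} g" and neg: "\<And>x. p \<le> x \<Longrightarrow> x < q \<Longrightarrow> g x < 0" and pq: "p < q"
  obtains \<eta> where "\<eta> > 0" "\<And>t. p \<le> t \<Longrightarrow> t \<le> q \<Longrightarrow> integral {p..t} g \<le> - \<eta> * (t - p)"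
proof -
  have "continuous_on {- q..- p} (\<lambda>x. - g (- x))"
    by (intro continuous_intros continuous_on_compose2[OF g]) auto
  then obtain \<eta> where \<eta>: "\<eta> > 0" "\<And>T t. - p \<le> T \<Longrightarrow> T \<le> - p \<Longrightarrow> - q \<le> t \<Longrightarrow> t \<le> T \<Longrightarrow>
      \<eta> * (T - t) \<le> integral {t..T} (\<lambda>x. - g (- x))"
    using average_rate_below[of "- q" "- p" "\<lambda>x. - g (- x)" "- p"] neg pq by (auto simp: minus_less_iff)
  have "integral {p..t} g \<le> - \<eta> * (t - p)" if t: "p \<le> t" "t \<le> q" for t
  proof -
    have "integral {- t..- p} (\<lambda>x. - g (- x)) = - integral {p..t} g"
      using Henstock_Kurzweil_Integration.integral_reflect_real[of t p "\<lambda>x. - g x"] by simp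
    then show ?thesis using \<eta>(2)[of "- p" "- t"] t by (simp add: algebra_simps)
  qed
  with \<eta>(1) that show thesis by blast
qed

lemma near_linear_subset:
  assumes "near_linear A \<rho> e s t Y" "s \<le> s'" "t' \<le> t" "\<rho> \<le> \<rho>'"
  shows "near_linear A \<rho>' e s' t' Y"
  unfolding near_linear_def
proof
  fix x assume x: "x \<in> {s'..t'}"
  then have "x \<in> {s..t}" using assms by auto
  then obtain v where v: "(Y has_vector_derivative v) (at x within {s..t})"
    "norm (e *\<^sub>R v - A x *v Y x) \<le> \<rho> * norm (Y x)"
    using assms(1) unfolding near_linear_def by blast
  have "(Y has_vector_derivative v) (at x within {s'..t'})"
    by (rule has_vector_derivative_within_subset[OF v(1)]) (use assms in auto)
  moreover have "\<rho> * norm (Y x) \<le> \<rho>' * norm (Y x)" using assms by (intro mult_right_mono) auto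
  ultimately show "\<exists>v. (Y has_vector_derivative v) (at x within {s'..t'}) \<and>
      norm (e *\<^sub>R v - A x *v Y x) \<le> \<rho>' * norm (Y x)" using v(2) by force
qed

text \<open>
  Abstract form of the truncated equation for the deviation.
\<close>
locale near_linear_field =
  fixes A :: "real \<Rightarrow> real^2^2" and c d \<rho> e L :: real and H :: "real \<Rightarrow> real^2 \<Rightarrow> real^2"
  assumes e: "e > 0"
    and cont: "continuous_on ({c..d} \<times> UNIV) (\<lambda>(t, y). H t y)"
    and L: "L \<ge> 0" and lip: "\<And>t x y. t \<in> {c..d} \<Longrightarrow> norm (H t x - H t y) \<le> L * norm (x - y)"
    and near: "\<And>t y. t \<in> {c..d} \<Longrightarrow> norm (e *\<^sub>R H t y - A t *v y) \<le> \<rho> * norm y"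
begin

lemma solution_through: "s \<in> {c..d} \<Longrightarrow> \<exists>Z. Z s = v \<and> solves H c d Z"
  using global_solution_exists[OF cont lip] by metis

lemma flow_close:
  "solves H c d Y \<Longrightarrow> solves H c d Z \<Longrightarrow> s \<in> {c..d} \<Longrightarrow> t \<in> {c..d} \<Longrightarrow>
     norm (Y t - Z t) \<le> exp (L * \<bar>t - s\<bar>) * norm (Y s - Z s)"
  by (rule solutions_close[OF L lip])

lemma near_linear_solution:
  assumes "solves H c d Z" "c \<le> s" "t \<le> d"
  shows "near_linear A \<rho> e s t Z"
proof -
  have "near_linear A \<rho> e c d Z" using assms(1) near unfolding near_linear_def solves_def by blast
  then show ?thesis by (rule near_linear_subset) (use assms in auto)
qed

lemma zero_solves: "solves H c d (\<lambda>t. 0)"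
  unfolding solves_def
proof
  fix t assume "t \<in> {c..d}"
  from near[OF this, of 0] have "norm (e *\<^sub>R H t 0) \<le> 0" by simp
  then have "H t 0 = 0" using e by (simp only: norm_le_zero_iff scaleR_eq_0_iff) simp
  then show "((\<lambda>t. 0) has_vector_derivative H t 0) (at t within {c..d})" by simp
qed

text \<open>
  The flow is not homogeneous, so the multiple \<open>\<sigma>\<close> that leads to the
  prescribed size \<open>r0\<close> is found with the intermediate value theorem. The image of the
  line is unbounded, since solutions depend on their initial values in a bi-Lipschitz way.
\<close>
lemma reach:
  assumes st: "s \<in> {c..d}" "t \<in> {c..d}" and p: "p \<noteq> 0" and r0: "r0 > 0"
  shows "\<exists>Z \<sigma>. solves H c d Z \<and> Z s = \<sigma> *\<^sub>R p \<and> norm (Z t) = r0"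
proof -
  define \<Phi> where "\<Phi> = (\<lambda>\<sigma>. SOME Z. Z s = \<sigma> *\<^sub>R p \<and> solves H c d Z)"
  have \<Phi>: "\<Phi> \<sigma> s = \<sigma> *\<^sub>R p" "solves H c d (\<Phi> \<sigma>)" for \<sigma>
    using someI_ex[OF solution_through[OF st(1), of "\<sigma> *\<^sub>R p"]] unfolding \<Phi>_def by auto
  let ?E = "exp (L * \<bar>t - s\<bar>)" and ?g = "\<lambda>\<sigma>. norm (\<Phi> \<sigma> t)"
  have cont_g: "continuous_on UNIV ?g"
  proof -
    have "norm (\<Phi> \<sigma> t - \<Phi> \<tau> t) \<le> (?E * norm p) * \<bar>\<sigma> - \<tau>\<bar>" for \<sigma> \<tau>
      using flow_close[OF \<Phi>(2)[of \<sigma>] \<Phi>(2)[of \<tau>] st] by (simp add: \<Phi>(1) mult_ac flip: scaleR_diff_left)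
    then have "(?E * norm p)-lipschitz_on UNIV (\<lambda>\<sigma>. \<Phi> \<sigma> t)"
      by (intro lipschitz_onI) (auto simp: dist_norm)
    then show ?thesis by (intro continuous_on_norm lipschitz_on_continuous_on)
  qed
  have z: "norm (\<Phi> 0 t) \<le> 0" using flow_close[OF \<Phi>(2)[of 0] zero_solves st] by (simp add: \<Phi>(1))
  define \<sigma>1 where "\<sigma>1 = ?E * r0 / norm p"
  have s1: "\<sigma>1 \<ge> 0" using r0 by (simp add: \<sigma>1_def)
  have "norm (\<Phi> \<sigma>1 s) \<le> exp (L * \<bar>s - t\<bar>) * norm (\<Phi> \<sigma>1 t)"
    using flow_close[OF \<Phi>(2)[of \<sigma>1] zero_solves st(2,1)] by simp
  then have "?E * r0 \<le> ?E * norm (\<Phi> \<sigma>1 t)"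
    using p r0 by (simp add: \<Phi>(1) \<sigma>1_def abs_minus_commute)
  then have "r0 \<le> norm (\<Phi> \<sigma>1 t)" by simp
  then have "\<exists>x\<ge>0. x \<le> \<sigma>1 \<and> ?g x = r0"
    by (intro IVT') (use z r0 s1 in \<open>auto intro: continuous_on_subset[OF cont_g]\<close>)
  then show ?thesis using \<Phi> by blast
qed

text \<open>
  The product of the circle of initial values \<open>|Z t0| = r0\<close> with \<open>[T1,
  T2]\<close> is connected, and \<open>|Z T|\<close> is a continuous function on it.
\<close>
lemma intermediate_crossing:
  assumes t0: "t0 \<in> {c..d}" and T: "c \<le> T1" "T1 \<le> T2" "T2 \<le> d"
    and Zp: "solves H c d Zp" "norm (Zp t0) = r0" "r0 \<le> norm (Zp T2)"
    and Zm: "solves H c d Zm" "norm (Zm t0) = r0" "norm (Zm T1) \<le> r0"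
  shows "\<exists>Z T. solves H c d Z \<and> norm (Z t0) = r0 \<and> T \<in> {T1..T2} \<and> norm (Z T) = r0"
proof -
  define \<Phi> where "\<Phi> = (\<lambda>v. SOME Z. Z t0 = v \<and> solves H c d Z)"
  have \<Phi>: "\<Phi> v t0 = v" "solves H c d (\<Phi> v)" for v
    using someI_ex[OF solution_through[OF t0, of v]] unfolding \<Phi>_def by auto
  define E where "E = exp (L * (d - c))"
  have lipv: "norm (\<Phi> v t - \<Phi> w t) \<le> E * norm (v - w)" if t: "t \<in> {c..d}" for v w t
  proof -
    have "norm (\<Phi> v t - \<Phi> w t) \<le> exp (L * \<bar>t - t0\<bar>) * norm (v - w)"
      using flow_close[OF \<Phi>(2)[of v] \<Phi>(2)[of w] t0 t] by (simp add: \<Phi>(1))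
    also have "\<dots> \<le> E * norm (v - w)"
      unfolding E_def using L t t0 by (intro mult_right_mono) (auto intro!: mult_left_mono)
    finally show ?thesis .
  qed
  have uniq: "\<Phi> (Z t0) t = Z t" if "solves H c d Z" "t \<in> {c..d}" for Z t
    using flow_close[OF \<Phi>(2)[of "Z t0"] that(1) t0 that(2)] by (simp add: \<Phi>(1))
  let ?g = "\<lambda>p. norm (\<Phi> (fst p) (snd p))" and ?S = "sphere (0::real^2) r0 \<times> {T1..T2}"
  have "continuous_on ?S ?g"
  proof (rule continuous_on_norm)
    show "continuous_on ?S (\<lambda>p. \<Phi> (fst p) (snd p))"
      unfolding continuous_on_iff
    proof (intro ballI allI impI)
      fix p and \<gamma> :: real assume p: "p \<in> ?S" and \<gamma>: "\<gamma> > 0"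
      obtain v t where vt: "p = (v, t)" "t \<in> {T1..T2}" using p by auto
      have "continuous_on {T1..T2} (\<Phi> v)"
        by (rule continuous_on_subset[OF solves_continuous[OF \<Phi>(2)]]) (use T in auto)
      then obtain k where k: "k > 0" "\<And>u. u \<in> {T1..T2} \<Longrightarrow> dist u t < k \<Longrightarrow> dist (\<Phi> v u) (\<Phi> v t) < \<gamma> / 2"
        unfolding continuous_on_iff using vt(2) \<gamma> by (meson half_gt_zero)
      have E: "E > 0" by (simp add: E_def)
      show "\<exists>k>0. \<forall>q\<in>?S. dist q p < k \<longrightarrow> dist (\<Phi> (fst q) (snd q)) (\<Phi> (fst p) (snd p)) < \<gamma>"
      proof (intro exI[of _ "min k (\<gamma> / (2 * E))"] conjI ballI impI)
        show "min k (\<gamma> / (2 * E)) > 0" using k \<gamma> E by simp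
        fix q assume q: "q \<in> ?S" "dist q p < min k (\<gamma> / (2 * E))"
        obtain w u where wu: "q = (w, u)" "u \<in> {T1..T2}" using q by auto
        have d1: "dist u t < k" "dist w v < \<gamma> / (2 * E)"
          using q(2) dist_snd_le[of q p] dist_fst_le[of q p] by (auto simp: wu vt)
        have "dist (\<Phi> w u) (\<Phi> v u) \<le> E * dist w v"
          using lipv[of u w v] wu T by (auto simp: dist_norm)
        also have "\<dots> < \<gamma> / 2" using d1(2) E by (simp add: field_simps)
        finally have "dist (\<Phi> w u) (\<Phi> v t) < \<gamma>"
          using k(2)[OF wu(2) d1(1)] dist_triangle[of "\<Phi> w u" "\<Phi> v t" "\<Phi> v u"] by linarith
        then show "dist (\<Phi> (fst q) (snd q)) (\<Phi> (fst p) (snd p)) < \<gamma>" by (simp add: wu vt)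
      qed
    qed
  qed
  moreover have "connected ?S"
    by (intro connected_Times connected_sphere) auto
  ultimately have con: "connected (?g ` ?S)" by (rule connected_continuous_image)
  have "norm (Zm T1) \<in> ?g ` ?S"
    using Zm uniq[OF Zm(1), of T1] T by (intro image_eqI[of _ _ "(Zm t0, T1)"]) auto
  moreover have "norm (Zp T2) \<in> ?g ` ?S"
    using Zp uniq[OF Zp(1), of T2] T by (intro image_eqI[of _ _ "(Zp t0, T2)"]) auto
  ultimately have "r0 \<in> ?g ` ?S"
    using con Zm(3) Zp(3) unfolding connected_iff_interval by blast
  then obtain v T where "norm v = r0" "T \<in> {T1..T2}" "norm (\<Phi> v T) = r0" by auto
  then show ?thesis using \<Phi> by metis
qed

end

lemma exp_quotient_le:
  fixes e :: real
  assumes "e > 0" "X \<le> - \<gamma>"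
  shows "exp (X / e) \<le> exp (- (\<gamma> / e))"
  using divide_right_mono[OF assms(2), of e] assms(1) by simp

text \<open>
  The matrix along the slow curve on the real interval \<open>S\<close>: stable before
  \<open>a\<close>, unstable after \<open>a\<close>, a focus up to \<open>b\<close> and a node
  after \<open>b\<close>.
\<close>
locale focus_node =
  fixes A :: "real \<Rightarrow> real^2^2" and S :: "real set" and a b :: real
  assumes ivl: "\<And>x y. x \<in> S \<Longrightarrow> y \<in> S \<Longrightarrow> {x..y} \<subseteq> S"
    and cont_A: "continuous_on S A" and ab: "a < b" "a \<in> S" "b \<in> S"
    and neg: "\<And>t. t \<in> S \<Longrightarrow> t < a \<Longrightarrow> fast_rate (A t) < 0"
    and pos: "\<And>t. t \<in> S \<Longrightarrow> a < t \<Longrightarrow> slow_rate (A t) > 0"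
    and focus: "\<And>t. t \<in> S \<Longrightarrow> t \<le> b \<Longrightarrow> discr (A t) \<le> 0"
    and node: "\<And>t. t \<in> S \<Longrightarrow> b < t \<Longrightarrow> discr (A t) > 0"
begin

abbreviation "slow t \<equiv> slow_rate (A t)"
abbreviation "fast t \<equiv> fast_rate (A t)"

lemma ivlD: "x \<in> S \<Longrightarrow> y \<in> S \<Longrightarrow> x \<le> z \<Longrightarrow> z \<le> y \<Longrightarrow> z \<in> S"
  using ivl[of x y] by auto

lemma slow_le_fast: "slow t \<le> fast t"
proof -
  have "0 \<le> sqrt (max 0 (discr (A t)))" by simp
  then show ?thesis unfolding slow_rate_def fast_rate_def by linarith
qed

lemma slow_eq_fast: "t \<in> S \<Longrightarrow> t \<le> b \<Longrightarrow> slow t = fast t"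
  using focus[of t] by (simp add: slow_rate_def fast_rate_def max_def)

lemma cont_sub: "s \<in> S \<Longrightarrow> t \<in> S \<Longrightarrow> continuous_on {s..t} A"
  using cont_A ivl continuous_on_subset by blast

lemma cont_slow: "s \<in> S \<Longrightarrow> t \<in> S \<Longrightarrow> continuous_on {s..t} slow"
  and cont_fast: "s \<in> S \<Longrightarrow> t \<in> S \<Longrightarrow> continuous_on {s..t} fast"
  by (rule continuous_on_rates; rule cont_sub; assumption)+

lemma integral_slow_eq_fast:
  assumes "s \<in> S" "t \<in> S" "t \<le> b"
  shows "integral {s..t} slow = integral {s..t} fast"
  by (rule integral_cong) (use assms ivl slow_eq_fast in force)

lemma integral_slow_pos:
  assumes "s \<in> S" "t \<in> S" "a \<le> s" "s < t"
  shows "integral {s..t} slow > 0"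
proof -
  obtain \<eta> where \<eta>: "\<eta> > 0" "\<And>T u. t \<le> T \<Longrightarrow> T \<le> t \<Longrightarrow> s \<le> u \<Longrightarrow> u \<le> T \<Longrightarrow> \<eta> * (T - u) \<le> integral {u..T} slow"
  proof (rule average_rate_below[OF cont_slow[OF assms(1,2)] _ assms(4) order_refl])
    fix x assume x: "s < x" "x \<le> t"
    then have "x \<in> {s..t}" by simp
    then have "x \<in> S" using ivl[OF assms(1,2)] by blast
    then show "slow x > 0" using pos[of x] x assms(3) by linarith
  qed (rule that)
  have "\<eta> * (t - s) > 0" using \<eta>(1) assms by simp
  then show ?thesis using \<eta>(2)[of t s] assms by linarith
qed

lemma integral_slow_le_fast:
  assumes "s \<in> S" "t \<in> S"
  shows "integral {s..t} slow \<le> integral {s..t} fast"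
  by (rule integral_le)
    (use assms slow_le_fast in \<open>auto intro!: integrable_continuous_interval cont_slow cont_fast\<close>)

lemma integral_fast_pos:
  assumes "s \<in> S" "t \<in> S" "a \<le> s" "s < t"
  shows "integral {s..t} fast > 0"
  using integral_slow_pos[OF assms] integral_slow_le_fast[OF assms(1,2)] by linarith

lemma integral_fast_neg:
  assumes "s \<in> S" "t \<in> S" "t \<le> a" "s < t"
  shows "integral {s..t} fast < 0"
proof -
  obtain \<eta> where \<eta>: "\<eta> > 0" "\<And>u. s \<le> u \<Longrightarrow> u \<le> t \<Longrightarrow> integral {s..u} fast \<le> - \<eta> * (u - s)"
  proof (rule average_rate_above[OF cont_fast[OF assms(1,2)] _ assms(4)])
    fix x assume x: "s \<le> x" "x < t"
    then have "x \<in> {s..t}" by simp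
    then have "x \<in> S" using ivl[OF assms(1,2)] by blast
    then show "fast x < 0" using neg[of x] x assms(3) by linarith
  qed (rule that)
  have "\<eta> * (t - s) > 0" using \<eta>(1) assms by simp
  then show ?thesis using \<eta>(2)[of t] assms by simp
qed

lemma entry_before_exit_after:
  assumes "te \<in> S" "ts \<in> S" "te < ts" "integral {te..ts} slow \<le> 0" "0 \<le> integral {te..ts} fast"
  shows "te < a" "a < ts"
proof -
  show "te < a" using integral_slow_pos[OF assms(1,2) _ assms(3)] assms(4) by (meson not_le)
  show "a < ts" using integral_fast_neg[OF assms(1,2) _ assms(3)] assms(5) by (meson not_le)
qed

text \<open>
  The core of the converse. Among the solutions that start at \<open>te\<close> on a circle, one
  is back on it at a time close to \<open>ts\<close>. By the intermediate value argument it
  suffices to exhibit one solution that is outside of the circle slightly after \<open>ts\<close>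
  and one that is inside slightly before. If \<open>ts \<le> b\<close>, both rates agree up to
  \<open>ts\<close>, and any solution will do. If \<open>b < ts\<close>, the first solution
  follows the fast eigendirection and the second one the slow eigendirection after a time
  \<open>b1\<close> just after \<open>b\<close>. The rates agree before \<open>b\<close>, and the
  piece \<open>[b, b1]\<close>, where the directions are not controlled, is so short that it does
  not matter.
\<close>
lemma crossing:
  assumes te: "te \<in> S" and ts: "ts \<in> S" "te < ts"
    and int: "integral {te..ts} slow \<le> 0" "0 \<le> integral {te..ts} fast"
    and cd: "c \<in> S" "d \<in> S" "c \<le> te" "ts + \<delta> \<le> d"
    and \<delta>: "\<delta> > 0" "\<delta> < ts - a" "b < ts \<Longrightarrow> \<delta> < ts - b"
  shows "\<exists>\<rho>>0. \<exists>e0>0. \<forall>e L H r0. near_linear_field A c d \<rho> e L H \<and> e < e0 \<and> 0 < r0 \<longrightarrow>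
    (\<exists>Z T. solves H c d Z \<and> norm (Z te) = r0 \<and> T \<in> {ts - \<delta>..ts + \<delta>} \<and> norm (Z T) = r0)"
proof -
  note order = entry_before_exit_after[OF te ts(1,2) int]
  have inS: "x \<in> S" if "c \<le> x" "x \<le> d" for x using ivl[OF cd(1,2)] that by auto
  have T: "ts - \<delta> \<in> S" "ts + \<delta> \<in> S" using inS cd \<delta> order ts by auto
  have spl_fast: "integral {x..z} fast = integral {x..y} fast + integral {y..z} fast"
    and spl_slow: "integral {x..z} slow = integral {x..y} slow + integral {y..z} slow"
    if "x \<in> S" "z \<in> S" "x \<le> y" "y \<le> z" for x y z
    by (rule integral_split; use that in \<open>auto intro: cont_fast cont_slow\<close>)+
  have fast_after: "integral {te..ts + \<delta>} fast > 0"
    using spl_fast[OF te T(2), of ts] ts \<delta>(1) int(2) integral_fast_pos[OF ts(1) T(2)] order by auto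
  have slow_before: "integral {te..ts - \<delta>} slow < 0"
    using spl_slow[OF te ts(1), of "ts - \<delta>"] ts \<delta> order int(1) integral_slow_pos[OF T(1) ts(1)] by auto
  define len where "len = d - c"
  have len: "len > 0" using cd \<delta> ts by (simp add: len_def)
  show ?thesis
  proof (cases "ts \<le> b")
    case True
    have z: "integral {te..ts} slow = 0" "integral {te..ts} fast = 0"
      using integral_slow_eq_fast[OF te ts(1) True] int by auto
    define Gp where "Gp = integral {te..ts + \<delta>} slow"
    define Gm where "Gm = - integral {te..ts - \<delta>} fast"
    have Gp: "Gp > 0"
      using spl_slow[OF te T(2), of ts] ts \<delta>(1) z integral_slow_pos[OF ts(1) T(2)] order by (auto simp: Gp_def)
    have Gm: "Gm > 0"
      using spl_fast[OF te ts(1), of "ts - \<delta>"] ts \<delta> order z integral_fast_pos[OF T(1) ts(1)] by (auto simp: Gm_def)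
    define \<gamma> where "\<gamma> = min Gp Gm / 2"
    define \<eta> where "\<eta> = \<gamma> / len"
    have \<gamma>: "\<gamma> > 0" "2 * \<gamma> \<le> Gp" "2 * \<gamma> \<le> Gm" and \<eta>: "\<eta> > 0" "\<eta> * len = \<gamma>"
      using Gp Gm len by (auto simp: \<gamma>_def \<eta>_def)
    obtain C1 \<rho>1 e1 where C1: "C1 > 0" "\<rho>1 > 0" "e1 > 0" and up: "\<And>e s t Y. 0 < e \<and> e < e1 \<and> c \<le> s \<and> s \<le> t \<and> t \<le> d \<and>
      near_linear A \<rho>1 e s t Y \<Longrightarrow> norm (Y t) \<le> C1 * norm (Y s) * exp ((integral {s..t} fast + \<eta> * (t - s)) / e)"
      using growth_upper[OF cont_sub[OF cd(1,2)] \<eta>(1)] by blast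
    obtain C2 \<rho>2 e2 where C2: "C2 > 0" "\<rho>2 > 0" "e2 > 0" and low: "\<And>e s t Y. 0 < e \<and> e < e2 \<and> c \<le> s \<and> s \<le> t \<and> t \<le> d \<and>
      near_linear A \<rho>2 e s t Y \<Longrightarrow> norm (Y s) \<le> C2 * norm (Y t) * exp ((- integral {s..t} slow + \<eta> * (t - s)) / e)"
      using growth_lower[OF cont_sub[OF cd(1,2)] \<eta>(1)] by blast
    obtain e3 where e3: "e3 > 0" "\<And>e. 0 < e \<Longrightarrow> e < e3 \<Longrightarrow> C1 * exp (- (\<gamma> / e)) < 1"
      using small_exponential[OF C1(1) \<gamma>(1)] by metis
    obtain e4 where e4: "e4 > 0" "\<And>e. 0 < e \<Longrightarrow> e < e4 \<Longrightarrow> C2 * exp (- (\<gamma> / e)) < 1"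
      using small_exponential[OF C2(1) \<gamma>(1)] by metis
    have main: "\<exists>Z T. solves H c d Z \<and> norm (Z te) = r0 \<and> T \<in> {ts - \<delta>..ts + \<delta>} \<and> norm (Z T) = r0"
      if nl: "near_linear_field A c d (min \<rho>1 \<rho>2) e L H" and small: "e < min (min e1 e2) (min e3 e4)" and r0: "0 < r0"
      for e L H r0
    proof -
      interpret near_linear_field A c d "min \<rho>1 \<rho>2" e L H by (fact nl)
      have tecd: "te \<in> {c..d}" using cd ts \<delta> by auto
      obtain v :: "real^2" where v: "norm v = r0" using vector_choose_size[of r0] r0 by auto
      obtain Z where Z: "Z te = v" "solves H c d Z" using solution_through[OF tecd] by blast
      have nz: "near_linear A \<rho>1 e s t Z" "near_linear A \<rho>2 e s t Z" if "c \<le> s" "t \<le> d" for s t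
        by (rule near_linear_subset[OF near_linear_solution[OF Z(2) that]]; simp)+
      have ex: "\<eta> * (t - te) \<le> \<gamma>" if "t \<le> d" for t
      proof -
        have "\<eta> * (t - te) \<le> \<eta> * len" using that cd \<eta> by (intro mult_left_mono) (auto simp: len_def)
        then show ?thesis using \<eta>(2) by simp
      qed
      have "norm (Z te) \<le> C2 * norm (Z (ts + \<delta>)) * exp ((- integral {te..ts + \<delta>} slow + \<eta> * (ts + \<delta> - te)) / e)"
        by (rule low) (use e small cd ts \<delta> nz in auto)
      also have "\<dots> \<le> C2 * norm (Z (ts + \<delta>)) * exp (- (\<gamma> / e))"
        using C2 ex[of "ts + \<delta>"] cd \<gamma> by (intro mult_left_mono exp_quotient_le[OF e]) (auto simp: Gp_def)
      also have "\<dots> = (C2 * exp (- (\<gamma> / e))) * norm (Z (ts + \<delta>))" by simp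
      also have "\<dots> \<le> 1 * norm (Z (ts + \<delta>))"
        using e4(2)[of e] e small by (intro mult_right_mono) auto
      finally have p: "r0 \<le> norm (Z (ts + \<delta>))" using Z v by simp
      have "norm (Z (ts - \<delta>)) \<le> C1 * norm (Z te) * exp ((integral {te..ts - \<delta>} fast + \<eta> * (ts - \<delta> - te)) / e)"
        by (rule up) (use e small cd ts \<delta> nz order in auto)
      also have "\<dots> \<le> C1 * norm (Z te) * exp (- (\<gamma> / e))"
        using C1 ex[of "ts - \<delta>"] cd \<gamma> \<delta> by (intro mult_left_mono exp_quotient_le[OF e]) (auto simp: Gm_def)
      also have "\<dots> = (C1 * exp (- (\<gamma> / e))) * norm (Z te)" by simp
      also have "\<dots> \<le> 1 * norm (Z te)"
        using e3(2)[of e] e small by (intro mult_right_mono) auto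
      finally have m: "norm (Z (ts - \<delta>)) \<le> r0" using Z v by simp
      show ?thesis
        by (rule intermediate_crossing[OF tecd _ _ _ Z(2) _ p Z(2) _ m]) (use Z v cd ts \<delta> order in auto)
    qed
    show ?thesis
      by (intro exI[of _ "min \<rho>1 \<rho>2"] conjI exI[of _ "min (min e1 e2) (min e3 e4)"] allI impI; (elim conjE)?)
        (use C1 C2 e3 e4 main in auto)
  next
    case False
    \<comment> \<open>one of the four parts is spent on \<open>[b, b1]\<close> and one on the
      error of the rates; what remains beats the constants\<close>
    define \<gamma> where "\<gamma> = min (integral {te..ts + \<delta>} fast) (- integral {te..ts - \<delta>} slow) / 4"
    have \<gamma>: "\<gamma> > 0" "4 * \<gamma> \<le> integral {te..ts + \<delta>} fast" "4 * \<gamma> \<le> - integral {te..ts - \<delta>} slow"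
      using fast_after slow_before by (auto simp: \<gamma>_def)
    have bT: "b < ts - \<delta>" using \<delta>(3) False by auto
    obtain b1 where b1: "b < b1" "b1 < ts - \<delta>" "integral {b..b1} fast - integral {b..b1} slow < \<gamma>"
    proof -
      have ci: "continuous_on {b..ts - \<delta>} (\<lambda>x. integral {b..x} (\<lambda>t. fast t - slow t))"
        by (intro indefinite_integral_continuous_1 integrable_continuous_interval continuous_intros cont_fast cont_slow ab T)
      \<comment> \<open>the integral is extended to a function on the line, for continuity at
        the end point \<open>b\<close>\<close>
      define F where "F = (\<lambda>x. integral {b..max b (min x (ts - \<delta>))} (\<lambda>t. fast t - slow t))"
      have "continuous_on UNIV F"
        unfolding F_def by (rule continuous_on_compose2[OF ci]) (use bT in \<open>auto intro!: continuous_intros\<close>)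
      then have "isCont F b" by (simp add: continuous_on_eq_continuous_at)
      then obtain k where k: "k > 0" "\<And>x. \<bar>x - b\<bar> < k \<Longrightarrow> \<bar>F x - F b\<bar> < \<gamma>"
        unfolding continuous_at_eps_delta dist_real_def using \<gamma>(1) by blast
      define x where "x = min (b + k / 2) ((b + (ts - \<delta>)) / 2)"
      have x: "b < x" "x < ts - \<delta>" "\<bar>x - b\<bar> < k" using k(1) bT by (auto simp: x_def min_def)
      have "max b (min x (ts - \<delta>)) = x" "max b (min b (ts - \<delta>)) = b" using x bT by auto
      then have "integral {b..x} (\<lambda>t. fast t - slow t) < \<gamma>" using k(2)[OF x(3)] by (simp add: F_def)
      moreover have "x \<in> S" using ivl[OF ab(3) T(1)] x by auto
      then have "integral {b..x} (\<lambda>t. fast t - slow t) = integral {b..x} fast - integral {b..x} slow"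
        by (intro Henstock_Kurzweil_Integration.integral_diff integrable_continuous_interval cont_fast cont_slow ab)
      ultimately show thesis using that x by simp
    qed
    have b1S: "b1 \<in> S" using ivl[OF ab(3) T(1)] b1 by auto
    have tb: "te \<le> b" using order ab by auto
    have head: "integral {te..b1} fast - integral {te..b1} slow < \<gamma>"
      using spl_fast[OF te b1S tb] spl_slow[OF te b1S tb] b1 integral_slow_eq_fast[OF te ab(3)] by auto
    define \<eta> where "\<eta> = \<gamma> / len"
    have \<eta>: "\<eta> > 0" "\<eta> * len = \<gamma>" using \<gamma> len by (auto simp: \<eta>_def)
    have disc: "discr (A x) > 0" if "b1 \<le> x" "x \<le> ts + \<delta>" for x
      by (rule node) (use ivl[OF b1S T(2)] that b1 in auto)
    obtain C1 \<rho>1 e1 where C1: "C1 > 0" "\<rho>1 > 0" "e1 > 0" and up: "\<And>e s t Y. 0 < e \<and> e < e1 \<and> c \<le> s \<and> s \<le> t \<and> t \<le> d \<and>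
      near_linear A \<rho>1 e s t Y \<Longrightarrow> norm (Y t) \<le> C1 * norm (Y s) * exp ((integral {s..t} fast + \<eta> * (t - s)) / e)"
      using growth_upper[OF cont_sub[OF cd(1,2)] \<eta>(1)] by blast
    obtain C2 \<rho>2 e2 where C2: "C2 > 0" "\<rho>2 > 0" "e2 > 0" and low: "\<And>e s t Y. 0 < e \<and> e < e2 \<and> c \<le> s \<and> s \<le> t \<and> t \<le> d \<and>
      near_linear A \<rho>2 e s t Y \<Longrightarrow> norm (Y s) \<le> C2 * norm (Y t) * exp ((- integral {s..t} slow + \<eta> * (t - s)) / e)"
      using growth_lower[OF cont_sub[OF cd(1,2)] \<eta>(1)] by blast
    have disc_p: "discr (A x) > 0" if "x \<in> {b1..ts + \<delta>}" for x using disc that by simp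
    have disc_m: "discr (A x) > 0" if "x \<in> {b1..ts - \<delta>}" for x using disc that \<delta>(1) by simp
    have b1T: "b1 \<le> ts + \<delta>" "b1 \<le> ts - \<delta>" using b1 \<delta> by auto
    obtain C3 \<rho>3 e3 p where C3: "C3 > 0" "\<rho>3 > 0" "e3 > 0" "p \<noteq> 0" and fst_g: "\<And>e t \<sigma> Y. 0 < e \<and> e < e3 \<and> b1 \<le> t \<and> t \<le> ts + \<delta> \<and>
      near_linear A \<rho>3 e b1 t Y \<and> Y b1 = \<sigma> *\<^sub>R p \<Longrightarrow>
      norm (Y b1) * exp ((integral {b1..t} fast - \<eta> * (t - b1)) / e) \<le> C3 * norm (Y t)"
      using fast_growth[OF cont_sub[OF b1S T(2)] \<eta>(1) b1T(1) disc_p] by blast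
    obtain C4 \<rho>4 e4 q where C4: "C4 > 0" "\<rho>4 > 0" "e4 > 0" "q \<noteq> 0" and slw_d: "\<And>e t \<sigma> Y. 0 < e \<and> e < e4 \<and> b1 \<le> t \<and> t \<le> ts - \<delta> \<and>
      near_linear A \<rho>4 e t (ts - \<delta>) Y \<and> Y (ts - \<delta>) = \<sigma> *\<^sub>R q \<Longrightarrow>
      norm (Y (ts - \<delta>)) * exp ((- integral {t..ts - \<delta>} slow - \<eta> * (ts - \<delta> - t)) / e) \<le> C4 * norm (Y t)"
      using slow_decay[OF cont_sub[OF b1S T(1)] \<eta>(1) b1T(2) disc_m] by blast
    obtain e5 where e5: "e5 > 0" "\<And>e. 0 < e \<Longrightarrow> e < e5 \<Longrightarrow> C2 * C3 * exp (- (\<gamma> / e)) < 1"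
      using small_exponential[of "C2 * C3" \<gamma>] C2 C3 \<gamma>(1) by (metis mult_pos_pos)
    obtain e6 where e6: "e6 > 0" "\<And>e. 0 < e \<Longrightarrow> e < e6 \<Longrightarrow> C1 * C4 * exp (- (\<gamma> / e)) < 1"
      using small_exponential[of "C1 * C4" \<gamma>] C1 C4 \<gamma>(1) by (metis mult_pos_pos)
    define \<rho> where "\<rho> = min (min \<rho>1 \<rho>2) (min \<rho>3 \<rho>4)"
    define e0 where "e0 = min (min e1 e2) (min (min e3 e4) (min e5 e6))"
    have rho: "\<rho> > 0" "\<rho> \<le> \<rho>1" "\<rho> \<le> \<rho>2" "\<rho> \<le> \<rho>3" "\<rho> \<le> \<rho>4" using C1 C2 C3 C4 by (auto simp: \<rho>_def)
    have e0: "e0 > 0" "e0 \<le> e1" "e0 \<le> e2" "e0 \<le> e3" "e0 \<le> e4" "e0 \<le> e5" "e0 \<le> e6"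
      using C1 C2 C3 C4 e5 e6 by (auto simp: e0_def)
    have main: "\<exists>Z T. solves H c d Z \<and> norm (Z te) = r0 \<and> T \<in> {ts - \<delta>..ts + \<delta>} \<and> norm (Z T) = r0"
      if nl: "near_linear_field A c d \<rho> e L H" and small: "e < e0" and r0: "0 < r0" for e L H r0
    proof -
      interpret near_linear_field A c d \<rho> e L H by (fact nl)
      have cds: "te \<in> {c..d}" "b1 \<in> {c..d}" "ts - \<delta> \<in> {c..d}" using cd ts \<delta> b1 tb by auto
      have teb1: "te \<le> b1" using tb b1 by auto
      have nz: "near_linear A \<rho>1 e s t Z" "near_linear A \<rho>2 e s t Z" "near_linear A \<rho>3 e s t Z" "near_linear A \<rho>4 e s t Z"
        if "solves H c d Z" "c \<le> s" "t \<le> d" for s t Z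
        by (rule near_linear_subset[OF near_linear_solution[OF that]]; simp add: rho)+
      have ex: "\<eta> * (t - te) \<le> \<gamma>" if "t \<le> d" for t
      proof -
        have "\<eta> * (t - te) \<le> \<eta> * len" using that cd \<eta> by (intro mult_left_mono) (auto simp: len_def)
        then show ?thesis using \<eta>(2) by simp
      qed
      obtain Zp \<sigma> where Zp: "solves H c d Zp" "Zp b1 = \<sigma> *\<^sub>R p" "norm (Zp te) = r0"
        using reach[OF cds(2,1) C3(4) r0] by blast
      let ?X = "(- integral {te..b1} slow + \<eta> * (b1 - te)) / e" and ?Y = "(integral {b1..ts + \<delta>} fast - \<eta> * (ts + \<delta> - b1)) / e"
      have l1: "norm (Zp te) \<le> C2 * norm (Zp b1) * exp ?X"
        by (rule low) (use e small e0 cds nz[OF Zp(1)] teb1 in auto)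
      have l2: "norm (Zp b1) * exp ?Y \<le> C3 * norm (Zp (ts + \<delta>))"
        by (rule fst_g) (use e small e0 cds nz[OF Zp(1)] b1T Zp(2) cd in auto)
      have "r0 * exp ?Y \<le> C2 * norm (Zp b1) * exp ?X * exp ?Y"
        using l1 Zp(3) by (intro mult_right_mono) auto
      also have "\<dots> = C2 * exp ?X * (norm (Zp b1) * exp ?Y)" by simp
      also have "\<dots> \<le> C2 * exp ?X * (C3 * norm (Zp (ts + \<delta>)))"
        using l2 C2 by (intro mult_left_mono) auto
      finally have "r0 * exp ?Y * exp (- ?Y) \<le> C2 * exp ?X * (C3 * norm (Zp (ts + \<delta>))) * exp (- ?Y)"
        by (intro mult_right_mono) auto
      then have "r0 \<le> C2 * C3 * (exp ?X * exp (- ?Y)) * norm (Zp (ts + \<delta>))"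
        by (simp add: mult_ac flip: exp_add)
      also have "exp ?X * exp (- ?Y) \<le> exp (- (\<gamma> / e))"
      proof -
        have "?X + - ?Y = (- integral {te..b1} slow - integral {b1..ts + \<delta>} fast + \<eta> * (ts + \<delta> - te)) / e"
          using e by (simp add: field_simps)
        also have "\<dots> \<le> (- \<gamma>) / e"
          using e ex[of "ts + \<delta>"] cd head \<gamma> spl_fast[OF te T(2) teb1 b1T(1)] by (intro divide_right_mono) auto
        finally show ?thesis by (simp flip: exp_add)
      qed
      then have "C2 * C3 * (exp ?X * exp (- ?Y)) * norm (Zp (ts + \<delta>)) \<le> C2 * C3 * exp (- (\<gamma> / e)) * norm (Zp (ts + \<delta>))"
        using C2 C3 by (intro mult_right_mono mult_left_mono) auto
      also have "\<dots> \<le> 1 * norm (Zp (ts + \<delta>))"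
        using e5(2)[of e] e small e0 by (intro mult_right_mono) auto
      finally have p: "r0 \<le> norm (Zp (ts + \<delta>))" by simp
      obtain Zm \<sigma>' where Zm: "solves H c d Zm" "Zm (ts - \<delta>) = \<sigma>' *\<^sub>R q" "norm (Zm te) = r0"
        using reach[OF cds(3,1) C4(4) r0] by blast
      let ?U = "(integral {te..b1} fast + \<eta> * (b1 - te)) / e" and ?V = "(- integral {b1..ts - \<delta>} slow - \<eta> * (ts - \<delta> - b1)) / e"
      have m1: "norm (Zm b1) \<le> C1 * norm (Zm te) * exp ?U"
        by (rule up) (use e small e0 cds nz[OF Zm(1)] teb1 in auto)
      have m2: "norm (Zm (ts - \<delta>)) * exp ?V \<le> C4 * norm (Zm b1)"
        by (rule slw_d) (use e small e0 cds nz[OF Zm(1)] b1T Zm(2) cd in auto)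
      have "norm (Zm (ts - \<delta>)) * exp ?V * exp (- ?V) \<le> C4 * (C1 * norm (Zm te) * exp ?U) * exp (- ?V)"
        using order_trans[OF m2 mult_left_mono[OF m1]] C4 by (intro mult_right_mono) auto
      then have "norm (Zm (ts - \<delta>)) \<le> C1 * C4 * (exp ?U * exp (- ?V)) * r0"
        using Zm(3) by (simp add: mult_ac flip: exp_add)
      also have "exp ?U * exp (- ?V) \<le> exp (- (\<gamma> / e))"
      proof -
        have "?U + - ?V = (integral {te..b1} fast + integral {b1..ts - \<delta>} slow + \<eta> * (ts - \<delta> - te)) / e"
          using e by (simp add: field_simps)
        also have "\<dots> \<le> (- \<gamma>) / e"
          using e ex[of "ts - \<delta>"] cd \<delta> head \<gamma> spl_slow[OF te T(1) teb1 b1T(2)] by (intro divide_right_mono) auto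
        finally show ?thesis by (simp flip: exp_add)
      qed
      then have "C1 * C4 * (exp ?U * exp (- ?V)) * r0 \<le> C1 * C4 * exp (- (\<gamma> / e)) * r0"
        using C1 C4 r0 by (intro mult_right_mono mult_left_mono) auto
      also have "\<dots> \<le> 1 * r0"
        using e6(2)[of e] e small e0 r0 by (intro mult_right_mono) auto
      finally have m: "norm (Zm (ts - \<delta>)) \<le> r0" by simp
      show ?thesis
        by (rule intermediate_crossing[OF cds(1) _ _ _ Zp(1,3) p Zm(1,3) m]) (use cd ts \<delta> order in auto)
    qed
    show ?thesis
      using rho(1) e0(1) main by blast
  qed
qed

text \<open>
  A solution of size \<open>r0\<close> at both ends is exponentially small inside: it decreases
  from \<open>te\<close> to \<open>a\<close> at least at the fast rate, and, read backwards, from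
  \<open>T\<close> to \<open>a\<close> at least at the slow rate. The exponent
  \<open>\<eta>\<close> and the other constants do not depend on \<open>T\<close>.
\<close>
lemma envelope:
  assumes te: "te \<in> S" "te < a" and cd: "c \<in> S" "d \<in> S" "c \<le> te" and q: "a < q" "q \<le> d"
  shows "\<exists>\<eta>>0. \<exists>C\<ge>1. \<exists>\<rho>>0. \<exists>e0>0. \<forall>e r0 T Y t. 0 < e \<and> e < e0 \<and> near_linear A \<rho> e te T Y \<and>
    norm (Y te) = r0 \<and> norm (Y T) = r0 \<and> q \<le> T \<and> T \<le> d \<and> te \<le> t \<and> t \<le> T \<longrightarrow>
    norm (Y t) \<le> C * r0 * exp (- (\<eta> * min (t - te) (T - t) / e))"
proof -
  have aS: "a \<in> S" by (rule ab)
  have inS: "x \<in> S" if "c \<le> x" "x \<le> d" for x using ivl[OF cd(1,2)] that by auto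
  obtain h1 where h1: "h1 > 0" "\<And>t. te \<le> t \<Longrightarrow> t \<le> a \<Longrightarrow> integral {te..t} fast \<le> - h1 * (t - te)"
  proof (rule average_rate_above[OF cont_fast[OF te(1) aS] _ te(2)])
    fix x assume "te \<le> x" "x < a"
    then show "fast x < 0" using neg[of x] ivlD[OF te(1) aS, of x] by simp
  qed (rule that)
  obtain h2 where h2: "h2 > 0" "\<And>T t. q \<le> T \<Longrightarrow> T \<le> d \<Longrightarrow> a \<le> t \<Longrightarrow> t \<le> T \<Longrightarrow> h2 * (T - t) \<le> integral {t..T} slow"
  proof (rule average_rate_below[OF cont_slow[OF aS cd(2)] _ q])
    fix x assume "a < x" "x \<le> d"
    then show "slow x > 0" using pos[of x] ivlD[OF aS cd(2), of x] by simp
  qed (rule that)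
  define \<eta> where "\<eta> = min h1 h2 / 2"
  have \<eta>: "\<eta> > 0" "2 * \<eta> \<le> h1" "2 * \<eta> \<le> h2" using h1 h2 by (auto simp: \<eta>_def)
  obtain C1 \<rho>1 e1 where C1: "C1 > 0" "\<rho>1 > 0" "e1 > 0" and up: "\<And>e s t Y. 0 < e \<and> e < e1 \<and> c \<le> s \<and> s \<le> t \<and> t \<le> d \<and>
    near_linear A \<rho>1 e s t Y \<Longrightarrow> norm (Y t) \<le> C1 * norm (Y s) * exp ((integral {s..t} fast + \<eta> * (t - s)) / e)"
    using growth_upper[OF cont_sub[OF cd(1,2)] \<eta>(1)] by blast
  obtain C2 \<rho>2 e2 where C2: "C2 > 0" "\<rho>2 > 0" "e2 > 0" and low: "\<And>e s t Y. 0 < e \<and> e < e2 \<and> c \<le> s \<and> s \<le> t \<and> t \<le> d \<and>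
    near_linear A \<rho>2 e s t Y \<Longrightarrow> norm (Y s) \<le> C2 * norm (Y t) * exp ((- integral {s..t} slow + \<eta> * (t - s)) / e)"
    using growth_lower[OF cont_sub[OF cd(1,2)] \<eta>(1)] by blast
  define C where "C = max 1 (max C1 C2)"
  have C: "C \<ge> 1" "C1 \<le> C" "C2 \<le> C" by (auto simp: C_def)
  have main: "norm (Y t) \<le> C * r0 * exp (- (\<eta> * min (t - te) (T - t) / e))"
    if e: "0 < e" "e < min e1 e2" and nl: "near_linear A (min \<rho>1 \<rho>2) e te T Y"
      and r0: "norm (Y te) = r0" "norm (Y T) = r0" and T: "q \<le> T" "T \<le> d" and t: "te \<le> t" "t \<le> T" for e r0 T Y t
  proof (cases "t \<le> a")
    case True
    have r00: "r0 \<ge> 0" using r0 norm_ge_zero by metis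
    have "near_linear A \<rho>1 e te t Y" by (rule near_linear_subset[OF nl]) (use t in auto)
    then have "norm (Y t) \<le> C1 * r0 * exp ((integral {te..t} fast + \<eta> * (t - te)) / e)"
      using up[of e te t Y] e cd t T r0 by auto
    also have "\<dots> \<le> C * r0 * exp (- (\<eta> * min (t - te) (T - t) / e))"
    proof (intro mult_mono)
      have "integral {te..t} fast + \<eta> * (t - te) \<le> - h1 * (t - te) + \<eta> * (t - te)" using h1(2)[OF t(1) True] by simp
      also have "\<dots> \<le> - (\<eta> * (t - te))"
        using mult_right_mono[OF \<eta>(2), of "t - te"] t by simp
      also have "\<dots> \<le> - (\<eta> * min (t - te) (T - t))" using \<eta>(1) by simp
      finally have "(integral {te..t} fast + \<eta> * (t - te)) / e \<le> - (\<eta> * min (t - te) (T - t)) / e"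
        using e by (intro divide_right_mono) auto
      then show "exp ((integral {te..t} fast + \<eta> * (t - te)) / e) \<le> exp (- (\<eta> * min (t - te) (T - t) / e))" by simp
    qed (use C C1 r00 in auto)
    finally show ?thesis .
  next
    case False
    have r00: "r0 \<ge> 0" using r0 norm_ge_zero by metis
    have "near_linear A \<rho>2 e t T Y" by (rule near_linear_subset[OF nl]) (use t in auto)
    then have "norm (Y t) \<le> C2 * r0 * exp ((- integral {t..T} slow + \<eta> * (T - t)) / e)"
      using low[of e t T Y] e cd t T r0 by auto
    also have "\<dots> \<le> C * r0 * exp (- (\<eta> * min (t - te) (T - t) / e))"
    proof (intro mult_mono)
      have "- integral {t..T} slow + \<eta> * (T - t) \<le> - h2 * (T - t) + \<eta> * (T - t)" using h2(2)[OF T _ t(2)] False by simp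
      also have "\<dots> \<le> - (\<eta> * (T - t))"
        using mult_right_mono[OF \<eta>(3), of "T - t"] t by simp
      also have "\<dots> \<le> - (\<eta> * min (t - te) (T - t))" using \<eta>(1) by simp
      finally have "(- integral {t..T} slow + \<eta> * (T - t)) / e \<le> - (\<eta> * min (t - te) (T - t)) / e"
        using e by (intro divide_right_mono) auto
      then show "exp ((- integral {t..T} slow + \<eta> * (T - t)) / e) \<le> exp (- (\<eta> * min (t - te) (T - t) / e))" by simp
    qed (use C C2 r00 in auto)
    finally show ?thesis .
  qed
  have "min \<rho>1 \<rho>2 > 0" "min e1 e2 > 0" using C1 C2 by auto
  with \<eta>(1) C(1) main show ?thesis by blast
qed

end

section \<open>Linearization near the slow curve\<close>

lemma vec2_expand: "(y :: complex^2) = y$1 *s axis 1 1 + y$2 *s axis 2 1"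
  by (simp add: vec_eq_iff forall_2 axis_def)

lemma norm_matrix_vector_le_complex:
  fixes M :: "complex^2^2"
  shows "norm (M *v y) \<le> 4 * norm M * norm y"
proof -
  have "norm (M *v y) \<le> (\<Sum>i\<in>UNIV. norm ((M *v y) $ i))" unfolding norm_vec_def by (rule L2_set_le_sum) simp
  also have "\<dots> \<le> (\<Sum>i\<in>(UNIV::2 set). \<Sum>j\<in>(UNIV::2 set). norm M * norm y)"
  proof (rule sum_mono)
    fix i :: 2
    have "norm ((M *v y) $ i) \<le> (\<Sum>j\<in>UNIV. norm (M$i$j * y$j))"
      unfolding matrix_vector_mult_def by (simp add: norm_sum)
    also have "\<dots> \<le> (\<Sum>j\<in>(UNIV::2 set). norm M * norm y)"
    proof (rule sum_mono)
      fix j :: 2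
      have "norm (M$i$j) \<le> norm M"
        using Finite_Cartesian_Product.norm_nth_le[of "M$i" j] Finite_Cartesian_Product.norm_nth_le[of M i] by linarith
      then show "norm (M$i$j * y$j) \<le> norm M * norm y"
        unfolding norm_mult by (intro mult_mono Finite_Cartesian_Product.norm_nth_le) auto
    qed
    finally show "norm ((M *v y) $ i) \<le> (\<Sum>j\<in>(UNIV::2 set). norm M * norm y)" .
  qed
  also have "\<dots> = 4 * norm M * norm y" by simp
  finally show ?thesis .
qed

lemma analytic_field_continuous: "analytic_field f D \<Longrightarrow> continuous_on D f"
  unfolding analytic_field_def
  by (rule continuous_at_imp_continuous_on) (blast intro: has_derivative_continuous)

text \<open>
  Complex linearity of the derivative is what makes \<open>DX\<close>, a matrix over the complex
  numbers, represent it.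
\<close>
lemma analytic_fieldD:
  assumes "analytic_field f D" "(t, x, e) \<in> D"
  obtains L where "(f has_derivative L) (at (t, x, e))"
    "\<And>y. L (0, y, 0) = DX f t x e *v y"
    "\<And>y. ((\<lambda>y. f (t, y, e)) has_derivative (\<lambda>y. DX f t x e *v y)) (at x)"
proof -
  obtain L where L: "(f has_derivative L) (at (t, x, e))"
    and lin: "\<And>c t x e. L (c * t, c *s x, c * e) = c *s L (t, x, e)"
    using assms unfolding analytic_field_def by blast
  interpret L: bounded_linear L using L by (rule has_derivative_bounded_linear)
  have d: "((\<lambda>y. f (t, y, e)) has_derivative (\<lambda>y. L (0, y, 0))) (at x)"
  proof -
    have "((\<lambda>y. (t, y, e)) has_derivative (\<lambda>y. (0, y, 0))) (at x)"
      by (intro derivative_eq_intros) auto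
    from diff_chain_at[OF this, of f L] L show ?thesis by (simp add: o_def)
  qed
  have entry: "DX f t x e $ i $ j = L (0, axis j 1, 0) $ i" for i j
    unfolding DX_def frechet_derivative_at[OF d, symmetric] by (simp add: matrix_def)
  have eq: "L (0, y, 0) = DX f t x e *v y" for y
  proof -
    have s: "L (0, z *s v, 0) = z *s L (0, v, 0)" for z v using lin[of z 0 v 0] by simp
    have "L (0, y, 0) = L ((0, y$1 *s axis 1 1, 0) + (0, y$2 *s axis 2 1, 0))"
      using vec2_expand[of y] by simp
    also have "\<dots> = y$1 *s L (0, axis 1 1, 0) + y$2 *s L (0, axis 2 1, 0)"
      by (simp only: L.add s)
    also have "\<dots> = DX f t x e *v y"
      by (simp add: vec_eq_iff matrix_vector_mult_def sum_2 entry mult.commute)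
    finally show ?thesis .
  qed
  show thesis using that[OF L eq] d by (simp add: eq)
qed

lemma norm_axis_shift: "norm (\<zeta> *s (axis j 1 :: complex^2)) = norm \<zeta>"
  using exhaust_2[of j] by (auto simp: norm_vec_def L2_set_def sum_2 axis_def)

lemma DX_entry_derivative:
  assumes f: "analytic_field f D" and p: "(t, x + \<zeta> *s axis j 1, e) \<in> D"
  shows "((\<lambda>\<zeta>. f (t, x + \<zeta> *s axis j 1, e) $ i) has_field_derivative DX f t (x + \<zeta> *s axis j 1) e $ i $ j) (at \<zeta>)"
proof -
  obtain L where L: "(f has_derivative L) (at (t, x + \<zeta> *s axis j 1, e))"
    "\<And>y. L (0, y, 0) = DX f t (x + \<zeta> *s axis j 1) e *v y"
    using analytic_fieldD[OF f p] by metis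
  have bl: "bounded_linear (\<lambda>h::complex. h *s (axis j 1 :: complex^2))"
  proof (rule bounded_linear_intro)
    show "norm (h *s (axis j 1 :: complex^2)) \<le> norm h * 1" for h :: complex
      by (simp add: norm_axis_shift)
  qed (auto simp: vec_eq_iff algebra_simps)
  have "((\<lambda>\<zeta>. x + \<zeta> *s axis j 1) has_derivative (\<lambda>h. h *s axis j 1)) (at \<zeta>)"
    using has_derivative_add[OF has_derivative_const bounded_linear_imp_has_derivative[OF bl], of x] by simp
  then have "((\<lambda>\<zeta>. (t, x + \<zeta> *s axis j 1, e)) has_derivative (\<lambda>h. (0, h *s axis j 1, 0))) (at \<zeta>)"
    by (intro has_derivative_Pair has_derivative_const)
  from diff_chain_at[OF this L(1)]
  have "((\<lambda>\<zeta>. f (t, x + \<zeta> *s axis j 1, e)) has_derivative (\<lambda>h. DX f t (x + \<zeta> *s axis j 1) e *v (h *s axis j 1))) (at \<zeta>)"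
    by (simp add: o_def L(2))
  then have "((\<lambda>\<zeta>. f (t, x + \<zeta> *s axis j 1, e) $ i) has_derivative (\<lambda>h. (DX f t (x + \<zeta> *s axis j 1) e *v (h *s axis j 1)) $ i)) (at \<zeta>)"
    by (rule bounded_linear.has_derivative[OF bounded_linear_vec_nth])
  moreover have "(M *v (h *s axis j 1)) $ i = M $ i $ j * h" for M :: "complex^2^2" and h
    by (simp add: matrix_vector_mult_def axis_def if_distrib sum.delta cong: if_cong)
  ultimately show ?thesis
    unfolding has_field_derivative_def by simp
qed

text \<open>
  A partial derivative is a one-variable derivative along a complex line, and Cauchy's inequality
  bounds the difference of two such derivatives by the difference of the functions on a circle. So
  continuity of \<open>f\<close> suffices.
\<close>
lemma DX_entry_continuous:
  assumes f: "analytic_field f D" and D: "open D"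
  shows "continuous_on D (\<lambda>(t, x, e). DX f t x e $ i $ j)"
  unfolding continuous_on_iff
proof (intro ballI allI impI)
  fix p0 and \<gamma> :: real assume p0: "p0 \<in> D" and \<gamma>: "\<gamma> > 0"
  obtain R0 where R0: "R0 > 0" "cball p0 R0 \<subseteq> D" using D p0 open_contains_cball by blast
  define R where "R = R0 / 2"
  have R: "R > 0" by (simp add: R_def R0)
  have "uniformly_continuous_on (cball p0 R0) f"
    by (intro compact_uniformly_continuous continuous_on_subset[OF analytic_field_continuous[OF f] R0(2)]) simp
  then obtain k where k: "k > 0" "\<And>p q. p \<in> cball p0 R0 \<Longrightarrow> q \<in> cball p0 R0 \<Longrightarrow> dist q p < k \<Longrightarrow> dist (f q) (f p) < \<gamma> * R / 2"
    unfolding uniformly_continuous_on_def using R \<gamma> by (metis half_gt_zero mult_pos_pos)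
  obtain t0 x0 e0 where p0eq: "p0 = (t0, x0, e0)" by (cases p0)
  show "\<exists>d>0. \<forall>p\<in>D. dist p p0 < d \<longrightarrow>
      dist (case p of (t, x, e) \<Rightarrow> DX f t x e $ i $ j) (case p0 of (t, x, e) \<Rightarrow> DX f t x e $ i $ j) < \<gamma>"
  proof (intro exI[of _ "min k R"] conjI ballI impI)
    show "min k R > 0" using k R by simp
    fix p assume p: "p \<in> D" "dist p p0 < min k R"
    obtain t x e where peq: "p = (t, x, e)" by (cases p)
    let ?v = "axis j 1 :: complex^2"
    have shift: "(t', x' + \<zeta> *s ?v, e') = (t', x', e') + (0, \<zeta> *s ?v, 0)"
      for t' e' \<zeta> :: complex and x' by simp
    have nrm: "norm (0::complex, \<zeta> *s ?v, 0::complex) = norm \<zeta>" for \<zeta> by (simp add: norm_Pair norm_axis_shift)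
    have in0: "(t0, x0 + \<zeta> *s ?v, e0) \<in> cball p0 R0" if "norm \<zeta> \<le> R" for \<zeta>
      using that R nrm[of \<zeta>] unfolding shift p0eq by (simp add: dist_norm R_def)
    have in1: "(t, x + \<zeta> *s ?v, e) \<in> cball p0 R0" if "norm \<zeta> \<le> R" for \<zeta>
    proof -
      have "dist p0 (p + (0, \<zeta> *s ?v, 0)) \<le> dist p0 p + dist p (p + (0, \<zeta> *s ?v, 0))" by (rule dist_triangle)
      also have "dist p (p + (0, \<zeta> *s ?v, 0)) = norm \<zeta>" using nrm[of \<zeta>] by (simp add: dist_norm)
      finally show ?thesis using that p(2) unfolding shift peq[symmetric] by (simp add: R_def dist_commute)
    qed
    define h where "h = (\<lambda>\<zeta>. f (t, x + \<zeta> *s ?v, e) $ i - f (t0, x0 + \<zeta> *s ?v, e0) $ i)"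
    have dh: "(h has_field_derivative DX f t (x + \<zeta> *s ?v) e $ i $ j - DX f t0 (x0 + \<zeta> *s ?v) e0 $ i $ j) (at \<zeta>)"
      if "norm \<zeta> \<le> R" for \<zeta>
      unfolding h_def by (intro DERIV_diff DX_entry_derivative[OF f]) (use in0[OF that] in1[OF that] R0(2) in auto)
    have hol: "h holomorphic_on cball 0 R"
      unfolding holomorphic_on_def field_differentiable_def using dh has_field_derivative_at_within by (metis mem_cball_0)
    have bd: "norm (h \<zeta>) \<le> \<gamma> * R / 2" if "norm (0 - \<zeta>) = R" for \<zeta>
    proof -
      have z: "norm \<zeta> \<le> R" using that by simp
      have "dist (t, x + \<zeta> *s ?v, e) (t0, x0 + \<zeta> *s ?v, e0) = dist p p0"
        unfolding shift peq p0eq by (simp only: dist_add_cancel2)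
      then have "dist (f (t, x + \<zeta> *s ?v, e)) (f (t0, x0 + \<zeta> *s ?v, e0)) < \<gamma> * R / 2"
        using k(2)[OF in0[OF z] in1[OF z]] p(2) by simp
      moreover have "norm (h \<zeta>) \<le> dist (f (t, x + \<zeta> *s ?v, e)) (f (t0, x0 + \<zeta> *s ?v, e0))"
        unfolding h_def dist_norm vector_minus_component[symmetric] by (rule Finite_Cartesian_Product.norm_nth_le)
      ultimately show ?thesis by simp
    qed
    have "norm ((deriv ^^ 1) h 0) \<le> fact 1 * (\<gamma> * R / 2) / R ^ 1"
      by (rule Cauchy_inequality[OF holomorphic_on_subset[OF hol] holomorphic_on_imp_continuous_on[OF hol] R bd]) auto
    moreover have "deriv h 0 = DX f t x e $ i $ j - DX f t0 x0 e0 $ i $ j"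
      using DERIV_imp_deriv[OF dh[of 0]] R by simp
    ultimately have "norm (DX f t x e $ i $ j - DX f t0 x0 e0 $ i $ j) \<le> \<gamma> / 2" using R by simp
    then show "dist (case p of (t, x, e) \<Rightarrow> DX f t x e $ i $ j) (case p0 of (t, x, e) \<Rightarrow> DX f t x e $ i $ j) < \<gamma>"
      using \<gamma> by (simp add: peq p0eq dist_norm)
  qed
qed

lemma DX_continuous:
  assumes f: "analytic_field f D" and D: "open D"
  shows "continuous_on D (\<lambda>p. DX f (fst p) (fst (snd p)) (snd (snd p)))"
proof -
  have "continuous_on D (\<lambda>p. \<chi> i j. DX f (fst p) (fst (snd p)) (snd (snd p)) $ i $ j)"
    using DX_entry_continuous[OF assms] by (intro continuous_on_vec_lambda) (simp add: case_prod_unfold)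
  then show ?thesis by (simp add: vec_lambda_eta)
qed

lemma compact_uniform_neighborhood:
  fixes g :: "'a::metric_space \<Rightarrow> 'b::metric_space"
  assumes g: "continuous_on D g" and D: "open D" and K: "compact K" "K \<subseteq> D" and \<gamma>: "\<gamma> > 0"
  obtains r where "r > 0" "\<And>k p. k \<in> K \<Longrightarrow> dist p k < r \<Longrightarrow> p \<in> D \<and> dist (g p) (g k) < \<gamma>"
proof -
  have "\<exists>s>0. \<forall>p. dist p k < s \<longrightarrow> p \<in> D \<and> dist (g p) (g k) < \<gamma> / 2" if k: "k \<in> D" for k
  proof -
    obtain s1 where s1: "s1 > 0" "\<And>p. dist p k < s1 \<Longrightarrow> p \<in> D"
      using D k unfolding open_dist by blast
    obtain s2 where s2: "s2 > 0" "\<And>p. p \<in> D \<Longrightarrow> dist p k < s2 \<Longrightarrow> dist (g p) (g k) < \<gamma> / 2"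
      using g k \<gamma> unfolding continuous_on_iff by (meson half_gt_zero)
    show ?thesis using s1 s2 by (intro exI[of _ "min s1 s2"]) auto
  qed
  then obtain s where s: "\<And>k. k \<in> D \<Longrightarrow> s k > 0"
    "\<And>k p. k \<in> D \<Longrightarrow> dist p k < s k \<Longrightarrow> p \<in> D \<and> dist (g p) (g k) < \<gamma> / 2" by metis
  have cover: "K \<subseteq> \<Union>((\<lambda>k. ball k (s k)) ` K)"
  proof
    fix k assume k: "k \<in> K"
    then have "k \<in> ball k (s k)" using s(1) K by auto
    with k show "k \<in> \<Union>((\<lambda>k. ball k (s k)) ` K)" by blast
  qed
  obtain r where r: "r > 0" "\<And>x. x \<in> K \<Longrightarrow> \<exists>G\<in>(\<lambda>k. ball k (s k)) ` K. ball x r \<subseteq> G"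
    using Heine_Borel_lemma[OF K(1) cover] by (metis (no_types, lifting) imageE open_ball)
  have "p \<in> D \<and> dist (g p) (g k) < \<gamma>" if k: "k \<in> K" "dist p k < r" for k p
  proof -
    obtain l where l: "l \<in> K" "ball k r \<subseteq> ball l (s l)" using r(2)[OF k(1)] by blast
    have "k \<in> ball k r" "p \<in> ball k r" using r(1) k by (auto simp: dist_commute)
    then have "k \<in> ball l (s l)" "p \<in> ball l (s l)" using l(2) by blast+
    then have "dist k l < s l" "dist p l < s l" by (auto simp: dist_commute)
    then have "p \<in> D" "dist (g p) (g l) < \<gamma> / 2" "dist (g k) (g l) < \<gamma> / 2" using s(2) l K by blast+
    then show ?thesis using dist_triangle2[of "g p" "g k" "g l"] by linarith
  qed
  with r(1) that show thesis by blast
qed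

lemma cvec_matrix:
  fixes M :: "complex^2^2"
  assumes "\<And>i j. M $ i $ j = of_real (B $ i $ j)"
  shows "M *v cvec y = cvec (B *v y)"
  by (simp add: vec_eq_iff matrix_vector_mult_def assms)

definition real_matrix :: "complex^2^2 \<Rightarrow> real^2^2" where
  "real_matrix M = (\<chi> i j. Re (M $ i $ j))"

text \<open>
  By compactness \<open>DX\<close> is uniformly close to its value on the curve, and the mean
  value inequality turns this into a Lipschitz bound for \<open>f - A\<close>.
\<close>
lemma linear_tube_exists:
  fixes \<psi> :: "real \<Rightarrow> real^2"
  assumes f: "analytic_field f D" and D: "open D"
    and real_values: "\<And>t x e. (of_real t, cvec x, of_real e) \<in> D \<Longrightarrow> \<exists>y. f (of_real t, cvec x, of_real e) = cvec y"
    and \<psi>: "continuous_on {c..d} \<psi>" "\<And>t. t \<in> {c..d} \<Longrightarrow> (of_real t, cvec (\<psi> t), 0) \<in> D"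
    and A: "\<And>t i j. t \<in> {c..d} \<Longrightarrow> DX f (of_real t) (cvec (\<psi> t)) 0 $ i $ j = of_real (A t $ i $ j)"
    and \<rho>: "\<rho> > 0"
  obtains r where "r > 0" "linear_tube f D \<psi> A c d \<rho> r"
proof -
  define K where "K = (\<lambda>t. (complex_of_real t, cvec (\<psi> t), 0::complex)) ` {c..d}"
  have K: "compact K" unfolding K_def by (intro compact_continuous_image continuous_intros \<psi>) auto
  have KD: "K \<subseteq> D" using \<psi>(2) by (auto simp: K_def)
  obtain r where r: "r > 0" and nb: "\<And>k p. k \<in> K \<Longrightarrow> dist p k < r \<Longrightarrow> p \<in> D \<and>
      dist (DX f (fst p) (fst (snd p)) (snd (snd p))) (DX f (fst k) (fst (snd k)) (snd (snd k))) < \<rho> / 4"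
    using compact_uniform_neighborhood[OF DX_continuous[OF f D] D K KD, of "\<rho> / 4"] \<rho> by auto
  have "linear_tube f D \<psi> A c d \<rho> (r / 2)"
    unfolding linear_tube_def
  proof (intro ballI allI impI; elim conjE)
    fix t x y e assume t: "t \<in> {c..d}" and xy: "norm (x - \<psi> t) < r / 2" "norm (y - \<psi> t) < r / 2" "\<bar>e\<bar> < r / 2"
    let ?M = "DX f (of_real t) (cvec (\<psi> t)) 0"
    let ?B = "ball (cvec (\<psi> t)) (r / 2)"
    have in_nb: "(of_real t, z, of_real e) \<in> D \<and> dist (DX f (of_real t) z (of_real e)) ?M < \<rho> / 4" if z: "z \<in> ?B" for z
    proof -
      have "dist (complex_of_real t, z, complex_of_real e) (of_real t, cvec (\<psi> t), 0) \<le> dist z (cvec (\<psi> t)) + \<bar>e\<bar>"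
        unfolding dist_Pair_Pair
        using sqrt_sum_squares_le_sum_abs[of "dist z (cvec (\<psi> t))" e] by simp
      also have "\<dots> < r" using z xy by (simp add: dist_commute)
      finally show ?thesis using nb[of "(of_real t, cvec (\<psi> t), 0)"] t by (force simp: K_def)
    qed
    have xB: "cvec x \<in> ?B" "cvec y \<in> ?B" using xy by (auto simp: dist_norm norm_minus_commute simp flip: cvec_diff)
    have "norm ((f (of_real t, cvec x, of_real e) - ?M *v cvec x) - (f (of_real t, cvec y, of_real e) - ?M *v cvec y))
        \<le> \<rho> * norm (cvec x - cvec y)"
    proof (rule differentiable_bound[where S = ?B and f' = "\<lambda>z v. (DX f (of_real t) z (of_real e) - ?M) *v v"])
      fix z assume z: "z \<in> ?B"
      have zD: "(of_real t, z, of_real e) \<in> D" using in_nb[OF z] by blast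
      have "((\<lambda>z. f (of_real t, z, of_real e)) has_derivative (\<lambda>v. DX f (of_real t) z (of_real e) *v v)) (at z)"
        by (rule analytic_fieldD[OF f zD])
      then have "((\<lambda>z. f (of_real t, z, of_real e) - ?M *v z) has_derivative
          (\<lambda>v. DX f (of_real t) z (of_real e) *v v - ?M *v v)) (at z)"
        by (intro has_derivative_diff bounded_linear_imp_has_derivative matrix_vector_mul_bounded_linear)
      then show "((\<lambda>z. f (of_real t, z, of_real e) - ?M *v z) has_derivative
          (\<lambda>v. (DX f (of_real t) z (of_real e) - ?M) *v v)) (at z within ?B)"
        by (simp add: matrix_vector_mult_diff_rdistrib has_derivative_at_withinI)
      show "onorm (\<lambda>v. (DX f (of_real t) z (of_real e) - ?M) *v v) \<le> \<rho>"
      proof (rule onorm_le)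
        fix v
        have "norm ((DX f (of_real t) z (of_real e) - ?M) *v v) \<le> 4 * norm (DX f (of_real t) z (of_real e) - ?M) * norm v"
          by (rule norm_matrix_vector_le_complex)
        also have "\<dots> \<le> \<rho> * norm v"
          using in_nb[OF z] by (intro mult_right_mono) (auto simp: dist_norm)
        finally show "norm ((DX f (of_real t) z (of_real e) - ?M) *v v) \<le> \<rho> * norm v" .
      qed
    qed (use xB in auto)
    moreover obtain fx fy where fxy: "f (of_real t, cvec x, of_real e) = cvec fx" "f (of_real t, cvec y, of_real e) = cvec fy"
      using real_values in_nb[OF xB(1)] in_nb[OF xB(2)] by metis
    moreover have "real_field f t x e = fx" "real_field f t y e = fy"
      by (simp_all add: real_field_def fxy vec_eq_iff)
    moreover have "?M *v cvec z = cvec (A t *v z)" for z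
      by (rule cvec_matrix) (rule A[OF t])
    ultimately have "norm (real_field f t x e - real_field f t y e - A t *v (x - y)) \<le> \<rho> * norm (x - y)"
      by (simp add: matrix_vector_mult_diff_distrib algebra_simps flip: cvec_diff)
    with in_nb[OF xB(1)] show "(of_real t, cvec x, of_real e) \<in> D \<and>
        norm (real_field f t x e - real_field f t y e - A t *v (x - y)) \<le> \<rho> * norm (x - y)" by blast
  qed
  with r that show thesis by (meson half_gt_zero)
qed

text \<open>
  Along a real line the imaginary part of \<open>f\<close> vanishes, hence so does its derivative.
\<close>
lemma DX_real:
  assumes f: "analytic_field f D" and D: "open D"
    and real_values: "\<And>t x e. (of_real t, cvec x, of_real e) \<in> D \<Longrightarrow> \<exists>y. f (of_real t, cvec x, of_real e) = cvec y"
    and p: "(of_real t, cvec x, of_real e) \<in> D"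
  shows "DX f (of_real t) (cvec x) (of_real e) $ i $ j = of_real (real_matrix (DX f (of_real t) (cvec x) (of_real e)) $ i $ j)"
proof -
  let ?v = "axis j 1 :: complex^2" and ?w = "axis j 1 :: real^2"
  let ?g = "\<lambda>h::real. f (of_real t, cvec x + of_real h *s ?v, of_real e) $ i"
  let ?m = "DX f (of_real t) (cvec x) (of_real e) $ i $ j"
  have shift: "cvec x + of_real h *s ?v = cvec (x + h *\<^sub>R ?w)" for h
    by (simp add: vec_eq_iff axis_def)
  have "((\<lambda>\<zeta>. f (of_real t, cvec x + \<zeta> *s ?v, of_real e) $ i) has_field_derivative ?m) (at 0)"
    using DX_entry_derivative[OF f, of "of_real t" "cvec x" 0 j "of_real e" i] p by simp
  then have "((\<lambda>\<zeta>. f (of_real t, cvec x + \<zeta> *s ?v, of_real e) $ i) has_field_derivative ?m) (at (of_real 0))" by simp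
  then have g: "(?g has_vector_derivative ?m) (at 0)"
    by (rule has_vector_derivative_real_field)
  then have Im: "((\<lambda>h. Im (?g h)) has_real_derivative Im ?m) (at 0)"
    unfolding has_real_derivative_iff_has_vector_derivative by (rule bounded_linear.has_vector_derivative[OF bounded_linear_Im])
  have op: "open {h::real. (complex_of_real t, cvec (x + h *\<^sub>R ?w), complex_of_real e) \<in> D}" (is "open ?U")
  proof -
    have "open ((\<lambda>h::real. (complex_of_real t, cvec (x + h *\<^sub>R ?w), complex_of_real e)) -` D)"
      by (intro open_vimage D continuous_intros)
    then show ?thesis by (simp add: vimage_def)
  qed
  have "((\<lambda>h. 0) has_real_derivative Im ?m) (at 0)"
  proof (rule has_field_derivative_transform_within_open[OF Im op])
    show "0 \<in> ?U" using p by simp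
    fix h assume "h \<in> ?U"
    then obtain y where "f (of_real t, cvec (x + h *\<^sub>R ?w), of_real e) = cvec y" using real_values by blast
    then show "Im (?g h) = 0" unfolding shift by simp
  qed
  then have "Im ?m = 0" using DERIV_const DERIV_unique by blast
  then show ?thesis by (simp add: real_matrix_def complex_eq_iff)
qed

lemma eigenvalue_iff_characteristic:
  fixes M :: "complex^2^2"
  shows "z \<in> eigenvalues M \<longleftrightarrow> (M$1$1 - z) * (M$2$2 - z) = M$1$2 * M$2$1"
proof -
  have ev: "M *v v = z *s v \<longleftrightarrow> M$1$1 * v$1 + M$1$2 * v$2 = z * v$1 \<and> M$2$1 * v$1 + M$2$2 * v$2 = z * v$2" for v
    by (simp add: vec_eq_iff forall_2 matrix_vector_mult_def sum_2)
  show ?thesis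
  proof
    assume "z \<in> eigenvalues M"
    then obtain v where v: "v \<noteq> 0" "M *v v = z *s v" by (auto simp: eigenvalues_def)
    from v(2)[unfolded ev] have e1: "(M$1$1 - z) * v$1 = - M$1$2 * v$2" and e2: "(M$2$2 - z) * v$2 = - M$2$1 * v$1"
      by (auto simp: algebra_simps add_eq_0_iff eq_neg_iff_add_eq_0)
    have "v$1 \<noteq> 0 \<or> v$2 \<noteq> 0" using v(1) by (auto simp: vec_eq_iff forall_2)
    then show "(M$1$1 - z) * (M$2$2 - z) = M$1$2 * M$2$1"
    proof
      assume n: "v$1 \<noteq> 0"
      have "(M$1$1 - z) * (M$2$2 - z) * v$1 = (M$2$2 - z) * ((M$1$1 - z) * v$1)" by (simp only: mult_ac)
      also have "\<dots> = - M$1$2 * ((M$2$2 - z) * v$2)" unfolding e1 by (simp only: mult_ac)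
      also have "\<dots> = M$1$2 * M$2$1 * v$1" unfolding e2 by simp
      finally show ?thesis using n by simp
    next
      assume n: "v$2 \<noteq> 0"
      have "(M$1$1 - z) * (M$2$2 - z) * v$2 = (M$1$1 - z) * ((M$2$2 - z) * v$2)" by (simp only: mult_ac)
      also have "\<dots> = - M$2$1 * ((M$1$1 - z) * v$1)" unfolding e2 by (simp only: mult_ac)
      also have "\<dots> = M$1$2 * M$2$1 * v$2" unfolding e1 by simp
      finally show ?thesis using n by simp
    qed
  next
    assume ch: "(M$1$1 - z) * (M$2$2 - z) = M$1$2 * M$2$1"
    have "\<exists>v. v \<noteq> 0 \<and> M *v v = z *s v"
    proof (cases "M$1$2 = 0 \<and> M$1$1 \<noteq> z")
      case False
      define v :: "complex^2" where "v = (if M$1$2 \<noteq> 0 then vector [M$1$2, z - M$1$1]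
        else if M$2$1 = 0 \<and> M$2$2 = z then vector [1, 0] else vector [z - M$2$2, M$2$1])"
      have "v \<noteq> 0"
        by (auto simp: v_def vec_eq_iff forall_2)
      moreover have "M *v v = z *s v"
        unfolding ev using ch False by (auto simp: v_def algebra_simps)
      ultimately show ?thesis by blast
    next
      case True
      then have "M$2$2 = z" using ch by simp
      then have "M *v (vector [0, 1]) = z *s vector [0, 1]" unfolding ev using True by simp
      moreover have "(vector [0, 1] :: complex^2) \<noteq> 0" by (auto simp: vec_eq_iff forall_2)
      ultimately show ?thesis by blast
    qed
    then show "z \<in> eigenvalues M" by (auto simp: eigenvalues_def)
  qed
qed

text \<open>
  The set \<open>{l, m}\<close> does not record multiplicities. They are recovered from the
  symmetry \<open>z \<mapsto> trace - z\<close> of the characteristic polynomial: it maps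
  \<open>l\<close> to \<open>m\<close>, or else fixes \<open>l\<close>, which is then a double
  root.
\<close>
lemma eigenvalue_sum_discriminant:
  fixes M :: "complex^2^2"
  assumes "{l, m} = eigenvalues M"
  shows "l + m = M$1$1 + M$2$2" "((M$1$1 - M$2$2) / 2)\<^sup>2 + M$1$2 * M$2$1 = ((l - m) / 2)\<^sup>2"
proof -
  have l: "(M$1$1 - l) * (M$2$2 - l) = M$1$2 * M$2$1"
    using assms by (simp flip: eigenvalue_iff_characteristic) blast
  have "(M$1$1 - (M$1$1 + M$2$2 - l)) * (M$2$2 - (M$1$1 + M$2$2 - l)) = M$1$2 * M$2$1"
    using l by (simp add: algebra_simps)
  then have "M$1$1 + M$2$2 - l \<in> {l, m}"
    unfolding assms by (simp add: eigenvalue_iff_characteristic)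
  moreover have "m = l" if "M$1$1 + M$2$2 - l = l"
  proof -
    have m: "(M$1$1 - m) * (M$2$2 - m) = M$1$2 * M$2$1"
      using assms by (simp flip: eigenvalue_iff_characteristic) blast
    have M22: "M$2$2 = 2 * l - M$1$1" using that by (simp add: algebra_simps)
    have "(m - l)\<^sup>2 = (M$1$1 - m) * (M$2$2 - m) - (M$1$1 - l) * (M$2$2 - l)"
      unfolding M22 by (simp add: power2_eq_square algebra_simps)
    then have "(m - l)\<^sup>2 = 0" unfolding l m by simp
    then show ?thesis by simp
  qed
  ultimately show s: "l + m = M$1$1 + M$2$2" by (auto simp: algebra_simps)
  have M22: "M$2$2 = l + m - M$1$1" using s by (simp add: algebra_simps)
  show "((M$1$1 - M$2$2) / 2)\<^sup>2 + M$1$2 * M$2$1 = ((l - m) / 2)\<^sup>2"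
    unfolding l[symmetric] M22 by (simp add: power2_eq_square field_simps)
qed

text \<open>
  The discriminant \<open>((l - m) / 2)\<^sup>2\<close> is real. For a focus this forces \<open>Re
  l = Re m\<close>.
\<close>
lemma rates_eq_eigenvalues:
  fixes M :: "complex^2^2" and B :: "real^2^2"
  assumes ev: "{l, m} = eigenvalues M" and real: "\<And>i j. M $ i $ j = of_real (B $ i $ j)"
    and cases: "Im l < 0 \<and> 0 < Im m \<or> Im l = 0 \<and> Im m = 0 \<and> Re l \<le> Re m"
  shows "slow_rate B = Re l" "fast_rate B = Re m"
    "discr B \<le> 0 \<longleftrightarrow> Im m > 0 \<or> l = m"
proof -
  have s: "l + m = of_real (B$1$1 + B$2$2)" and d: "((l - m) / 2)\<^sup>2 = of_real (discr B)"
    using eigenvalue_sum_discriminant[OF ev] by (simp_all add: real discr_def)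
  have tr: "half_trace B = (Re l + Re m) / 2" using arg_cong[OF s, of Re] by (simp add: half_trace_def)
  have im: "Im l + Im m = 0" using arg_cong[OF s, of Im] by simp
  have re2: "discr B = ((Re l - Re m) / 2)\<^sup>2 - ((Im l - Im m) / 2)\<^sup>2"
    using arg_cong[OF d, of Re] by (simp add: power2_eq_square)
  have im2: "(Re l - Re m) * (Im l - Im m) = 0"
    using arg_cong[OF d, of Im] by (auto simp: power2_eq_square)
  from cases have "slow_rate B = Re l \<and> fast_rate B = Re m \<and> (discr B \<le> 0 \<longleftrightarrow> Im m > 0 \<or> l = m)"
  proof
    assume i: "Im l < 0 \<and> 0 < Im m"
    then have r: "Re l = Re m" using im2 by auto
    have "discr B \<le> 0" unfolding re2 r by simp
    then show ?thesis using i r by (simp add: slow_rate_def fast_rate_def tr max_def)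
  next
    assume i: "Im l = 0 \<and> Im m = 0 \<and> Re l \<le> Re m"
    have dd: "discr B = ((Re m - Re l) / 2)\<^sup>2" unfolding re2 using i by (simp add: power2_eq_square algebra_simps)
    then have sq: "sqrt (max 0 (discr B)) = (Re m - Re l) / 2" using i by simp
    have "discr B \<le> 0 \<longleftrightarrow> l = m" unfolding dd using i by (auto simp: complex_eq_iff)
    then show ?thesis using i by (simp add: slow_rate_def fast_rate_def tr sq field_simps)
  qed
  then show "slow_rate B = Re l" "fast_rate B = Re m" "discr B \<le> 0 \<longleftrightarrow> Im m > 0 \<or> l = m" by blast+
qed

section \<open>The ultrapower\<close>

lemma ultra_properties:
  shows ultra_ne_bot: "ultra \<noteq> bot" and ultra_le: "ultra \<le> sequentially"
    and ultra_not: "\<not> eventually P ultra \<longleftrightarrow> eventually (\<lambda>n. \<not> P n) ultra"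
proof -
  have u: "ultra \<noteq> bot" "ultra \<le> sequentially" "\<And>P. eventually P ultra \<or> eventually (\<lambda>n. \<not> P n) ultra"
    using free_ultrafilter_ultra unfolding free_ultrafilter_def by auto
  then show "ultra \<noteq> bot" "ultra \<le> sequentially" by auto
  have "False" if "eventually P ultra" "eventually (\<lambda>n. \<not> P n) ultra"
  proof -
    have "eventually (\<lambda>n. False) ultra" using that by eventually_elim simp
    then show False using u(1) by (simp add: trivial_limit_def)
  qed
  then show "\<not> eventually P ultra \<longleftrightarrow> eventually (\<lambda>n. \<not> P n) ultra" using u(3)[of P] by blast
qed

lemma ultra_ex: "eventually P ultra \<Longrightarrow> \<exists>n. P n"
  using ultra_ne_bot eventually_happens' by blast

lemma star_exhaust: obtains x where "t = abs_star x"
  by (rule star.abs_induct[of "\<lambda>t. (\<forall>x. t = abs_star x \<longrightarrow> thesis) \<longrightarrow> thesis" t, THEN mp]) (auto intro: that)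

lemma infinitesimal_abs: "infinitesimal (abs_star x) \<longleftrightarrow> (\<forall>r>0. eventually (\<lambda>n. norm (x n) < r) ultra)"
  by (simp add: infinitesimal_def starP.abs_eq)

lemma approx_abs: "abs_star x \<simeq> abs_star y \<longleftrightarrow> (\<forall>r>0. eventually (\<lambda>n. norm (x n - y n) < r) ultra)"
  by (simp add: approx_def starfun2.abs_eq infinitesimal_abs)

lemma S_interior_abs:
  "abs_star u \<in> S_interior t1 t2 \<longleftrightarrow> (\<exists>R. eventually (\<lambda>n. \<bar>u n\<bar> \<le> R) ultra) \<and>
    eventually (\<lambda>n. t1 < ereal (u n) \<and> ereal (u n) < t2) ultra \<and>
    (\<forall>r. ereal r = t1 \<or> ereal r = t2 \<longrightarrow> (\<exists>\<delta>>0. eventually (\<lambda>n. \<delta> \<le> \<bar>u n - r\<bar>) ultra))"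
  unfolding S_interior_def mem_Collect_eq limited_def
  by (simp add: starP.abs_eq star_of.abs_eq approx_abs ultra_not not_less)

text \<open>
  Being infinitely close at every point of the S-interior is uniform convergence on compact
  subintervals, in the sense of the ultrafilter. If uniformity failed on \<open>[c, d]\<close>,
  the bad points would represent a point of the S-interior where infinite closeness fails.
\<close>
lemma goes_along_iff:
  "goes_along \<phi> Dt t1 t2 (abs_star X) \<longleftrightarrow> t1 < t2 \<and>
     (\<forall>s. t1 < ereal s \<and> ereal s < t2 \<longrightarrow> of_real s \<in> Dt) \<and>
     (\<forall>c d r. t1 < ereal c \<and> c \<le> d \<and> ereal d < t2 \<and> 0 < r \<longrightarrow>
        eventually (\<lambda>n. \<forall>s\<in>{c..d}. s \<in> fst (X n) \<and> norm (cvec (snd (X n) s) - \<phi> (of_real s)) < r) ultra)"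
  (is "_ \<longleftrightarrow> _ \<and> _ \<and> ?U")
proof -
  let ?Q = "\<lambda>n r s. s \<in> fst (X n) \<and> norm (cvec (snd (X n) s) - \<phi> (of_real s)) < r"
  have at: "(starP2 (\<lambda>Y s. s \<in> fst Y) (abs_star X) (abs_star u) \<and>
        starfun2 (\<lambda>Y s. cvec (snd Y s)) (abs_star X) (abs_star u) \<simeq> starfun (\<lambda>s. \<phi> (of_real s)) (abs_star u))
      \<longleftrightarrow> (\<forall>r>0. eventually (\<lambda>n. ?Q n r (u n)) ultra)" for u
    unfolding starP2.abs_eq starfun2.abs_eq starfun.abs_eq approx_abs eventually_conj_iff
    by (meson zero_less_one)
  have "(\<forall>t\<in>S_interior t1 t2. starP2 (\<lambda>Y s. s \<in> fst Y) (abs_star X) t \<and>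
        starfun2 (\<lambda>Y s. cvec (snd Y s)) (abs_star X) t \<simeq> starfun (\<lambda>s. \<phi> (of_real s)) t) \<longleftrightarrow> ?U"
    if t12: "t1 < t2"
  proof
    assume L: "\<forall>t\<in>S_interior t1 t2. starP2 (\<lambda>Y s. s \<in> fst Y) (abs_star X) t \<and>
        starfun2 (\<lambda>Y s. cvec (snd Y s)) (abs_star X) t \<simeq> starfun (\<lambda>s. \<phi> (of_real s)) t"
    show ?U
    proof (intro allI impI, rule ccontr)
      fix c d r assume cd: "t1 < ereal c \<and> c \<le> d \<and> ereal d < t2 \<and> 0 < (r::real)"
        and "\<not> eventually (\<lambda>n. \<forall>s\<in>{c..d}. ?Q n r s) ultra"
      then have bad: "eventually (\<lambda>n. \<exists>s\<in>{c..d}. \<not> ?Q n r s) ultra" by (simp add: ultra_not)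
      define B where "B = (\<lambda>n s. s \<in> {c..d} \<and> \<not> ?Q n r s)"
      define u where "u = (\<lambda>n. if \<exists>s. B n s then SOME s. B n s else c)"
      have u: "B n (u n)" if "\<exists>s. B n s" for n
        using someI_ex[OF that] that by (simp add: u_def)
      have ucd: "c \<le> u n" "u n \<le> d" for n
      proof -
        have "u n \<in> {c..d}"
          using u[of n] cd by (cases "\<exists>s. B n s") (auto simp: B_def u_def)
        then show "c \<le> u n" "u n \<le> d" by auto
      qed
      have "abs_star u \<in> S_interior t1 t2"
        unfolding S_interior_abs
      proof (intro conjI allI impI)
        have "\<bar>u n\<bar> \<le> max \<bar>c\<bar> \<bar>d\<bar>" for n using ucd[of n] by auto
        then show "\<exists>R. eventually (\<lambda>n. \<bar>u n\<bar> \<le> R) ultra"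
          by (intro exI[of _ "max \<bar>c\<bar> \<bar>d\<bar>"] always_eventually allI)
        have "t1 < ereal (u n) \<and> ereal (u n) < t2" for n
          using ucd[of n] cd by (meson ereal_less_eq(3) less_le_trans le_less_trans)
        then show "eventually (\<lambda>n. t1 < ereal (u n) \<and> ereal (u n) < t2) ultra" by simp
        fix x assume x: "ereal x = t1 \<or> ereal x = t2"
        then have "x < c \<or> d < x" using cd by auto
        then show "\<exists>\<delta>>0. eventually (\<lambda>n. \<delta> \<le> \<bar>u n - x\<bar>) ultra"
        proof
          assume "x < c"
          moreover have "c - x \<le> \<bar>u n - x\<bar>" for n using ucd[of n] by linarith
          ultimately show ?thesis by (intro exI[of _ "c - x"]) simp
        next
          assume "d < x"
          moreover have "x - d \<le> \<bar>u n - x\<bar>" for n using ucd[of n] by linarith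
          ultimately show ?thesis by (intro exI[of _ "x - d"]) simp
        qed
      qed
      with L have "\<forall>r>0. eventually (\<lambda>n. ?Q n r (u n)) ultra" unfolding at[symmetric] by blast
      then have "eventually (\<lambda>n. ?Q n r (u n)) ultra" using cd by blast
      moreover have "eventually (\<lambda>n. \<not> ?Q n r (u n)) ultra"
        using bad
      proof eventually_elim
        case (elim n)
        then have "\<exists>s. B n s" unfolding B_def by blast
        from u[OF this] show ?case unfolding B_def by blast
      qed
      ultimately show False using ultra_not[of "\<lambda>n. ?Q n r (u n)"] by blast
    qed
  next
    assume U: ?U
    show "\<forall>t\<in>S_interior t1 t2. starP2 (\<lambda>Y s. s \<in> fst Y) (abs_star X) t \<and>
        starfun2 (\<lambda>Y s. cvec (snd Y s)) (abs_star X) t \<simeq> starfun (\<lambda>s. \<phi> (of_real s)) t"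
    proof
      fix t assume t: "t \<in> S_interior t1 t2"
      obtain u where u: "t = abs_star u" by (rule star_exhaust)
      from t obtain R where R: "eventually (\<lambda>n. \<bar>u n\<bar> \<le> R) ultra"
        and btw: "eventually (\<lambda>n. t1 < ereal (u n) \<and> ereal (u n) < t2) ultra"
        and far: "\<And>r. ereal r = t1 \<or> ereal r = t2 \<Longrightarrow> \<exists>\<delta>>0. eventually (\<lambda>n. \<delta> \<le> \<bar>u n - r\<bar>) ultra"
        unfolding u S_interior_abs by blast
      have "\<exists>c. t1 < ereal c \<and> eventually (\<lambda>n. c \<le> u n) ultra"
      proof (cases t1)
        case (real r1)
        then obtain \<delta> where \<delta>: "\<delta> > 0" "eventually (\<lambda>n. \<delta> \<le> \<bar>u n - r1\<bar>) ultra" using far by blast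
        from \<delta>(2) btw have "eventually (\<lambda>n. r1 + \<delta> \<le> u n) ultra"
          by eventually_elim (simp add: real)
        then show ?thesis using \<delta>(1) by (intro exI[of _ "r1 + \<delta>"]) (simp add: real)
      next
        case MInf
        from R have "eventually (\<lambda>n. - R \<le> u n) ultra" by eventually_elim simp
        then show ?thesis by (intro exI[of _ "- R"]) (simp add: MInf)
      qed (use t12 in auto)
      then obtain c where c: "t1 < ereal c" "eventually (\<lambda>n. c \<le> u n) ultra" by blast
      have "\<exists>d. ereal d < t2 \<and> eventually (\<lambda>n. u n \<le> d) ultra"
      proof (cases t2)
        case (real r2)
        then obtain \<delta> where \<delta>: "\<delta> > 0" "eventually (\<lambda>n. \<delta> \<le> \<bar>u n - r2\<bar>) ultra" using far by blast
        from \<delta>(2) btw have "eventually (\<lambda>n. u n \<le> r2 - \<delta>) ultra"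
          by eventually_elim (simp add: real)
        then show ?thesis using \<delta>(1) by (intro exI[of _ "r2 - \<delta>"]) (simp add: real)
      next
        case PInf
        from R have "eventually (\<lambda>n. u n \<le> R) ultra" by eventually_elim simp
        then show ?thesis by (intro exI[of _ R]) (simp add: PInf)
      qed (use t12 in auto)
      then obtain d where d: "ereal d < t2" "eventually (\<lambda>n. u n \<le> d) ultra" by blast
      have "eventually (\<lambda>n. c \<le> u n \<and> u n \<le> d) ultra" using c(2) d(2) by eventually_elim simp
      then have cd: "c \<le> d" using ultra_ex by fastforce
      have "eventually (\<lambda>n. ?Q n r (u n)) ultra" if "r > 0" for r
      proof -
        have "eventually (\<lambda>n. \<forall>s\<in>{c..d}. ?Q n r s) ultra" using U c(1) d(1) cd that by blast
        with c(2) d(2) show ?thesis by eventually_elim simp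
      qed
      then show "starP2 (\<lambda>Y s. s \<in> fst Y) (abs_star X) t \<and>
        starfun2 (\<lambda>Y s. cvec (snd Y s)) (abs_star X) t \<simeq> starfun (\<lambda>s. \<phi> (of_real s)) t"
        unfolding u at by blast
    qed
  qed
  then show ?thesis unfolding goes_along_def by blast
qed

text \<open>
  This replaces the permanence principle: a property that holds for every standard
  \<open>k\<close> holds for some infinitely large one.
\<close>
lemma ultra_diagonal:
  assumes "\<And>k. eventually (\<lambda>n. P n k) ultra"
  obtains \<kappa> :: "nat \<Rightarrow> nat" where "\<And>K. eventually (\<lambda>n. K \<le> \<kappa> n) ultra" "eventually (\<lambda>n. P n (\<kappa> n)) ultra"
proof -
  define M where "M = (\<lambda>n. {k. k \<le> n \<and> P n k})"
  define \<kappa> where "\<kappa> = (\<lambda>n. Max (M n))"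
  have fin: "finite (M n)" for n unfolding M_def by (rule finite_subset[of _ "{..n}"]) auto
  have mem: "eventually (\<lambda>n. K \<in> M n) ultra" for K
  proof -
    have "eventually (\<lambda>n. K \<le> n) ultra"
      using ultra_le eventually_ge_at_top[of K] by (rule filter_leD)
    with assms[of K] show ?thesis by eventually_elim (simp add: M_def)
  qed
  show thesis
  proof
    fix K show "eventually (\<lambda>n. K \<le> \<kappa> n) ultra"
      using mem[of K] by eventually_elim (simp add: \<kappa>_def fin)
  next
    show "eventually (\<lambda>n. P n (\<kappa> n)) ultra"
      using mem[of 0]
    proof eventually_elim
      case (elim n)
      then have "\<kappa> n \<in> M n" unfolding \<kappa>_def by (intro Max_in fin) auto
      then show ?case by (simp add: M_def)
    qed
  qed
qed

section \<open>Entry and exit times of trajectories\<close>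

text \<open>
  The hypotheses, with \<open>\<epsilon>\<close> and the big canard given by representing
  sequences.
\<close>
locale canard_problem =
  fixes f :: field and D :: "(complex \<times> (complex^2) \<times> complex) set" and \<phi> :: "complex \<Rightarrow> complex^2"
    and Dt :: "complex set" and tm tM :: ereal and a b :: real and lam mu :: "complex \<Rightarrow> complex"
    and en :: "nat \<Rightarrow> real" and Xc :: "nat \<Rightarrow> curve"
  assumes H1: "HFN1 f D" and H3: "HFN3 f D \<phi> Dt tm tM" and H4: "HFN4 f \<phi> Dt tm tM a b lam mu"
    and H5: "HFN5 Dt a b lam mu"
    and en_pos: "eventually (\<lambda>n. 0 < en n) ultra"
    and en_small: "r > 0 \<Longrightarrow> eventually (\<lambda>n. en n < r) ultra"
    and canard_sol: "eventually (\<lambda>n. solution f D (en n) (Xc n)) ultra"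
    and canard_along: "goes_along \<phi> Dt tm tM (abs_star Xc)"
begin

definition S :: "real set" where "S = {t. tm < ereal t \<and> ereal t < tM}"

definition \<psi> :: "real \<Rightarrow> real^2" where "\<psi> t = (\<chi> i. Re (\<phi> (of_real t) $ i))"

definition A :: "real \<Rightarrow> real^2^2" where "A t = real_matrix (DX f (of_real t) (\<phi> (of_real t)) 0)"

lemma analytic: "analytic_field f D" and openD: "open D"
  and real_values: "(of_real t, cvec x, of_real e) \<in> D \<Longrightarrow> \<exists>y. f (of_real t, cvec x, of_real e) = cvec y"
  using H1 unfolding HFN1_def domain_def by blast+

lemma S_Dt: "t \<in> S \<longleftrightarrow> of_real t \<in> Dt"
  using H3 unfolding HFN3_def S_def by blast

lemma S_interval: "x \<in> S \<Longrightarrow> y \<in> S \<Longrightarrow> x \<le> z \<Longrightarrow> z \<le> y \<Longrightarrow> z \<in> S"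
  unfolding S_def by (metis (no_types, lifting) dual_order.strict_trans1 dual_order.strict_trans2 ereal_less_eq(3) mem_Collect_eq)

lemma S_open_ball:
  assumes "t \<in> S"
  obtains h where "h > 0" "t - h \<in> S" "t + h \<in> S"
proof -
  obtain p where p: "tm < p" "p < ereal t" using assms dense unfolding S_def by blast
  then obtain p' where p': "p = ereal p'" by (cases p) auto
  obtain q where q: "ereal t < q" "q < tM" using assms dense unfolding S_def by blast
  then obtain q' where q': "q = ereal q'" by (cases q) auto
  define h where "h = min (t - p') (q' - t)"
  have tt: "tm < ereal t" "ereal t < tM" using assms by (simp_all add: S_def)
  have pq0: "p' < t" "t < q'" using p q by (simp_all add: p' q')
  have "p' \<in> S" using p pq0 less_trans[of "ereal p'" "ereal t" tM] tt by (simp add: p' S_def)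
  moreover have "q' \<in> S" using q pq0 less_trans[of tm "ereal t" "ereal q'"] tt by (simp add: q' S_def)
  ultimately have pq: "p' < t" "t < q'" "p' \<in> S" "q' \<in> S" using pq0 by auto
  then have "h > 0" "p' \<le> t - h" "t + h \<le> q'" by (auto simp: h_def)
  then show thesis using that[of h] S_interval[OF pq(3,4)] pq by auto
qed

lemma canard_close:
  assumes "c \<in> S" "d \<in> S" "r > 0"
  shows "eventually (\<lambda>n. \<forall>t\<in>{c..d}. t \<in> fst (Xc n) \<and> norm (cvec (snd (Xc n) t) - \<phi> (of_real t)) < r) ultra"
proof (cases "c \<le> d")
  case True
  then show ?thesis using canard_along assms unfolding goes_along_iff S_def by blast
qed auto

text \<open>
  The slow curve takes real values because it is the limit of the real canard.
\<close>
lemma phi_real: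
  assumes "t \<in> S"
  shows "\<phi> (of_real t) = cvec (\<psi> t)"
proof -
  have "\<bar>Im (\<phi> (of_real t) $ i)\<bar> < r" if r: "r > 0" for r i
  proof -
    obtain n where "norm (cvec (snd (Xc n) t) - \<phi> (of_real t)) < r"
      using ultra_ex[OF canard_close[OF assms assms r]] by auto
    moreover have "\<bar>Im (\<phi> (of_real t) $ i)\<bar> = \<bar>Im ((cvec (snd (Xc n) t) - \<phi> (of_real t)) $ i)\<bar>" by simp
    moreover have "\<dots> \<le> norm ((cvec (snd (Xc n) t) - \<phi> (of_real t)) $ i)" by (rule abs_Im_le_cmod)
    moreover have "\<dots> \<le> norm (cvec (snd (Xc n) t) - \<phi> (of_real t))" by (rule Finite_Cartesian_Product.norm_nth_le)
    ultimately show ?thesis by linarith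
  qed
  then have "Im (\<phi> (of_real t) $ i) = 0" for i
    by (metis abs_ge_zero abs_le_zero_iff dense_le less_eq_real_def linorder_not_less)
  then show ?thesis by (simp add: vec_eq_iff \<psi>_def complex_eq_iff)
qed

lemma canard_close_real:
  assumes "c \<in> S" "d \<in> S" "r > 0"
  shows "eventually (\<lambda>n. \<forall>t\<in>{c..d}. t \<in> fst (Xc n) \<and> norm (snd (Xc n) t - \<psi> t) < r) ultra"
  using canard_close[OF assms]
proof eventually_elim
  case (elim n)
  show ?case
  proof
    fix t assume t: "t \<in> {c..d}"
    then have tS: "t \<in> S" using S_interval[OF assms(1,2)] by auto
    have "t \<in> fst (Xc n)" "norm (cvec (snd (Xc n) t) - \<phi> (of_real t)) < r" using elim t by blast+
    then show "t \<in> fst (Xc n) \<and> norm (snd (Xc n) t - \<psi> t) < r"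
      by (simp add: phi_real[OF tS] flip: cvec_diff)
  qed
qed

lemma curve_in_D: "t \<in> S \<Longrightarrow> (of_real t, cvec (\<psi> t), 0) \<in> D"
  using H3 unfolding HFN3_def S_Dt[of t] by (metis S_Dt phi_real)

lemma A_entries: "t \<in> S \<Longrightarrow> DX f (of_real t) (cvec (\<psi> t)) 0 $ i $ j = of_real (A t $ i $ j)"
  using DX_real[OF analytic openD real_values, of t "\<psi> t" 0 i j] curve_in_D[of t]
  by (simp add: A_def phi_real)

lemma cont_phi: "continuous_on S (\<lambda>t. \<phi> (of_real t))"
proof -
  have "continuous_on Dt (\<lambda>z. \<phi> z $ i)" for i
    using H3 unfolding HFN3_def by (intro holomorphic_on_imp_continuous_on analytic_imp_holomorphic) blast
  then have "continuous_on S (\<lambda>t. \<phi> (of_real t) $ i)" for i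
    by (rule continuous_on_compose2) (auto simp: S_Dt intro!: continuous_intros)
  then have "continuous_on S (\<lambda>t. \<chi> i. \<phi> (of_real t) $ i)" by (intro continuous_on_vec_lambda)
  then show ?thesis by (simp add: vec_lambda_eta)
qed

lemma cont_psi: "continuous_on S \<psi>"
  unfolding \<psi>_def by (intro continuous_intros continuous_on_component cont_phi)

lemma cont_A: "continuous_on S A"
proof -
  have g: "continuous_on S (\<lambda>t. (complex_of_real t, \<phi> (of_real t), 0::complex))"
    by (intro continuous_intros cont_phi)
  have sub: "(\<lambda>t. (complex_of_real t, \<phi> (of_real t), 0::complex)) ` S \<subseteq> D"
    using curve_in_D by (auto simp: phi_real)
  have "continuous_on S (\<lambda>t. DX f (of_real t) (\<phi> (of_real t)) 0)"
    using continuous_on_compose2[OF DX_continuous[OF analytic openD] g sub] by simp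
  then show ?thesis unfolding A_def real_matrix_def
    by (intro continuous_intros continuous_on_component)
qed

lemma ab: "a < b" "a \<in> S" "b \<in> S"
proof -
  have "tm < ereal a" "a < b" "ereal b < tM" using H4 unfolding HFN4_def by blast+
  then show "a < b" "a \<in> S" "b \<in> S" unfolding S_def by (auto intro: less_trans[of _ "ereal a"] less_trans[of _ "ereal b"])
qed

lemma eigen_signs:
  assumes "t \<in> S"
  shows "t < a \<Longrightarrow> Re (mu (of_real t)) < 0" "t > a \<Longrightarrow> Re (lam (of_real t)) > 0"
    "t < b \<Longrightarrow> Im (lam (of_real t)) < 0 \<and> 0 < Im (mu (of_real t))"
    "t \<ge> b \<Longrightarrow> Im (lam (of_real t)) = 0 \<and> Im (mu (of_real t)) = 0"
    "lam (of_real t) = mu (of_real t) \<longleftrightarrow> t = b"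
    "{lam (of_real t), mu (of_real t)} = eigenvalues (DX f (of_real t) (\<phi> (of_real t)) 0)"
proof -
  have t: "tm < ereal t" "ereal t < tM" "of_real t \<in> Dt" using assms S_Dt[of t] unfolding S_def by auto
  show "t < a \<Longrightarrow> Re (mu (of_real t)) < 0" "t > a \<Longrightarrow> Re (lam (of_real t)) > 0"
    "t < b \<Longrightarrow> Im (lam (of_real t)) < 0 \<and> 0 < Im (mu (of_real t))"
    "t \<ge> b \<Longrightarrow> Im (lam (of_real t)) = 0 \<and> Im (mu (of_real t)) = 0"
    "{lam (of_real t), mu (of_real t)} = eigenvalues (DX f (of_real t) (\<phi> (of_real t)) 0)"
    using H4 t unfolding HFN4_def by blast+
  have "lam (of_real t) = mu (of_real t) \<longleftrightarrow> (of_real t :: complex) = of_real b"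
    using H4 t(3) unfolding HFN4_def by blast
  then show "lam (of_real t) = mu (of_real t) \<longleftrightarrow> t = b" by simp
qed

lemma eigen_order:
  assumes "t \<in> S" "b \<le> t"
  shows "Re (lam (of_real t)) \<le> Re (mu (of_real t))"
proof (cases "t = b")
  case True
  then show ?thesis using eigen_signs(5)[OF assms(1)] by simp
next
  case False
  then have "b < t" "of_real t \<in> Dt" using assms S_Dt[of t] by auto
  then show ?thesis using H5 unfolding HFN5_def by (blast intro: less_imp_le)
qed

lemma rates:
  assumes t: "t \<in> S"
  shows "slow_rate (A t) = Re (lam (of_real t))" "fast_rate (A t) = Re (mu (of_real t))"
    "discr (A t) \<le> 0 \<longleftrightarrow> t \<le> b"
proof -
  let ?l = "lam (of_real t)" and ?m = "mu (of_real t)"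
  have c: "Im ?l < 0 \<and> 0 < Im ?m \<or> Im ?l = 0 \<and> Im ?m = 0 \<and> Re ?l \<le> Re ?m"
    using eigen_signs(3,4)[OF t] eigen_order[OF t] by (cases "t < b") auto
  have M: "DX f (of_real t) (\<phi> (of_real t)) 0 $ i $ j = of_real (A t $ i $ j)" for i j
    using A_entries[OF t] phi_real[OF t] by simp
  note r = rates_eq_eigenvalues[OF eigen_signs(6)[OF t] M c]
  show "slow_rate (A t) = Re ?l" "fast_rate (A t) = Re ?m" by (fact r(1), fact r(2))
  show "discr (A t) \<le> 0 \<longleftrightarrow> t \<le> b"
    unfolding r(3) eigen_signs(5)[OF t] using eigen_signs(3,4)[OF t] by (cases "t < b") auto
qed

sublocale focus_node A S a b
proof
  fix x y assume "x \<in> S" "y \<in> S"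
  then show "{x..y} \<subseteq> S" using S_interval[of x y] by auto
next
  fix t assume t: "t \<in> S"
  show "t < a \<Longrightarrow> fast_rate (A t) < 0" using rates(2)[OF t] eigen_signs(1)[OF t] by simp
  show "a < t \<Longrightarrow> slow_rate (A t) > 0" using rates(1)[OF t] eigen_signs(2)[OF t] by simp
  show "t \<le> b \<Longrightarrow> discr (A t) \<le> 0" using rates(3)[OF t] by simp
  show "b < t \<Longrightarrow> discr (A t) > 0" using rates(3)[OF t] by simp
qed (fact cont_A ab)+

lemma integral_rates:
  assumes "te \<in> S" "ts \<in> S"
  shows "integral {te..ts} (\<lambda>t. Re (lam (of_real t))) = integral {te..ts} slow"
    "integral {te..ts} (\<lambda>t. Re (mu (of_real t))) = integral {te..ts} fast"
proof -
  have "x \<in> S" if "x \<in> {te..ts}" for x using S_interval[OF assms] that by auto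
  then show "integral {te..ts} (\<lambda>t. Re (lam (of_real t))) = integral {te..ts} slow"
    "integral {te..ts} (\<lambda>t. Re (mu (of_real t))) = integral {te..ts} fast"
    by (auto intro!: integral_cong simp: rates)
qed

lemma tube_exists:
  assumes "c \<in> S" "d \<in> S" "\<rho> > 0"
  obtains r where "r > 0" "linear_tube f D \<psi> A c d \<rho> r"
proof (rule linear_tube_exists[OF analytic openD real_values])
  have "{c..d} \<subseteq> S" using S_interval[OF assms(1,2)] by auto
  then show "continuous_on {c..d} \<psi>" by (rule continuous_on_subset[OF cont_psi])
  fix t assume "t \<in> {c..d}"
  then have t: "t \<in> S" using \<open>{c..d} \<subseteq> S\<close> by blast
  show "(of_real t, cvec (\<psi> t), 0) \<in> D" by (rule curve_in_D[OF t])
  show "DX f (of_real t) (cvec (\<psi> t)) 0 $ i $ j = of_real (A t $ i $ j)" for i j by (rule A_entries[OF t])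
qed (use assms(3) that in auto)

lemma eventually_canard_tube:
  assumes cd: "c \<in> S" "d \<in> S" and \<rho>: "\<rho> > 0" and r: "r > 0" "linear_tube f D \<psi> A c d \<rho> r"
  shows "eventually (\<lambda>n. canard_tube f D \<psi> A c d \<rho> r (en n) (fst (Xc n)) (snd (Xc n))) ultra"
proof -
  have "r / 2 > 0" using r by simp
  from en_pos en_small[OF r(1)] canard_sol canard_close_real[OF cd this]
  show ?thesis
  proof eventually_elim
    case (elim n)
    show ?case
    proof
      show "solution f D (en n) (fst (Xc n), snd (Xc n))" using elim by simp
      show "{c..d} \<subseteq> fst (Xc n)" using elim by blast
      show "norm (snd (Xc n) t - \<psi> t) < r / 2" if "t \<in> {c..d}" for t using elim that by blast
      show "continuous_on {c..d} A" by (rule cont_sub[OF cd])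
      show "continuous_on D f" by (rule analytic_field_continuous[OF analytic])
    qed (use elim r \<rho> real_values in auto)
  qed
qed

abbreviation dev :: "(nat \<Rightarrow> curve) \<Rightarrow> nat \<Rightarrow> real \<Rightarrow> real" where
  "dev X n t \<equiv> norm (snd (X n) t - snd (Xc n) t)"

lemma dev_vs_curve:
  assumes t: "t \<in> S"
  shows "norm (cvec (snd (X n) t) - \<phi> (of_real t)) \<le> dev X n t + norm (snd (Xc n) t - \<psi> t)"
    "dev X n t \<le> norm (cvec (snd (X n) t) - \<phi> (of_real t)) + norm (snd (Xc n) t - \<psi> t)"
proof -
  have e: "norm (cvec (snd (X n) t) - \<phi> (of_real t)) = norm (snd (X n) t - \<psi> t)"
    using t by (simp add: phi_real flip: cvec_diff)
  show "norm (cvec (snd (X n) t) - \<phi> (of_real t)) \<le> dev X n t + norm (snd (Xc n) t - \<psi> t)"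
    unfolding e using norm_triangle_ineq[of "snd (X n) t - snd (Xc n) t" "snd (Xc n) t - \<psi> t"] by simp
  show "dev X n t \<le> norm (cvec (snd (X n) t) - \<phi> (of_real t)) + norm (snd (Xc n) t - \<psi> t)"
    unfolding e using norm_triangle_ineq4[of "snd (X n) t - \<psi> t" "snd (Xc n) t - \<psi> t"] by simp
qed

lemma along_dev_small:
  assumes al: "goes_along \<phi> Dt t1 t2 (abs_star X)" and cd: "t1 < ereal c" "c \<le> d" "ereal d < t2" and r: "r > 0"
  shows "eventually (\<lambda>n. \<forall>t\<in>{c..d}. t \<in> fst (X n) \<and> t \<in> fst (Xc n) \<and> dev X n t < r) ultra"
proof -
  have inS: "t \<in> S" if "c \<le> t" "t \<le> d" for t
  proof -
    have "t1 < ereal t" "ereal t < t2" using that cd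
      by (meson ereal_less_eq(3) less_le_trans, meson ereal_less_eq(3) le_less_trans)
    then show ?thesis using al unfolding goes_along_iff S_Dt by blast
  qed
  have r2: "r / 2 > 0" using r by simp
  have "eventually (\<lambda>n. \<forall>s\<in>{c..d}. s \<in> fst (X n) \<and> norm (cvec (snd (X n) s) - \<phi> (of_real s)) < r / 2) ultra"
    using al cd r2 unfolding goes_along_iff by blast
  moreover have "eventually (\<lambda>n. \<forall>t\<in>{c..d}. t \<in> fst (Xc n) \<and> norm (snd (Xc n) t - \<psi> t) < r / 2) ultra"
    by (rule canard_close_real[OF _ _ r2]) (use inS cd in auto)
  ultimately show ?thesis
  proof eventually_elim
    case (elim n)
    show ?case
    proof
      fix t assume t: "t \<in> {c..d}"
      have "dev X n t \<le> norm (cvec (snd (X n) t) - \<phi> (of_real t)) + norm (snd (Xc n) t - \<psi> t)"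
        by (rule dev_vs_curve(2)) (use inS t in auto)
      then show "t \<in> fst (X n) \<and> t \<in> fst (Xc n) \<and> dev X n t < r" using elim t by force
    qed
  qed
qed

text \<open>
  The failure of uniform closeness to the slow curve is restated for the deviation from the
  canard, with a standard lower bound \<open>r\<close>.
\<close>
lemma not_along_dev:
  assumes nal: "\<not> goes_along \<phi> Dt (ereal c) (ereal d) (abs_star X)" and cd: "c < d" "c \<in> S" "d \<in> S"
  obtains p q r where "c < p" "p \<le> q" "q < d" "r > 0"
    "eventually (\<lambda>n. \<exists>t\<in>{p..q}. t \<in> fst (X n) \<longrightarrow> r \<le> dev X n t) ultra"
proof -
  have dts: "\<forall>s. ereal c < ereal s \<and> ereal s < ereal d \<longrightarrow> of_real s \<in> Dt"
    using S_interval[OF cd(2,3)] S_Dt by auto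
  have "ereal c < ereal d" using cd(1) by simp
  with dts nal[unfolded goes_along_iff]
  have "\<not> (\<forall>p q r. ereal c < ereal p \<and> p \<le> q \<and> ereal q < ereal d \<and> 0 < r \<longrightarrow>
      eventually (\<lambda>n. \<forall>s\<in>{p..q}. s \<in> fst (X n) \<and> norm (cvec (snd (X n) s) - \<phi> (of_real s)) < r) ultra)"
    by blast
  then obtain p q r where pq: "ereal c < ereal p" "p \<le> q" "ereal q < ereal d" "0 < r"
    and ev: "\<not> eventually (\<lambda>n. \<forall>s\<in>{p..q}. s \<in> fst (X n) \<and> norm (cvec (snd (X n) s) - \<phi> (of_real s)) < r) ultra"
    by blast
  have pqS: "p \<in> S" "q \<in> S" using S_interval[OF cd(2,3)] pq by auto
  have r2: "r / 2 > 0" using pq by simp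
  from ev[unfolded ultra_not] canard_close_real[OF pqS r2]
  have "eventually (\<lambda>n. \<exists>t\<in>{p..q}. t \<in> fst (X n) \<longrightarrow> r / 2 \<le> dev X n t) ultra"
  proof eventually_elim
    case (elim n)
    from elim(1) obtain t where t: "t \<in> {p..q}" "t \<in> fst (X n) \<longrightarrow> r \<le> norm (cvec (snd (X n) t) - \<phi> (of_real t))"
      by (meson not_less)
    have "norm (snd (Xc n) t - \<psi> t) < r / 2" using elim t(1) by blast
    moreover have "norm (cvec (snd (X n) t) - \<phi> (of_real t)) \<le> dev X n t + norm (snd (Xc n) t - \<psi> t)"
      by (rule dev_vs_curve(1)) (use S_interval[OF pqS] t in auto)
    ultimately have "t \<in> fst (X n) \<longrightarrow> r / 2 \<le> dev X n t" using t(2) by linarith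
    with t(1) show ?case by blast
  qed
  then show thesis
    by (rule that[OF _ pq(2) _ r2, rotated 2]) (use pq in auto)
qed

text \<open>
  By maximality of \<open>]te, ts[\<close> the deviation is of standard size somewhere in every
  neighbourhood of \<open>te\<close> and of \<open>ts\<close>, while it is infinitesimal in
  between. So it takes one and the same standard value \<open>s\<close> at a time
  \<open>t0\<close> near \<open>te\<close> and at a time \<open>t1\<close> near \<open>ts\<close>,
  and never exceeds \<open>s\<close> in between. The growth estimates from \<open>t0\<close> to
  \<open>t1\<close> then compare \<open>s\<close> with itself. The value \<open>s\<close> may tend
  to \<open>0\<close> with \<open>\<delta>\<close>, but it cancels.
\<close>
lemma exit_balance:
  assumes traj: "eventually (\<lambda>n. trajectory f D (en n) (X n)) ultra"
    and ex: "goes_along_exactly \<phi> Dt (ereal te) (ereal ts) (abs_star X)"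
    and S: "te - \<delta> \<in> S" "ts + \<delta> \<in> S" and cd: "c \<in> S" "d \<in> S" "c < te - \<delta>" "ts + \<delta> < d"
    and \<delta>: "\<delta> > 0" "2 * \<delta> < ts - te" and \<eta>: "\<eta> > 0"
  shows "\<exists>C>0. eventually (\<lambda>n. \<exists>t0 t1. t0 \<in> {te - \<delta>..te + \<delta>} \<and> t1 \<in> {ts - \<delta>..ts + \<delta>} \<and>
     1 \<le> C * exp ((integral {t0..t1} fast + \<eta> * (t1 - t0)) / en n) \<and>
     1 \<le> C * exp ((- integral {t0..t1} slow + \<eta> * (t1 - t0)) / en n)) ultra"
proof -
  have al: "goes_along \<phi> Dt (ereal te) (ereal ts) (abs_star X)"
    and mx: "\<And>t1 t2. t1 \<le> ereal te \<Longrightarrow> ereal ts \<le> t2 \<Longrightarrow> goes_along \<phi> Dt t1 t2 (abs_star X) \<Longrightarrow> t1 = ereal te \<and> t2 = ereal ts"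
    using ex unfolding goes_along_exactly_def by blast+
  have teS: "te \<in> S" "ts \<in> S" using S_interval[OF S, of te] S_interval[OF S, of ts] \<delta> by auto
  obtain C1 \<rho>1 e1 where C1: "C1 > 0" "\<rho>1 > 0" "e1 > 0" and up: "\<And>e s t Y. 0 < e \<and> e < e1 \<and> c \<le> s \<and> s \<le> t \<and> t \<le> d \<and>
    near_linear A \<rho>1 e s t Y \<Longrightarrow> norm (Y t) \<le> C1 * norm (Y s) * exp ((integral {s..t} fast + \<eta> * (t - s)) / e)"
    using growth_upper[OF cont_sub[OF cd(1,2)] \<eta>] by blast
  obtain C2 \<rho>2 e2 where C2: "C2 > 0" "\<rho>2 > 0" "e2 > 0" and low: "\<And>e s t Y. 0 < e \<and> e < e2 \<and> c \<le> s \<and> s \<le> t \<and> t \<le> d \<and>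
    near_linear A \<rho>2 e s t Y \<Longrightarrow> norm (Y s) \<le> C2 * norm (Y t) * exp ((- integral {s..t} slow + \<eta> * (t - s)) / e)"
    using growth_lower[OF cont_sub[OF cd(1,2)] \<eta>] by blast
  define \<rho> where "\<rho> = min \<rho>1 \<rho>2"
  have \<rho>: "\<rho> > 0" "\<rho> \<le> \<rho>1" "\<rho> \<le> \<rho>2" using C1 C2 by (auto simp: \<rho>_def)
  obtain r where r: "r > 0" "linear_tube f D \<psi> A c d \<rho> r" using tube_exists[OF cd(1,2) \<rho>(1)] by blast
  have lts: "te - \<delta> < ts" "te < ts + \<delta>" using \<delta> by linarith+
  have nal1: "\<not> goes_along \<phi> Dt (ereal (te - \<delta>)) (ereal ts) (abs_star X)"
    using mx[of "ereal (te - \<delta>)" "ereal ts"] \<delta> by auto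
  obtain p q r1 where pq: "te - \<delta> < p" "p \<le> q" "q < ts" "r1 > 0"
    and bad1: "eventually (\<lambda>n. \<exists>t\<in>{p..q}. t \<in> fst (X n) \<longrightarrow> r1 \<le> dev X n t) ultra"
    by (rule not_along_dev[OF nal1 lts(1) S(1) teS(2)]) (rule that)
  have nal2: "\<not> goes_along \<phi> Dt (ereal te) (ereal (ts + \<delta>)) (abs_star X)"
    using mx[of "ereal te" "ereal (ts + \<delta>)"] \<delta> by auto
  obtain p' q' r2 where pq': "te < p'" "p' \<le> q'" "q' < ts + \<delta>" "r2 > 0"
    and bad2: "eventually (\<lambda>n. \<exists>t\<in>{p'..q'}. t \<in> fst (X n) \<longrightarrow> r2 \<le> dev X n t) ultra"
    by (rule not_along_dev[OF nal2 lts(2) teS(1) S(2)]) (rule that)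
  \<comment> \<open>small enough to be attained at both ends, and inside the tube\<close>
  define s where "s = min (min r1 r2) (r / 4)"
  have s: "s > 0" "s \<le> r1" "s \<le> r2" "s \<le> r / 4" using pq(4) pq'(4) r by (auto simp: s_def)
  define m1 where "m1 = min (te + \<delta>) p'"
  define m2 where "m2 = max (ts - \<delta>) q"
  have m: "te < m1" "m1 \<le> te + \<delta>" "m1 \<le> p'" "m2 < ts" "ts - \<delta> \<le> m2" "q \<le> m2" "m1 \<le> m2"
    using \<delta> pq pq' by (auto simp: m1_def m2_def)
  have mid: "eventually (\<lambda>n. \<forall>t\<in>{m1..m2}. t \<in> fst (X n) \<and> t \<in> fst (Xc n) \<and> dev X n t < s) ultra"
    by (rule along_dev_small[OF al _ m(7) _ s(1)]) (use m in auto)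
  have e12: "min e1 e2 > 0" using C1 C2 by simp
  define C where "C = max C1 C2"
  have C: "C > 0" "C1 \<le> C" "C2 \<le> C" using C1 by (auto simp: C_def)
  have "eventually (\<lambda>n. \<exists>t0 t1. t0 \<in> {te - \<delta>..te + \<delta>} \<and> t1 \<in> {ts - \<delta>..ts + \<delta>} \<and>
     1 \<le> C * exp ((integral {t0..t1} fast + \<eta> * (t1 - t0)) / en n) \<and>
     1 \<le> C * exp ((- integral {t0..t1} slow + \<eta> * (t1 - t0)) / en n)) ultra"
    using traj bad1 bad2 mid en_small[OF e12] eventually_canard_tube[OF cd(1,2) \<rho>(1) r]
  proof eventually_elim
    case (elim n)
    interpret T: canard_tube f D \<psi> A c d \<rho> r "en n" "fst (Xc n)" "snd (Xc n)" by (fact elim(6))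
    define I where "I = fst (X n)"
    define x where "x = snd (X n)"
    let ?Y = "\<lambda>t. x t - snd (Xc n) t"
    have Xn: "X n = (I, x)" by (simp add: I_def x_def)
    have tr: "trajectory f D (en n) (I, x)" using elim(1) by (simp add: Xn)
    have midn: "t \<in> I" "norm (?Y t) < s" if "m1 \<le> t" "t \<le> m2" for t using elim(4) that by (auto simp: I_def x_def)
    from elim(2) obtain u where u0: "u \<in> {p..q}" "u \<in> fst (X n) \<longrightarrow> r1 \<le> dev X n u" by blast
    then have u: "u \<in> {p..q}" "u \<in> I \<Longrightarrow> r1 \<le> norm (?Y u)" by (simp_all add: I_def x_def)
    have um: "u < m1"
    proof (rule ccontr)
      assume "\<not> u < m1"
      then have "u \<in> I" "norm (?Y u) < s" using midn[of u] u(1) m by auto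
      with u(2) s show False by linarith
    qed
    obtain t0 where t0: "t0 \<in> {te - \<delta>..te + \<delta>}" "t0 \<le> m1" "{t0..m1} \<subseteq> I" "norm (?Y t0) = s"
      "\<And>t. t \<in> {t0..m1} \<Longrightarrow> norm (?Y t) \<le> s"
    proof (rule T.trajectory_enters[OF tr, of "te - \<delta>" m1 s u])
      show "u \<in> I \<Longrightarrow> s \<le> norm (?Y u)" using u(2) s by linarith
    qed (use cd m midn[of m1] s u um pq \<delta> that in auto)
    from elim(3) obtain w where w0: "w \<in> {p'..q'}" "w \<in> fst (X n) \<longrightarrow> r2 \<le> dev X n w" by blast
    then have w: "w \<in> {p'..q'}" "w \<in> I \<Longrightarrow> r2 \<le> norm (?Y w)" by (simp_all add: I_def x_def)
    have wm: "w > m2"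
    proof (rule ccontr)
      assume "\<not> w > m2"
      then have "w \<in> I" "norm (?Y w) < s" using midn[of w] w(1) m by auto
      with w(2) s show False by linarith
    qed
    obtain t1 where t1: "t1 \<in> {ts - \<delta>..ts + \<delta>}" "m2 \<le> t1" "{m2..t1} \<subseteq> I" "norm (?Y t1) = s"
      "\<And>t. t \<in> {m2..t1} \<Longrightarrow> norm (?Y t) \<le> s"
    proof (rule T.trajectory_exits[OF tr, of m2 "ts + \<delta>" s w])
      show "w \<in> I \<Longrightarrow> s \<le> norm (?Y w)" using w(2) s by linarith
    qed (use cd m midn[of m2] s w wm pq' \<delta> that in auto)
    have sub: "{t0..t1} \<subseteq> I"
    proof
      fix t assume t: "t \<in> {t0..t1}"
      consider "t \<le> m1" | "m1 \<le> t" "t \<le> m2" | "m2 \<le> t" by linarith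
      then show "t \<in> I" using t t0(3) t1(3) midn(1)[of t] by cases auto
    qed
    have small: "norm (?Y t) \<le> r / 2" if t: "t \<in> {t0..t1}" for t
    proof -
      consider "t \<le> m1" | "m1 \<le> t" "t \<le> m2" | "m2 \<le> t" by linarith
      then have "norm (?Y t) \<le> s" using t t0(5)[of t] t1(5)[of t] midn(2)[of t] by cases auto
      then show ?thesis using s r by linarith
    qed
    have cdt: "c \<le> t0" "t0 \<le> t1" "t1 \<le> d" using t0(1,2) t1(1,2) m cd by auto
    have sx: "solution f D (en n) (I, x)" using tr by (simp add: trajectory_def)
    have nl: "near_linear A \<rho> (en n) t0 t1 ?Y"
      by (rule T.solves_near_linear[OF T.deviation_solves[OF sx cdt(1,3) sub small] cdt(1,3)])
    have nl1: "near_linear A \<rho>1 (en n) t0 t1 ?Y" and nl2: "near_linear A \<rho>2 (en n) t0 t1 ?Y"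
      by (rule near_linear_subset[OF nl order_refl order_refl]; fact \<rho>)+
    have "s \<le> C1 * s * exp ((integral {t0..t1} fast + \<eta> * (t1 - t0)) / en n)"
      using up[of "en n" t0 t1 ?Y] nl1 cdt T.e(1) elim(5) t0(4) t1(4) by auto
    also have "\<dots> \<le> C * s * exp ((integral {t0..t1} fast + \<eta> * (t1 - t0)) / en n)"
      using C s by (intro mult_right_mono) auto
    finally have "1 \<le> C * exp ((integral {t0..t1} fast + \<eta> * (t1 - t0)) / en n)" using s(1) by simp
    moreover have "s \<le> C2 * s * exp ((- integral {t0..t1} slow + \<eta> * (t1 - t0)) / en n)"
      using low[of "en n" t0 t1 ?Y] nl2 cdt T.e(1) elim(5) t0(4) t1(4) by auto
    then have "s \<le> C * s * exp ((- integral {t0..t1} slow + \<eta> * (t1 - t0)) / en n)"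
      by (rule order_trans) (use C s in \<open>auto intro!: mult_right_mono\<close>)
    then have "1 \<le> C * exp ((- integral {t0..t1} slow + \<eta> * (t1 - t0)) / en n)" using s(1) by simp
    ultimately show ?case using t0(1) t1(1) by blast
  qed
  with C(1) show ?thesis by blast
qed

lemma integral_end_points_close:
  fixes g :: "real \<Rightarrow> real"
  assumes g: "continuous_on {c..d} g" and K: "\<And>x. x \<in> {c..d} \<Longrightarrow> \<bar>g x\<bar> \<le> K" "K \<ge> 0"
    and cd: "c \<le> te - \<delta>" "ts + \<delta> \<le> d" "2 * \<delta> < ts - te" "\<delta> > 0"
    and t: "t0 \<in> {te - \<delta>..te + \<delta>}" "t1 \<in> {ts - \<delta>..ts + \<delta>}"
  shows "\<bar>integral {t0..t1} g - integral {te..ts} g\<bar> \<le> 2 * (K * \<delta>)"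
proof -
  define G where "G = (\<lambda>x. integral {c..x} g)"
  have G: "\<bar>G y - G x\<bar> \<le> K * \<delta>" if "c \<le> x" "x \<le> y" "y \<le> d" "y - x \<le> \<delta>" for x y
  proof -
    have "G y = G x + integral {x..y} g"
      unfolding G_def by (rule integral_split) (use that in \<open>auto intro: continuous_on_subset[OF g]\<close>)
    moreover have "norm (integral {x..y} g) \<le> K * (y - x)"
      by (rule integral_bound) (use that K in \<open>auto intro: continuous_on_subset[OF g]\<close>)
    moreover have "K * (y - x) \<le> K * \<delta>" using that K by (intro mult_left_mono) auto
    ultimately show ?thesis by simp
  qed
  have I: "integral {x..y} g = G y - G x" if "c \<le> x" "x \<le> y" "y \<le> d" for x y
    unfolding G_def using integral_split[of c y g x] that by (simp add: continuous_on_subset[OF g])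
  have "\<bar>G t0 - G te\<bar> \<le> K * \<delta>"
    using G[of t0 te] G[of te t0] t cd by (cases "t0 \<le> te") (auto simp: abs_minus_commute)
  moreover have "\<bar>G t1 - G ts\<bar> \<le> K * \<delta>"
    using G[of t1 ts] G[of ts t1] t cd by (cases "t1 \<le> ts") (auto simp: abs_minus_commute)
  moreover have "integral {t0..t1} g = G t1 - G t0" "integral {te..ts} g = G ts - G te"
    by (rule I; use t cd in simp)+
  ultimately show ?thesis by linarith
qed

text \<open>
  If the integral were negative, then, for \<open>\<delta>\<close> and \<open>\<eta>\<close>
  small, the exponentials of the balance would be infinitesimal.
\<close>
lemma balanced_integral_nonneg:
  fixes g :: "real \<Rightarrow> real"
  assumes g: "continuous_on S g" and te: "te \<in> S" "ts \<in> S" "te < ts"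
    and bal: "\<And>\<delta> \<eta> c d. te - \<delta> \<in> S \<Longrightarrow> ts + \<delta> \<in> S \<Longrightarrow> c \<in> S \<Longrightarrow> d \<in> S \<Longrightarrow> c < te - \<delta> \<Longrightarrow> ts + \<delta> < d \<Longrightarrow>
      \<delta> > 0 \<Longrightarrow> 2 * \<delta> < ts - te \<Longrightarrow> \<eta> > 0 \<Longrightarrow> \<exists>C>0. eventually (\<lambda>n. \<exists>t0 t1. t0 \<in> {te - \<delta>..te + \<delta>} \<and>
      t1 \<in> {ts - \<delta>..ts + \<delta>} \<and> 1 \<le> C * exp ((integral {t0..t1} g + \<eta> * (t1 - t0)) / en n)) ultra"
  shows "integral {te..ts} g \<ge> 0"
proof (rule ccontr)
  assume "\<not> integral {te..ts} g \<ge> 0"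
  define \<gamma> where "\<gamma> = - integral {te..ts} g"
  have \<gamma>: "\<gamma> > 0" using \<open>\<not> _\<close> by (simp add: \<gamma>_def)
  obtain h1 where h1: "h1 > 0" "te - h1 \<in> S" "te + h1 \<in> S" using S_open_ball[OF te(1)] by blast
  obtain h2 where h2: "h2 > 0" "ts - h2 \<in> S" "ts + h2 \<in> S" using S_open_ball[OF te(2)] by blast
  define c where "c = te - h1"
  define d where "d = ts + h2"
  have cd: "c \<in> S" "d \<in> S" "c < te" "ts < d" using h1 h2 by (auto simp: c_def d_def)
  have gc: "continuous_on {c..d} g" by (rule continuous_on_subset[OF g ivl[OF cd(1,2)]])
  then have "bounded (g ` {c..d})" by (intro compact_imp_bounded compact_continuous_image) auto
  then obtain K0 where "\<forall>z\<in>g ` {c..d}. norm z \<le> K0" unfolding bounded_iff by blast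
  then have K0: "\<And>x. x \<in> {c..d} \<Longrightarrow> \<bar>g x\<bar> \<le> K0" by simp
  define K where "K = \<bar>K0\<bar> + 1"
  have K: "\<And>x. x \<in> {c..d} \<Longrightarrow> \<bar>g x\<bar> \<le> K" "K > 0" using K0 by (force simp: K_def)+
  define \<delta> where "\<delta> = min (min (h1 / 2) (h2 / 2)) (min ((ts - te) / 3) (\<gamma> / (8 * K)))"
  have \<delta>: "\<delta> > 0" "c < te - \<delta>" "ts + \<delta> < d" "2 * \<delta> < ts - te"
    using h1 h2 te \<gamma> K by (auto simp: \<delta>_def c_def d_def min_def)
  have "\<delta> \<le> \<gamma> / (8 * K)" by (simp add: \<delta>_def)
  then have \<delta>K: "2 * (K * \<delta>) \<le> \<gamma> / 4" using K by (simp add: field_simps)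
  define \<eta> where "\<eta> = \<gamma> / (4 * (d - c))"
  have \<eta>: "\<eta> > 0" "\<eta> * (d - c) = \<gamma> / 4"
  proof -
    have dc: "d - c > 0" using cd te by simp
    then show "\<eta> > 0" using \<gamma> by (simp add: \<eta>_def)
    have "x / (4 * v) * v = x / 4" if "v > 0" for x v :: real using that by simp
    then show "\<eta> * (d - c) = \<gamma> / 4" unfolding \<eta>_def using dc by blast
  qed
  have S2: "te - \<delta> \<in> S" "ts + \<delta> \<in> S" using S_interval[OF cd(1,2)] \<delta> te by auto
  obtain C where C: "C > 0" and ev: "eventually (\<lambda>n. \<exists>t0 t1. t0 \<in> {te - \<delta>..te + \<delta>} \<and>
      t1 \<in> {ts - \<delta>..ts + \<delta>} \<and> 1 \<le> C * exp ((integral {t0..t1} g + \<eta> * (t1 - t0)) / en n)) ultra"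
    using bal[OF S2 cd(1,2) \<delta>(2,3,1,4) \<eta>(1)] by blast
  have g2: "\<gamma> / 2 > 0" using \<gamma> by simp
  obtain e0 where e0: "e0 > 0" "\<And>e. 0 < e \<Longrightarrow> e < e0 \<Longrightarrow> C * exp (- (\<gamma> / 2 / e)) < 1"
    using small_exponential[OF C g2] by metis
  have "eventually (\<lambda>n. False) ultra"
    using ev en_pos en_small[OF e0(1)]
  proof eventually_elim
    case (elim n)
    then obtain t0 t1 where t: "t0 \<in> {te - \<delta>..te + \<delta>}" "t1 \<in> {ts - \<delta>..ts + \<delta>}"
      and one: "1 \<le> C * exp ((integral {t0..t1} g + \<eta> * (t1 - t0)) / en n)" by blast
    have "\<bar>integral {t0..t1} g - integral {te..ts} g\<bar> \<le> 2 * (K * \<delta>)"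
      by (rule integral_end_points_close[OF gc K(1)]) (use K \<delta> t in auto)
    moreover have "\<eta> * (t1 - t0) \<le> \<eta> * (d - c)" using t \<delta> \<eta> by (intro mult_left_mono) auto
    ultimately have "integral {t0..t1} g + \<eta> * (t1 - t0) \<le> - (\<gamma> / 2)"
      using \<delta>K \<eta>(2) \<gamma> unfolding \<gamma>_def by linarith
    then have "exp ((integral {t0..t1} g + \<eta> * (t1 - t0)) / en n) \<le> exp (- (\<gamma> / 2 / en n))"
      by (rule exp_quotient_le[OF elim(2)])
    then have "C * exp ((integral {t0..t1} g + \<eta> * (t1 - t0)) / en n) \<le> C * exp (- (\<gamma> / 2 / en n))"
      using C by (intro mult_left_mono) auto
    with one e0(2)[OF elim(2,3)] show False by linarith
  qed
  then show False using ultra_ex by blast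
qed

lemma exit_inequalities:
  assumes traj: "eventually (\<lambda>n. trajectory f D (en n) (X n)) ultra"
    and ex: "goes_along_exactly \<phi> Dt (ereal te) (ereal ts) (abs_star X)"
    and te: "te \<in> S" "ts \<in> S"
  shows "integral {te..ts} slow \<le> 0" "0 \<le> integral {te..ts} fast"
proof -
  have lt: "te < ts" using ex unfolding goes_along_exactly_def goes_along_def by simp
  note bal = exit_balance[OF traj ex]
  show "0 \<le> integral {te..ts} fast"
  proof (rule balanced_integral_nonneg[OF _ te lt])
    show "continuous_on S fast" by (rule continuous_on_rates(3)[OF cont_A])
    fix \<delta> \<eta> c d :: real assume as: "te - \<delta> \<in> S" "ts + \<delta> \<in> S" "c \<in> S" "d \<in> S" "c < te - \<delta>" "ts + \<delta> < d"
      "0 < \<delta>" "2 * \<delta> < ts - te" "0 < \<eta>"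
    then obtain C where C: "C > 0" and ev: "eventually (\<lambda>n. \<exists>t0 t1. t0 \<in> {te - \<delta>..te + \<delta>} \<and> t1 \<in> {ts - \<delta>..ts + \<delta>} \<and>
       1 \<le> C * exp ((integral {t0..t1} fast + \<eta> * (t1 - t0)) / en n) \<and>
       1 \<le> C * exp ((- integral {t0..t1} slow + \<eta> * (t1 - t0)) / en n)) ultra"
      using bal[OF as] by blast
    have "eventually (\<lambda>n. \<exists>t0 t1. t0 \<in> {te - \<delta>..te + \<delta>} \<and> t1 \<in> {ts - \<delta>..ts + \<delta>} \<and>
       1 \<le> C * exp ((integral {t0..t1} fast + \<eta> * (t1 - t0)) / en n)) ultra"
      using ev by (rule eventually_mono) blast
    with C show "\<exists>C>0. eventually (\<lambda>n. \<exists>t0 t1. t0 \<in> {te - \<delta>..te + \<delta>} \<and> t1 \<in> {ts - \<delta>..ts + \<delta>} \<and>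
       1 \<le> C * exp ((integral {t0..t1} fast + \<eta> * (t1 - t0)) / en n)) ultra" by blast
  qed
  have "0 \<le> integral {te..ts} (\<lambda>t. - slow t)"
  proof (rule balanced_integral_nonneg[OF _ te lt])
    show "continuous_on S (\<lambda>t. - slow t)" by (intro continuous_intros continuous_on_rates(4)[OF cont_A])
    fix \<delta> \<eta> c d :: real assume as: "te - \<delta> \<in> S" "ts + \<delta> \<in> S" "c \<in> S" "d \<in> S" "c < te - \<delta>" "ts + \<delta> < d"
      "0 < \<delta>" "2 * \<delta> < ts - te" "0 < \<eta>"
    then obtain C where C: "C > 0" and ev: "eventually (\<lambda>n. \<exists>t0 t1. t0 \<in> {te - \<delta>..te + \<delta>} \<and> t1 \<in> {ts - \<delta>..ts + \<delta>} \<and>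
       1 \<le> C * exp ((integral {t0..t1} fast + \<eta> * (t1 - t0)) / en n) \<and>
       1 \<le> C * exp ((- integral {t0..t1} slow + \<eta> * (t1 - t0)) / en n)) ultra"
      using bal[OF as] by blast
    have "eventually (\<lambda>n. \<exists>t0 t1. t0 \<in> {te - \<delta>..te + \<delta>} \<and> t1 \<in> {ts - \<delta>..ts + \<delta>} \<and>
       1 \<le> C * exp ((integral {t0..t1} (\<lambda>t. - slow t) + \<eta> * (t1 - t0)) / en n)) ultra"
      using ev by (rule eventually_mono) (auto simp only: Henstock_Kurzweil_Integration.integral_neg)
    with C show "\<exists>C>0. eventually (\<lambda>n. \<exists>t0 t1. t0 \<in> {te - \<delta>..te + \<delta>} \<and> t1 \<in> {ts - \<delta>..ts + \<delta>} \<and>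
       1 \<le> C * exp ((integral {t0..t1} (\<lambda>t. - slow t) + \<eta> * (t1 - t0)) / en n)) ultra" by blast
  qed
  then show "integral {te..ts} slow \<le> 0" by simp
qed

end

section \<open>Trajectories with prescribed entry and exit times\<close>

text \<open>
  A small solution of the truncated equation is a solution of the true equation, on a slightly
  larger open interval, and extends to a trajectory.
\<close>
lemma (in canard_tube) trajectory_from_deviation:
  assumes Z: "solves H c d Z" and pq: "c < p" "p \<le> q" "q < d"
    and small: "\<And>t. t \<in> {p..q} \<Longrightarrow> norm (Z t) \<le> r / 4"
  obtains X where "trajectory f D e X" "{p..q} \<subseteq> fst X" "\<And>t. t \<in> {p..q} \<Longrightarrow> snd X t - xc t = Z t"
proof -
  have near: "\<exists>h>0. \<forall>\<tau>. \<bar>\<tau> - m\<bar> < h \<longrightarrow> norm (Z \<tau>) \<le> r / 2" if m: "m \<in> {p..q}" for m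
  proof -
    have "isCont Z m"
      using solves_continuous[OF Z] m pq by (intro continuous_on_interior[of "{c..d}"]) auto
    moreover have "r / 4 > 0" using r by simp
    ultimately obtain h where h: "h > 0" "\<forall>\<tau>. dist \<tau> m < h \<longrightarrow> dist (Z \<tau>) (Z m) < r / 4"
      unfolding continuous_at_eps_delta by blast
    have "norm (Z \<tau>) \<le> r / 2" if "\<bar>\<tau> - m\<bar> < h" for \<tau>
    proof -
      have "norm (Z \<tau> - Z m) < r / 4" using h(2) that by (simp add: dist_norm)
      then show ?thesis using small[OF m] norm_triangle_ineq2[of "Z \<tau>" "Z m"] by linarith
    qed
    with h(1) show ?thesis by blast
  qed
  have "p \<in> {p..q}" "q \<in> {p..q}" using pq by auto
  obtain h1 where h1: "h1 > 0" "\<And>\<tau>. \<bar>\<tau> - p\<bar> < h1 \<Longrightarrow> norm (Z \<tau>) \<le> r / 2" using near[OF \<open>p \<in> _\<close>] by blast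
  obtain h2 where h2: "h2 > 0" "\<And>\<tau>. \<bar>\<tau> - q\<bar> < h2 \<Longrightarrow> norm (Z \<tau>) \<le> r / 2" using near[OF \<open>q \<in> _\<close>] by blast
  define p' where "p' = max c (p - h1)"
  define q' where "q' = min d (q + h2)"
  have p'q': "c \<le> p'" "p' < p" "q < q'" "q' \<le> d" using pq h1 h2 by (auto simp: p'_def q'_def)
  have "solution f D e ({p'<..<q'}, \<lambda>\<tau>. xc \<tau> + Z \<tau>)"
  proof (rule solves_gives_solution[OF Z])
    fix \<tau> assume t: "p' < \<tau>" "\<tau> < q'"
    consider "\<tau> < p" | "\<tau> \<in> {p..q}" | "q < \<tau>" by fastforce
    then show "norm (Z \<tau>) \<le> r / 2"
    proof cases
      case 1
      then show ?thesis using t by (intro h1(2)) (auto simp: p'_def)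
    next
      case 2
      then show ?thesis using small[of \<tau>] r by linarith
    next
      case 3
      then show ?thesis using t by (intro h2(2)) (auto simp: q'_def)
    qed
  qed (use p'q' pq in auto)
  then obtain X where X: "trajectory f D e X" "fst ({p'<..<q'}, \<lambda>\<tau>. xc \<tau> + Z \<tau>) \<subseteq> fst X"
    "\<And>t. t \<in> fst ({p'<..<q'}, \<lambda>\<tau>. xc \<tau> + Z \<tau>) \<Longrightarrow> snd X t = snd ({p'<..<q'}, \<lambda>\<tau>. xc \<tau> + Z \<tau>) t"
    using solution_extends_to_trajectory by blast
  have sub: "{p..q} \<subseteq> {p'<..<q'}" using p'q' by auto
  show thesis
  proof (rule that[OF X(1)])
    show "{p..q} \<subseteq> fst X" using X(2) sub by simp
    show "snd X t - xc t = Z t" if "t \<in> {p..q}" for t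
    proof -
      have "t \<in> {p'<..<q'}" using sub that by blast
      then show ?thesis using X(3)[of t] by simp
    qed
  qed
qed

context canard_problem
begin

text \<open>
  A trajectory that enters at \<open>te\<close> and exits at \<open>T\<close>, within
  \<open>\<delta>\<close> of \<open>ts\<close>, at the same distance from the canard, and is
  exponentially small in between. The distance at the ends may depend on \<open>\<delta>\<close>
  but is at least \<open>exp (- \<gamma> / \<epsilon>)\<close>; for infinitesimal
  \<open>\<gamma>\<close> this is still too large for a trajectory that goes along a larger
  interval.
\<close>
definition tuned_passage :: "real \<Rightarrow> real \<Rightarrow> real \<Rightarrow> real \<Rightarrow> real \<Rightarrow> nat \<Rightarrow> curve \<Rightarrow> real \<Rightarrow> bool" where
  "tuned_passage te ts \<eta> \<delta> \<gamma> n X T \<longleftrightarrow> trajectory f D (en n) X \<and> \<bar>T - ts\<bar> \<le> \<delta> \<and> {te..T} \<subseteq> fst X \<and>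
     norm (snd X te - snd (Xc n) te) = norm (snd X T - snd (Xc n) T) \<and>
     exp (- (\<gamma> / en n)) \<le> norm (snd X te - snd (Xc n) te) \<and>
     (\<forall>t\<in>{te..T}. norm (snd X t - snd (Xc n) t) \<le> exp (- (\<eta> * min (t - te) (T - t) / en n)))"

text \<open>
  The accuracy \<open>\<delta>\<close> of the exit time determines how close to linear the
  equation has to be, hence the radius of the tube and the distance \<open>r0\<close> at the ends.
  The envelope is obtained beforehand, so that its exponent \<open>\<eta>\<close> is independent
  of \<open>\<delta>\<close>. The distance \<open>r0\<close> is standard, so it exceeds \<open>exp
  (- \<gamma> / \<epsilon>)\<close> as soon as \<open>\<epsilon>\<close> is small enough.
\<close>
lemma tuned_passages_exist:
  assumes te: "te \<in> S" "ts \<in> S" "te < ts"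
    and int: "integral {te..ts} slow \<le> 0" "0 \<le> integral {te..ts} fast"
  obtains \<eta> \<delta>0 where "\<eta> > 0" "\<delta>0 > 0" "a < ts - \<delta>0"
    "\<And>\<delta> \<gamma>. 0 < \<delta> \<Longrightarrow> \<delta> \<le> \<delta>0 \<Longrightarrow> 0 < \<gamma> \<Longrightarrow> eventually (\<lambda>n. \<exists>X T. tuned_passage te ts \<eta> \<delta> \<gamma> n X T) ultra"
proof -
  note order = entry_before_exit_after[OF te int]
  obtain h1 where h1: "h1 > 0" "te - h1 \<in> S" using S_open_ball[OF te(1)] by blast
  obtain h2 where h2: "h2 > 0" "ts + h2 \<in> S" using S_open_ball[OF te(2)] by blast
  define c where "c = te - h1"
  define d where "d = ts + h2"
  define q where "q = (a + ts) / 2"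
  have cd: "c \<in> S" "d \<in> S" "c < te" "ts < d" using h1 h2 by (auto simp: c_def d_def)
  have q: "a < q" "q < ts" "q \<le> d" using order cd by (auto simp: q_def field_simps)
  \<comment> \<open>keeps exit times after \<open>q\<close>, and after \<open>b\<close> if
    \<open>ts\<close> is\<close>
  define \<delta>0 where "\<delta>0 = min (h2 / 2) (min ((ts - a) / 4) (if b < ts then (ts - b) / 2 else 1))"
  have \<delta>0: "\<delta>0 > 0" "ts + \<delta>0 < d" "\<delta>0 \<le> (ts - a) / 4" "b < ts \<Longrightarrow> \<delta>0 < ts - b"
    using h2 order by (auto simp: \<delta>0_def d_def min_def)
  have q\<delta>: "q \<le> ts - \<delta>0" using \<delta>0(3) order by (simp add: q_def field_simps)
  obtain \<eta> C0 \<rho>0 e0 where env: "\<eta> > 0" "C0 \<ge> 1" "\<rho>0 > 0" "e0 > 0"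
    and envl: "\<And>e r0 T Y t. 0 < e \<and> e < e0 \<and> near_linear A \<rho>0 e te T Y \<and>
      norm (Y te) = r0 \<and> norm (Y T) = r0 \<and> q \<le> T \<and> T \<le> d \<and> te \<le> t \<and> t \<le> T \<Longrightarrow>
      norm (Y t) \<le> C0 * r0 * exp (- (\<eta> * min (t - te) (T - t) / e))"
    using envelope[OF te(1) order(1) cd(1,2) less_imp_le[OF cd(3)] q(1,3)] by blast
  have "eventually (\<lambda>n. \<exists>X T. tuned_passage te ts \<eta> \<delta> \<gamma> n X T) ultra" if \<delta>: "0 < \<delta>" "\<delta> \<le> \<delta>0" and \<gamma>: "0 < \<gamma>" for \<delta> \<gamma>
  proof -
    have \<delta>': "ts + \<delta> \<le> d" "\<delta> < ts - a" "b < ts \<Longrightarrow> \<delta> < ts - b" using \<delta> \<delta>0 order by auto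
    obtain \<rho>1 e1 where \<rho>1: "\<rho>1 > 0" "e1 > 0" and cross: "\<And>e L H r0. near_linear_field A c d \<rho>1 e L H \<and> e < e1 \<and> 0 < r0 \<Longrightarrow>
      \<exists>Z T. solves H c d Z \<and> norm (Z te) = r0 \<and> T \<in> {ts - \<delta>..ts + \<delta>} \<and> norm (Z T) = r0"
      using crossing[OF te int cd(1,2) less_imp_le[OF cd(3)] \<delta>'(1) \<delta>(1) \<delta>'(2,3)] by blast
    define \<rho> where "\<rho> = min \<rho>0 \<rho>1"
    have \<rho>: "\<rho> > 0" "\<rho> \<le> \<rho>0" "\<rho> \<le> \<rho>1" using env \<rho>1 by (auto simp: \<rho>_def)
    obtain r where r: "r > 0" "linear_tube f D \<psi> A c d \<rho> r" using tube_exists[OF cd(1,2) \<rho>(1)] by blast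
    \<comment> \<open>the envelope then stays in the part of the tube where nothing is truncated\<close>
    define r0 where "r0 = min (r / 4) 1 / C0"
    have r0: "r0 > 0" "C0 * r0 \<le> r / 4" "C0 * r0 \<le> 1" using r env by (auto simp: r0_def)
    have r0': "1 / r0 > 0" using r0 by simp
    obtain e2 where e2: "e2 > 0" "\<And>e. 0 < e \<Longrightarrow> e < e2 \<Longrightarrow> 1 / r0 * exp (- (\<gamma> / e)) < 1"
      using small_exponential[OF r0' \<gamma>] by metis
    have e012: "min e0 (min e1 e2) > 0" using env \<rho>1 e2 by simp
    show ?thesis
      using en_small[OF e012] eventually_canard_tube[OF cd(1,2) \<rho>(1) r]
    proof eventually_elim
      case (elim n)
      interpret T: canard_tube f D \<psi> A c d \<rho> r "en n" "fst (Xc n)" "snd (Xc n)" by (fact elim(2))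
      obtain L where L: "L \<ge> 0" "\<And>t x y. t \<in> {c..d} \<Longrightarrow> norm (T.H t x - T.H t y) \<le> L * norm (x - y)"
        using T.H_lipschitz by blast
      have nlf: "near_linear_field A c d \<rho>1 (en n) L T.H"
      proof
        show "0 < en n" by (rule T.e)
        show "continuous_on ({c..d} \<times> UNIV) (\<lambda>(t, y). T.H t y)" by (rule T.H_continuous)
        show "0 \<le> L" by (rule L)
        show "norm (T.H t x - T.H t y) \<le> L * norm (x - y)" if "t \<in> {c..d}" for t x y by (rule L(2)[OF that])
        fix t y assume "t \<in> {c..d}"
        then have "norm (en n *\<^sub>R T.H t y - A t *v y) \<le> \<rho> * norm y" by (rule T.H_near_linear)
        also have "\<dots> \<le> \<rho>1 * norm y" using \<rho>(3) by (rule mult_right_mono) simp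
        finally show "norm (en n *\<^sub>R T.H t y - A t *v y) \<le> \<rho>1 * norm y" .
      qed
      obtain Z T where Z: "solves T.H c d Z" "norm (Z te) = r0" "T \<in> {ts - \<delta>..ts + \<delta>}" "norm (Z T) = r0"
        using cross[of "en n" L T.H r0] nlf elim(1) r0(1) by auto
      have T: "c \<le> te" "te < T" "T < d" "T \<le> d" "q \<le> T" using Z(3) \<delta> \<delta>0 q\<delta> cd order q by auto
      have nl: "near_linear A \<rho>0 (en n) te T Z"
        by (rule near_linear_subset[OF T.solves_near_linear[OF solves_subset[OF Z(1) T(1,4)] T(1,4)] order_refl order_refl \<rho>(2)])
      have bound: "norm (Z t) \<le> C0 * r0 * exp (- (\<eta> * min (t - te) (T - t) / en n))" if t: "t \<in> {te..T}" for t
        using envl[of "en n" T Z r0 t] nl Z T t T.e(1) elim(1) by auto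
      have expo: "exp (- (\<eta> * min (t - te) (T - t) / en n)) \<le> 1" if t: "t \<in> {te..T}" for t
        using env(1) t T.e(1) by simp
      have C0r0: "C0 * r0 \<ge> 0" using env(2) r0(1) by simp
      have small: "norm (Z t) \<le> r / 4" if t: "t \<in> {te..T}" for t
        using bound[OF t] mult_left_mono[OF expo[OF t] C0r0] r0(2) by linarith
      have small1: "norm (Z t) \<le> exp (- (\<eta> * min (t - te) (T - t) / en n))" if t: "t \<in> {te..T}" for t
      proof -
        have "C0 * r0 * exp (- (\<eta> * min (t - te) (T - t) / en n)) \<le> 1 * exp (- (\<eta> * min (t - te) (T - t) / en n))"
          by (rule mult_right_mono[OF r0(3)]) simp
        with bound[OF t] show ?thesis by linarith
      qed
      obtain X where X: "trajectory f D (en n) X" "{te..T} \<subseteq> fst X" "\<And>t. t \<in> {te..T} \<Longrightarrow> snd X t - snd (Xc n) t = Z t"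
        using T.trajectory_from_deviation[OF Z(1) cd(3) less_imp_le[OF T(2)] T(3) small] by blast
      have ends: "te \<in> {te..T}" "T \<in> {te..T}" using T by auto
      have "exp (- (\<gamma> / en n)) \<le> r0" using e2(2)[of "en n"] T.e(1) elim(1) r0(1) by (simp add: field_simps)
      then have "tuned_passage te ts \<eta> \<delta> \<gamma> n X T"
        unfolding tuned_passage_def using X Z(2-4) small1 ends by auto
      then show ?case by blast
    qed
  qed
  moreover have "a < ts - \<delta>0" using \<delta>0 order by (simp add: field_simps)
  ultimately show thesis using that[OF env(1) \<delta>0(1)] by blast
qed

text \<open>
  Used for maximality. A trajectory that stays close to the canard on all of \<open>[p, q]\<close>
  has a deviation of at most 1 at each end. If \<open>[p, q]\<close> is attracting, the deviation
  at \<open>q\<close> is therefore exponentially small; if a final piece of \<open>[p, q]\<close>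
  is repelling, so is the deviation before that piece. One \<open>\<gamma>\<close> out of four is
  spent on the error of the rates and one on the constants.
\<close>
lemma ends_exponentially_small:
  assumes X: "eventually (\<lambda>n. trajectory f D (en n) (X n)) ultra"
    and pq: "p \<in> S" "q \<in> S" "p < q" and \<gamma>: "\<gamma> > 0"
    and close: "\<And>r. r > 0 \<Longrightarrow> eventually (\<lambda>n. \<forall>t\<in>{p..q}. t \<in> fst (X n) \<and> t \<in> fst (Xc n) \<and> dev X n t < r) ultra"
  shows "integral {p..q} fast \<le> - (4 * \<gamma>) \<Longrightarrow> eventually (\<lambda>n. dev X n q < exp (- (\<gamma> / en n))) ultra"
    and "\<And>m. p \<le> m \<Longrightarrow> m < q \<Longrightarrow> (\<And>T. p \<le> T \<Longrightarrow> T \<le> m \<Longrightarrow> integral {T..q} slow \<ge> 4 * \<gamma>) \<Longrightarrow>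
      eventually (\<lambda>n. \<forall>T. p \<le> T \<and> T \<le> m \<longrightarrow> dev X n T < exp (- (\<gamma> / en n))) ultra"
proof -
  define \<eta> where "\<eta> = \<gamma> / (q - p)"
  have \<eta>: "\<eta> > 0" "\<eta> * (q - p) = \<gamma>" using \<gamma> pq by (auto simp: \<eta>_def)
  obtain C1 \<rho>1 e1 where C1: "C1 > 0" "\<rho>1 > 0" "e1 > 0" and up: "\<And>e s t Y. 0 < e \<and> e < e1 \<and> p \<le> s \<and> s \<le> t \<and> t \<le> q \<and>
    near_linear A \<rho>1 e s t Y \<Longrightarrow> norm (Y t) \<le> C1 * norm (Y s) * exp ((integral {s..t} fast + \<eta> * (t - s)) / e)"
    using growth_upper[OF cont_sub[OF pq(1,2)] \<eta>(1)] by blast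
  obtain C2 \<rho>2 e2 where C2: "C2 > 0" "\<rho>2 > 0" "e2 > 0" and low: "\<And>e s t Y. 0 < e \<and> e < e2 \<and> p \<le> s \<and> s \<le> t \<and> t \<le> q \<and>
    near_linear A \<rho>2 e s t Y \<Longrightarrow> norm (Y s) \<le> C2 * norm (Y t) * exp ((- integral {s..t} slow + \<eta> * (t - s)) / e)"
    using growth_lower[OF cont_sub[OF pq(1,2)] \<eta>(1)] by blast
  define \<rho> where "\<rho> = min \<rho>1 \<rho>2"
  have \<rho>: "\<rho> > 0" "\<rho> \<le> \<rho>1" "\<rho> \<le> \<rho>2" using C1 C2 by (auto simp: \<rho>_def)
  obtain r where r: "r > 0" "linear_tube f D \<psi> A p q \<rho> r" using tube_exists[OF pq(1,2) \<rho>(1)] by blast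
  define s where "s = min 1 (r / 2)"
  have s: "s > 0" "s \<le> 1" "s \<le> r / 2" using r by (auto simp: s_def)
  obtain e3 where e3: "e3 > 0" "\<And>e. 0 < e \<Longrightarrow> e < e3 \<Longrightarrow> max C1 C2 * exp (- (\<gamma> / e)) < 1"
    using small_exponential[of "max C1 C2" \<gamma>] C1 \<gamma> by (metis less_max_iff_disj)
  have e123: "min (min e1 e2) e3 > 0" using C1 C2 e3 by simp
  have both: "eventually (\<lambda>n. (0 < en n \<and> en n < min (min e1 e2) e3) \<and> (\<forall>t\<in>{p..q}. dev X n t \<le> 1) \<and>
      (\<forall>u v. p \<le> u \<and> u \<le> v \<and> v \<le> q \<longrightarrow>
        near_linear A \<rho>1 (en n) u v (\<lambda>t. snd (X n) t - snd (Xc n) t) \<and>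
        near_linear A \<rho>2 (en n) u v (\<lambda>t. snd (X n) t - snd (Xc n) t))) ultra"
    using X close[OF s(1)] en_small[OF e123] eventually_canard_tube[OF pq(1,2) \<rho>(1) r]
  proof eventually_elim
    case (elim n)
    interpret T: canard_tube f D \<psi> A p q \<rho> r "en n" "fst (Xc n)" "snd (Xc n)" by (fact elim(4))
    have sx: "solution f D (en n) (fst (X n), snd (X n))" using elim(1) by (simp add: trajectory_def)
    have nl: "near_linear A \<rho> (en n) u v (\<lambda>t. snd (X n) t - snd (Xc n) t)" if uv: "p \<le> u" "u \<le> v" "v \<le> q" for u v
    proof (rule T.solves_near_linear[OF T.deviation_solves[OF sx uv(1,3)] uv(1,3)])
      show "{u..v} \<subseteq> fst (X n)" using elim(2) uv by auto
      show "norm (snd (X n) \<tau> - snd (Xc n) \<tau>) \<le> r / 2" if "\<tau> \<in> {u..v}" for \<tau>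
        using elim(2)[rule_format, of \<tau>] that uv s by auto
    qed
    have "near_linear A \<rho>1 (en n) u v (\<lambda>t. snd (X n) t - snd (Xc n) t) \<and>
        near_linear A \<rho>2 (en n) u v (\<lambda>t. snd (X n) t - snd (Xc n) t)" if uv: "p \<le> u \<and> u \<le> v \<and> v \<le> q" for u v
      using near_linear_subset[OF nl order_refl order_refl] uv \<rho> by blast
    moreover have "\<forall>t\<in>{p..q}. dev X n t \<le> 1" using elim(2) s by force
    ultimately show ?case using T.e(1) elim(3) by blast
  qed
  have final: "x < exp (- (\<gamma> / e))" if x: "x \<le> C * y * exp (z / e)" and C: "0 < C" "C \<le> max C1 C2" and y: "y \<le> 1" "0 \<le> y"
    and z: "z \<le> - (2 * \<gamma>)" and e: "0 < e" "e < e3" for x y z C e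
  proof -
    have "exp (z / e) \<le> exp (- (2 * \<gamma> / e))" by (rule exp_quotient_le[OF e(1) z])
    also have "\<dots> = exp (- (\<gamma> / e)) * exp (- (\<gamma> / e))" by (simp flip: exp_add)
    finally have 1: "exp (z / e) \<le> exp (- (\<gamma> / e)) * exp (- (\<gamma> / e))" .
    have "C * y * exp (z / e) \<le> max C1 C2 * 1 * (exp (- (\<gamma> / e)) * exp (- (\<gamma> / e)))"
      using C y 1 by (intro mult_mono) auto
    also have "\<dots> = (max C1 C2 * exp (- (\<gamma> / e))) * exp (- (\<gamma> / e))" by simp
    also have "\<dots> < 1 * exp (- (\<gamma> / e))" using e3(2)[OF e] by (intro mult_strict_right_mono) auto
    finally show ?thesis using x by linarith
  qed
  show "eventually (\<lambda>n. dev X n q < exp (- (\<gamma> / en n))) ultra" if i: "integral {p..q} fast \<le> - (4 * \<gamma>)"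
    using both
  proof eventually_elim
    case (elim n)
    have "dev X n q \<le> C1 * dev X n p * exp ((integral {p..q} fast + \<eta> * (q - p)) / en n)"
      by (rule up) (use elim pq in auto)
    then show ?case
      by (rule final) (use elim C1 pq i \<eta> \<gamma> in auto)
  qed
  show "eventually (\<lambda>n. \<forall>T. p \<le> T \<and> T \<le> m \<longrightarrow> dev X n T < exp (- (\<gamma> / en n))) ultra"
    if m: "p \<le> m" "m < q" and i: "\<And>T. p \<le> T \<Longrightarrow> T \<le> m \<Longrightarrow> integral {T..q} slow \<ge> 4 * \<gamma>" for m
    using both
  proof eventually_elim
    case (elim n)
    show ?case
    proof (intro allI impI; elim conjE)
      fix T assume T: "p \<le> T" "T \<le> m"
      have "dev X n T \<le> C2 * dev X n q * exp ((- integral {T..q} slow + \<eta> * (q - T)) / en n)"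
        by (rule low) (use elim T m in auto)
      moreover have "\<eta> * (q - T) \<le> \<gamma>" using mult_left_mono[of "q - T" "q - p" \<eta>] \<eta> T by simp
      ultimately show "dev X n T < exp (- (\<gamma> / en n))"
        by (intro final[of "dev X n T" C2 "dev X n q"]) (use elim C2 pq T m i[OF T] \<gamma> in auto)
    qed
  qed
qed

text \<open>
  The passages with exit times within \<open>\<delta>0 / (k + 1)\<close> of \<open>ts\<close> and
  \<open>\<gamma> = 1 / (k + 1)\<close> exist for every standard \<open>k\<close>, hence for an
  infinitely large one. Such a passage exits at a time infinitely close to \<open>ts\<close>, and
  it cannot go along a larger interval, since its deviation at \<open>te\<close> or at the exit
  time would then be at most \<open>exp (- \<gamma> / \<epsilon>)\<close> for a standard
  \<open>\<gamma> > 0\<close>.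
\<close>
lemma exit_realized:
  assumes te: "te \<in> S" "ts \<in> S" "te < ts"
    and int: "integral {te..ts} slow \<le> 0" "0 \<le> integral {te..ts} fast"
  shows "\<exists>X. eventually (\<lambda>n. trajectory f D (en n) (X n)) ultra \<and>
    goes_along_exactly \<phi> Dt (ereal te) (ereal ts) (abs_star X)"
proof -
  note order = entry_before_exit_after[OF te int]
  obtain \<eta> \<delta>0 where \<eta>: "\<eta> > 0" "\<delta>0 > 0" "a < ts - \<delta>0"
    and passages: "\<And>\<delta> \<gamma>. 0 < \<delta> \<Longrightarrow> \<delta> \<le> \<delta>0 \<Longrightarrow> 0 < \<gamma> \<Longrightarrow> eventually (\<lambda>n. \<exists>X T. tuned_passage te ts \<eta> \<delta> \<gamma> n X T) ultra"
    using tuned_passages_exist[OF te int] by metis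
  define w where "w = (\<lambda>k::nat. 1 / real (Suc k))"
  have w: "w k > 0" "w k \<le> 1" for k by (auto simp: w_def)
  have w_small: "\<exists>K. \<forall>k\<ge>K. w k < x" if x: "x > 0" for x
  proof -
    obtain K where K: "inverse (real (Suc K)) < x" using reals_Archimedean[OF x] by blast
    have "w k < x" if "k \<ge> K" for k
    proof -
      have "w k \<le> w K" using that by (simp add: w_def frac_le)
      then show ?thesis using K by (simp add: w_def inverse_eq_divide)
    qed
    then show ?thesis by blast
  qed
  have "eventually (\<lambda>n. \<exists>X T. tuned_passage te ts \<eta> (\<delta>0 * w k) (w k) n X T) ultra" for k
    by (rule passages) (use \<eta> w[of k] in auto)
  then obtain \<kappa> where \<kappa>: "\<And>K. eventually (\<lambda>n. K \<le> \<kappa> n) ultra"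
    and ev: "eventually (\<lambda>n. \<exists>X T. tuned_passage te ts \<eta> (\<delta>0 * w (\<kappa> n)) (w (\<kappa> n)) n X T) ultra"
    using ultra_diagonal[of "\<lambda>n k. \<exists>X T. tuned_passage te ts \<eta> (\<delta>0 * w k) (w k) n X T"] by blast
  define Z where "Z = (\<lambda>n. SOME p. tuned_passage te ts \<eta> (\<delta>0 * w (\<kappa> n)) (w (\<kappa> n)) n (fst p) (snd p))"
  define X where "X = (\<lambda>n. fst (Z n))"
  define T where "T = (\<lambda>n. snd (Z n))"
  have XT: "eventually (\<lambda>n. tuned_passage te ts \<eta> (\<delta>0 * w (\<kappa> n)) (w (\<kappa> n)) n (X n) (T n)) ultra"
    using ev
  proof eventually_elim
    case (elim n)
    then have "\<exists>p. tuned_passage te ts \<eta> (\<delta>0 * w (\<kappa> n)) (w (\<kappa> n)) n (fst p) (snd p)" by auto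
    from someI_ex[OF this] show ?case unfolding X_def T_def Z_def .
  qed
  have wk: "eventually (\<lambda>n. w (\<kappa> n) < x) ultra" if x: "x > 0" for x
  proof -
    obtain K where K: "\<And>k. k \<ge> K \<Longrightarrow> w k < x" using w_small[OF x] by blast
    show ?thesis using \<kappa>[of K] by (rule eventually_mono) (rule K)
  qed
  have traj: "eventually (\<lambda>n. trajectory f D (en n) (X n)) ultra"
    using XT by (rule eventually_mono) (simp add: tuned_passage_def)
  have Tn: "eventually (\<lambda>n. \<bar>T n - ts\<bar> < x) ultra" if x: "x > 0" for x
  proof -
    have "x / \<delta>0 > 0" using x \<eta> by simp
    from XT wk[OF this] show ?thesis
    proof eventually_elim
      case (elim n)
      have "\<delta>0 * w (\<kappa> n) < x" using elim(2) \<eta>(2) by (simp add: field_simps)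
      then show ?case using elim(1) by (auto simp: tuned_passage_def)
    qed
  qed
  have DtS: "of_real s \<in> Dt" if "te < s" "s < ts" for s
    using S_interval[OF te(1,2), of s] that S_Dt by auto
  have along: "goes_along \<phi> Dt (ereal te) (ereal ts) (abs_star X)"
    unfolding goes_along_iff
  proof (intro conjI allI impI)
    show "ereal te < ereal ts" using te by simp
    show "of_real s \<in> Dt" if "ereal te < ereal s \<and> ereal s < ereal ts" for s using DtS that by simp
    fix c d r assume "ereal te < ereal c \<and> c \<le> d \<and> ereal d < ereal ts \<and> 0 < (r::real)"
    then have cd: "te < c" "c \<le> d" "d < ts" and r: "r > 0" by auto
    have cdS: "c \<in> S" "d \<in> S" using S_interval[OF te(1,2)] cd by auto
    define m where "m = min (c - te) ((ts - d) / 2)"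
    have "m > 0" using cd by (simp add: m_def)
    moreover have "m \<le> c - te" "m \<le> (ts - d) / 2" unfolding m_def by (rule min.cobounded1, rule min.cobounded2)
    ultimately have m: "m > 0" "m \<le> c - te" "m \<le> (ts - d) / 2" by auto
    have pos: "2 / r > 0" "\<eta> * m > 0" "r / 2 > 0" "(ts - d) / 2 > 0" using r \<eta> m cd by auto
    obtain e0 where e0: "e0 > 0" "\<And>e. 0 < e \<Longrightarrow> e < e0 \<Longrightarrow> 2 / r * exp (- (\<eta> * m / e)) < 1"
      using small_exponential[OF pos(1,2)] by metis
    show "eventually (\<lambda>n. \<forall>s\<in>{c..d}. s \<in> fst (X n) \<and> norm (cvec (snd (X n) s) - \<phi> (of_real s)) < r) ultra"
      using XT Tn[OF pos(4)] en_pos en_small[OF e0(1)] canard_close_real[OF cdS pos(3)]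
    proof eventually_elim
      case (elim n)
      show ?case
      proof
        fix s assume s: "s \<in> {c..d}"
        have s1: "c \<le> s" "s \<le> d" using s by auto
        have "- (T n - ts) < (ts - d) / 2" using elim(2) by (simp only: abs_less_iff)
        then have "2 * ts < 2 * T n + (ts - d)" by (simp add: field_simps)
        moreover have "2 * m \<le> ts - d" using m(3) by simp
        ultimately have sT: "m \<le> s - te" "m \<le> T n - s" using s1 m(2) by linarith+
        then have st: "s \<in> {te..T n}" using m by auto
        have "dev X n s \<le> exp (- (\<eta> * min (s - te) (T n - s) / en n))"
          using elim(1) st by (simp add: tuned_passage_def)
        also have "\<dots> \<le> exp (- (\<eta> * m / en n))"
          using sT \<eta> elim(3) by (simp add: divide_right_mono mult_left_mono)
        also have "\<dots> < r / 2" using e0(2)[OF elim(3,4)] r by (simp add: field_simps)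
        finally have "dev X n s < r / 2" .
        moreover have "norm (snd (Xc n) s - \<psi> s) < r / 2" using elim(5) s by blast
        moreover have "norm (cvec (snd (X n) s) - \<phi> (of_real s)) \<le> dev X n s + norm (snd (Xc n) s - \<psi> s)"
          by (rule dev_vs_curve(1)) (use S_interval[OF cdS] s in auto)
        moreover have "s \<in> fst (X n)" using elim(1) st by (auto simp: tuned_passage_def)
        ultimately show "s \<in> fst (X n) \<and> norm (cvec (snd (X n) s) - \<phi> (of_real s)) < r" by linarith
      qed
    qed
  qed
  have max: "t1 = ereal te \<and> t2 = ereal ts"
    if t12: "t1 \<le> ereal te" "ereal ts \<le> t2" and al: "goes_along \<phi> Dt t1 t2 (abs_star X)" for t1 t2
  proof (rule ccontr)
    assume "\<not> (t1 = ereal te \<and> t2 = ereal ts)"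
    then consider "t1 < ereal te" | "ereal ts < t2" using t12 by force
    then show False
    proof cases
      case 1
      obtain p0 where p0: "t1 < p0" "p0 < ereal te" using dense[OF 1] by blast
      obtain p where p: "p0 = ereal p" using p0 by (cases p0) auto
      have "ereal p < t2" using p0 p te(3) t12 by (metis ereal_less_eq(3) less_imp_le less_le_trans order_trans)
      then have pS: "p \<in> S" using al p0 p unfolding goes_along_iff S_Dt by blast
      have pt: "p < te" using p0 p by simp
      have tet2: "ereal te < t2" using te(3) t12(2) by (metis ereal_less(2) less_ereal.simps(1) less_le_trans)
      define \<gamma> where "\<gamma> = - integral {p..te} fast / 4"
      have \<gamma>: "\<gamma> > 0" using integral_fast_neg[OF pS te(1) _ pt] order by (simp add: \<gamma>_def)
      have "eventually (\<lambda>n. dev X n te < exp (- (\<gamma> / en n))) ultra"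
        by (rule ends_exponentially_small(1)[OF traj pS te(1) pt \<gamma>])
          (use along_dev_small[OF al _ _ tet2] p0 p pt in \<open>auto simp: \<gamma>_def\<close>)
      from this XT wk[OF \<gamma>] en_pos have "eventually (\<lambda>n. False) ultra"
      proof eventually_elim
        case (elim n)
        have "exp (- (\<gamma> / en n)) \<le> exp (- (w (\<kappa> n) / en n))" using elim by (simp add: divide_right_mono)
        also have "\<dots> \<le> dev X n te" using elim(2) by (simp add: tuned_passage_def)
        finally show False using elim(1) by simp
      qed
      then show False using ultra_ex by blast
    next
      case 2
      obtain q0 where q0: "ereal ts < q0" "q0 < t2" using dense[OF 2] by blast
      obtain q where q: "q0 = ereal q" using q0 by (cases q0) auto
      have qt: "ts < q" using q0 q by simp
      have "t1 < ereal q" using t12(1) te(3) qt by (metis ereal_less_eq(3) le_less_trans less_ereal.simps(1) less_trans)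
      then have qS: "q \<in> S" using al q0 q unfolding goes_along_iff S_Dt by blast
      define p where "p = max (ts - \<delta>0) ((te + ts) / 2)"
      define m where "m = (ts + q) / 2"
      have pm: "te < p" "p < ts" "a < p" "ts < m" "m < q" using \<eta> te qt by (auto simp: p_def m_def max_def)
      have t1p: "t1 < ereal p" using t12(1) pm(1) by (metis le_less_trans less_ereal.simps(1))
      have pS: "p \<in> S" "m \<in> S" using S_interval[OF te(1) qS] pm by auto
      have pq: "p < q" using pm qt by simp
      define \<gamma> where "\<gamma> = integral {m..q} slow / 4"
      have \<gamma>: "\<gamma> > 0" using integral_slow_pos[OF pS(2) qS _ pm(5)] pm by (simp add: \<gamma>_def)
      have small: "eventually (\<lambda>n. \<forall>T. p \<le> T \<and> T \<le> m \<longrightarrow> dev X n T < exp (- (\<gamma> / en n))) ultra"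
      proof (rule ends_exponentially_small(2)[OF traj pS(1) qS pq \<gamma>])
        show "eventually (\<lambda>n. \<forall>t\<in>{p..q}. t \<in> fst (X n) \<and> t \<in> fst (Xc n) \<and> dev X n t < r) ultra" if "r > 0" for r
          by (rule along_dev_small[OF al t1p _ _ that]) (use pq q0 q in auto)
        show "p \<le> m" "m < q" using pm by auto
        fix T assume T: "p \<le> T" "T \<le> m"
        have TS: "T \<in> S" using S_interval[OF pS] T by blast
        have "integral {T..q} slow = integral {T..m} slow + integral {m..q} slow"
          by (rule integral_split[OF cont_slow[OF TS qS]]) (use T pm in auto)
        moreover have "integral {T..m} slow \<ge> 0"
          using integral_slow_pos[OF TS pS(2)] T pm by (cases "T = m") auto
        ultimately show "integral {T..q} slow \<ge> 4 * \<gamma>" by (simp add: \<gamma>_def)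
      qed
      have x: "min (ts - p) (m - ts) > 0" using pm by simp
      have "eventually (\<lambda>n. False) ultra"
        using small XT Tn[OF x] wk[OF \<gamma>] en_pos
      proof eventually_elim
        case (elim n)
        have "\<bar>T n - ts\<bar> < ts - p" "\<bar>T n - ts\<bar> < m - ts" using elim(3) by simp_all
        then have "p \<le> T n" "T n \<le> m" by linarith+
        then have "dev X n (T n) < exp (- (\<gamma> / en n))" using elim(1) by blast
        also have "exp (- (\<gamma> / en n)) \<le> exp (- (w (\<kappa> n) / en n))" using elim by (simp add: divide_right_mono)
        also have "\<dots> \<le> dev X n (T n)" using elim(2) by (simp add: tuned_passage_def)
        finally show False by simp
      qed
      then show False using ultra_ex by blast
    qed
  qed
  show ?thesis
    using traj along max unfolding goes_along_exactly_def by blast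
qed

end

theorem proposition4:
  fixes f :: field and D :: "(complex \<times> (complex^2) \<times> complex) set"
    and \<phi> :: "complex \<Rightarrow> complex^2" and Dt :: "complex set"
    and tm tM :: ereal and a b :: real
    and lam mu :: "complex \<Rightarrow> complex"
    and \<epsilon> :: "real star"
  assumes "HFN1 f D"
    and "HFN2 \<epsilon>"
    and "HFN3 f D \<phi> Dt tm tM"
    and "HFN4 f \<phi> Dt tm tM a b lam mu"
    and "HFN5 Dt a b lam mu"
    and big_canard: "\<exists>Xc. starP2 (solution f D) \<epsilon> Xc \<and> goes_along \<phi> Dt tm tM Xc"
  shows "(\<forall>X (te::real) (ts::real).
            starP2 (trajectory f D) \<epsilon> X \<and> goes_along_exactly \<phi> Dt (ereal te) (ereal ts) X \<and>
            tm < ereal te \<and> ereal ts < tM \<longrightarrow>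
              integral {te..ts} (\<lambda>\<tau>. Re (lam (of_real \<tau>))) \<le> 0 \<and>
              0 \<le> integral {te..ts} (\<lambda>\<tau>. Re (mu (of_real \<tau>))))
       \<and> (\<forall>(te::real) (ts::real).
            te < ts \<and> tm < ereal te \<and> ereal ts < tM \<and>
            integral {te..ts} (\<lambda>\<tau>. Re (lam (of_real \<tau>))) \<le> 0 \<and>
            0 \<le> integral {te..ts} (\<lambda>\<tau>. Re (mu (of_real \<tau>))) \<longrightarrow>
              (\<exists>X. starP2 (trajectory f D) \<epsilon> X \<and>
                   goes_along_exactly \<phi> Dt (ereal te) (ereal ts) X))"
proof -
  obtain en where en: "\<epsilon> = abs_star en" by (rule star_exhaust)
  obtain Xc' where Xc': "starP2 (solution f D) \<epsilon> Xc'" "goes_along \<phi> Dt tm tM Xc'" using big_canard by blast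
  obtain Xc where Xc: "Xc' = abs_star Xc" by (rule star_exhaust)
  interpret canard_problem f D \<phi> Dt tm tM a b lam mu en Xc
  proof
    show "eventually (\<lambda>n. 0 < en n) ultra"
      using assms(2) unfolding HFN2_def en starP.abs_eq by blast
    show "eventually (\<lambda>n. en n < r) ultra" if "r > 0" for r
    proof -
      have "eventually (\<lambda>n. norm (en n) < r) ultra"
        using assms(2) that unfolding HFN2_def en infinitesimal_abs by blast
      then show ?thesis by (rule eventually_mono) simp
    qed
    show "eventually (\<lambda>n. solution f D (en n) (Xc n)) ultra"
      using Xc'(1) unfolding en Xc starP2.abs_eq .
    show "goes_along \<phi> Dt tm tM (abs_star Xc)" using Xc'(2) unfolding Xc .
  qed (fact assms)+
  have inS: "te \<in> S" "ts \<in> S" if "te < ts" "tm < ereal te" "ereal ts < tM" for te ts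
    using that unfolding S_def by (auto intro: less_trans[of _ "ereal te"] less_trans[of _ "ereal ts"])
  show ?thesis
  proof (intro conjI allI impI; elim conjE)
    fix X te ts
    assume X: "starP2 (trajectory f D) \<epsilon> X" and ex: "goes_along_exactly \<phi> Dt (ereal te) (ereal ts) X"
      and t: "tm < ereal te" "ereal ts < tM"
    obtain x where x: "X = abs_star x" by (rule star_exhaust)
    have tr: "eventually (\<lambda>n. trajectory f D (en n) (x n)) ultra"
      using X unfolding en x starP2.abs_eq .
    have lt: "te < ts" using ex unfolding goes_along_exactly_def goes_along_def by simp
    note res = exit_inequalities[OF tr ex[unfolded x] inS[OF lt t]]
    show "integral {te..ts} (\<lambda>\<tau>. Re (lam (of_real \<tau>))) \<le> 0"
      unfolding integral_rates[OF inS[OF lt t]] by (rule res)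
    show "0 \<le> integral {te..ts} (\<lambda>\<tau>. Re (mu (of_real \<tau>)))"
      unfolding integral_rates[OF inS[OF lt t]] by (rule res)
  next
    fix te ts
    assume t: "te < ts" "tm < ereal te" "ereal ts < tM"
      and "integral {te..ts} (\<lambda>\<tau>. Re (lam (of_real \<tau>))) \<le> 0" "0 \<le> integral {te..ts} (\<lambda>\<tau>. Re (mu (of_real \<tau>)))"
    then have int: "integral {te..ts} slow \<le> 0" "0 \<le> integral {te..ts} fast"
      unfolding integral_rates[OF inS[OF t]] by auto
    obtain x where "eventually (\<lambda>n. trajectory f D (en n) (x n)) ultra"
      "goes_along_exactly \<phi> Dt (ereal te) (ereal ts) (abs_star x)"
      using exit_realized[OF inS[OF t] t(1) int] by blast
    then show "\<exists>X. starP2 (trajectory f D) \<epsilon> X \<and> goes_along_exactly \<phi> Dt (ereal te) (ereal ts) X"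
      unfolding en by (intro exI[of _ "abs_star x"]) (simp add: starP2.abs_eq)
  qed
qed

end
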